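(* Let $\Omega\subseteq\mathbb{R}^n$ be open and bounded and let $F\colon\mathcal{S}^n\times\Omega\to\overline{\mathbb{R}}$ be elliptic at $0$. Suppose that for each $x_0\in\Omega$ we have $\emptyset\neq\partial\Theta_+(x_0)=\partial\Theta_-(x_0)$ and $$\lim_{t\to0^+}\ \sup_{x,y\in B_t(x_0)}\mathrm{d}_{t|x-y|^{-2}}\big(\Theta_+(x),\Theta_+(y)\big)=0 .$$ Then the comparison principle holds for the equation $F(\mathcal{H}w,x)=0$ in $\Omega$.
   Context: $\mathcal{S}^n$ is the space of real symmetric $n\times n$ matrices with its usual partial order ($X\le Y$ iff $Y-X$ is positive semidefinite), $|X|$ is the operator norm (largest absolute value of an eigenvalue), $\overline{\mathbb{R}}=\mathbb{R}\cup\{-\infty,\infty\}$, $\mathcal{H}w$ is the Hessian matrix of $w$, and $B_t(x_0)$ is the open ball in $\mathbb{R}^n$ ($t$ so small that $B_t(x_0)\subseteq\Omega$). $F$ is elliptic at $0$ if for all $x\in\Omega$ and $X\le Y$ in $\mathcal{S}^n$: $0\le F(X,x)$ implies $0\le F(Y,x)$, and $0<F(X,x)$ implies $0<F(Y,x)$. $\Theta_-(x):=\{X\in\mathcal{S}^n : F(X,x)\le 0\}$ and $\Theta_+(x):=\{X\in\mathcal{S}^n : F(X,x)\ge 0\}$; $\partial$ is the topological boundary in $\mathcal{S}^n$. $\operatorname{dist}(X,\Theta):=\inf_{Y\in\Theta}|X-Y|$ (operator norm). For $R\in(0,\infty]$, the bounded Hausdorff distance is $$\mathrm{d}_R(\Theta_1,\Theta_2):=\sup_{|X|<R}\big|\operatorname{dist}(X,\Theta_1)-\operatorname{dist}(X,\Theta_2)\big|;$$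 when $x=y$, $t|x-y|^{-2}$ is interpreted as $\infty$ (and the distance is then $0$). Viscosity solutions: $v\in USC(\overline\Omega)$ is a viscosity subsolution of $F(\mathcal{H}w,x)=0$ in $\Omega$ if, whenever $x_0\in\Omega$ and $\phi$ is a $C^2$ function near $x_0$ with $\phi(x_0)=v(x_0)$ and $\phi\ge v$ near $x_0$, then $F(\mathcal{H}\phi(x_0),x_0)\ge0$. $u\in LSC(\overline\Omega)$ is a viscosity supersolution if, whenever $\phi$ is $C^2$ near $x_0\in\Omega$ with $\phi(x_0)=u(x_0)$ and $\phi\le u$ near $x_0$, then $F(\mathcal{H}\phi(x_0),x_0)\le0$. ($USC$, $LSC$: real-valued upper/lower semicontinuous functions.) The comparison principle holds for the equation in $\Omega$ if: whenever $v\in USC(\overline\Omega)$ is a viscosity subsolution and $u\in LSC(\overline\Omega)$ is a viscosity supersolution in $\Omega$ with $v\le u$ on $\partial\Omega$, then $v\le u$ in $\Omega$. *)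

theory Defs
  imports "HOL-Analysis.Analysis"
begin

section \<open>Symmetric matrices\<close>

definition sym_mats :: "(real^'n^'n) set" where
  "sym_mats = {X. transpose X = X}"

definition pos_semidef :: "real^'n^'n \<Rightarrow> bool" where
  "pos_semidef A \<longleftrightarrow> transpose A = A \<and> (\<forall>v. 0 \<le> v \<bullet> (A *v v))"

definition loewner_le :: "real^'n^'n \<Rightarrow> real^'n^'n \<Rightarrow> bool" where
  "loewner_le X Y \<longleftrightarrow> pos_semidef (Y - X)"

definition op_norm :: "real^'n^'n \<Rightarrow> real" where
  "op_norm X = onorm ((*v) X)"

text \<open>The boundary is taken in the space of symmetric matrices, which is a proper
  subspace (with empty interior) of the space of all matrices as soon as the
  dimension is at least 2.\<close>

definition sym_boundary :: "(real^'n^'n) set \<Rightarrow> (real^'n^'n) set" where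
  "sym_boundary T = (top_of_set sym_mats) frontier_of T"

text \<open>With values in \<^typ>\<open>ereal\<close>, the infimum over the empty set is \<open>\<infinity>\<close>.
  As \<open>\<infinity> - \<infinity> = \<infinity>\<close> in \<^typ>\<open>ereal\<close>, \<open>bdd_hausdorff\<close> below is meaningful
  only for nonempty sets.\<close>

definition mat_dist :: "real^'n^'n \<Rightarrow> (real^'n^'n) set \<Rightarrow> ereal" where
  "mat_dist X T = (INF Y\<in>T. ereal (op_norm (X - Y)))"

definition bdd_hausdorff :: "ereal \<Rightarrow> (real^'n^'n) set \<Rightarrow> (real^'n^'n) set \<Rightarrow> ereal" where
  "bdd_hausdorff R T1 T2 =
     (SUP X\<in>{X\<in>sym_mats. ereal (op_norm X) < R}. \<bar>mat_dist X T1 - mat_dist X T2\<bar>)"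


section \<open>The equation\<close>

text \<open>The operator \<open>F\<close> is a total function here; only its values at symmetric
  matrices and at points of \<open>\<Omega>\<close> are relevant.\<close>

definition elliptic_at_0 :: "(real^'n) set \<Rightarrow> (real^'n^'n \<Rightarrow> real^'n \<Rightarrow> ereal) \<Rightarrow> bool" where
  "elliptic_at_0 \<Omega> F \<longleftrightarrow>
     (\<forall>x\<in>\<Omega>. \<forall>X\<in>sym_mats. \<forall>Y\<in>sym_mats. loewner_le X Y \<longrightarrow>
        (0 \<le> F X x \<longrightarrow> 0 \<le> F Y x) \<and> (0 < F X x \<longrightarrow> 0 < F Y x))"

definition Theta_minus :: "(real^'n^'n \<Rightarrow> real^'n \<Rightarrow> ereal) \<Rightarrow> real^'n \<Rightarrow> (real^'n^'n) set" where
  "Theta_minus F x = {X\<in>sym_mats. F X x \<le> 0}"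

definition Theta_plus :: "(real^'n^'n \<Rightarrow> real^'n \<Rightarrow> ereal) \<Rightarrow> real^'n \<Rightarrow> (real^'n^'n) set" where
  "Theta_plus F x = {X\<in>sym_mats. F X x \<ge> 0}"

definition scaled_radius :: "real \<Rightarrow> real^'n \<Rightarrow> real^'n \<Rightarrow> ereal" where
  "scaled_radius t x y = (if x = y then \<infinity> else ereal (t / (norm (x - y))\<^sup>2))"


section \<open>Viscosity solutions\<close>

definition usc_on :: "'a::topological_space set \<Rightarrow> ('a \<Rightarrow> real) \<Rightarrow> bool" where
  "usc_on S f \<longleftrightarrow> (\<forall>a. openin (top_of_set S) {x\<in>S. f x < a})"

definition lsc_on :: "'a::topological_space set \<Rightarrow> ('a \<Rightarrow> real) \<Rightarrow> bool" where
  "lsc_on S f \<longleftrightarrow> (\<forall>a. openin (top_of_set S) {x\<in>S. f x > a})"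

definition gradient :: "(real^'n \<Rightarrow> real) \<Rightarrow> real^'n \<Rightarrow> real^'n" where
  "gradient \<phi> x = (\<chi> i. frechet_derivative \<phi> (at x) (axis i 1))"

definition hessian :: "(real^'n \<Rightarrow> real) \<Rightarrow> real^'n \<Rightarrow> real^'n^'n" where
  "hessian \<phi> x = jacobian (gradient \<phi>) (at x)"

definition C2_near :: "(real^'n \<Rightarrow> real) \<Rightarrow> real^'n \<Rightarrow> bool" where
  "C2_near \<phi> x0 \<longleftrightarrow>
     (\<exists>U. open U \<and> x0 \<in> U \<and>
        (\<forall>x\<in>U. \<phi> differentiable at x) \<and>
        (\<forall>x\<in>U. gradient \<phi> differentiable at x) \<and>
        continuous_on U (hessian \<phi>))"

definition viscosity_subsolution ::
  "(real^'n) set \<Rightarrow> (real^'n^'n \<Rightarrow> real^'n \<Rightarrow> ereal) \<Rightarrow> (real^'n \<Rightarrow> real) \<Rightarrow> bool" where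
  "viscosity_subsolution \<Omega> F v \<longleftrightarrow>
     usc_on (closure \<Omega>) v \<and>
     (\<forall>x0\<in>\<Omega>. \<forall>\<phi>. C2_near \<phi> x0 \<and> \<phi> x0 = v x0 \<and> (\<forall>\<^sub>F x in nhds x0. \<phi> x \<ge> v x)
        \<longrightarrow> F (hessian \<phi> x0) x0 \<ge> 0)"

definition viscosity_supersolution ::
  "(real^'n) set \<Rightarrow> (real^'n^'n \<Rightarrow> real^'n \<Rightarrow> ereal) \<Rightarrow> (real^'n \<Rightarrow> real) \<Rightarrow> bool" where
  "viscosity_supersolution \<Omega> F u \<longleftrightarrow>
     lsc_on (closure \<Omega>) u \<and>
     (\<forall>x0\<in>\<Omega>. \<forall>\<phi>. C2_near \<phi> x0 \<and> \<phi> x0 = u x0 \<and> (\<forall>\<^sub>F x in nhds x0. \<phi> x \<le> u x)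
        \<longrightarrow> F (hessian \<phi> x0) x0 \<le> 0)"

definition comparison_principle ::
  "(real^'n) set \<Rightarrow> (real^'n^'n \<Rightarrow> real^'n \<Rightarrow> ereal) \<Rightarrow> bool" where
  "comparison_principle \<Omega> F \<longleftrightarrow>
     (\<forall>v u. viscosity_subsolution \<Omega> F v \<and> viscosity_supersolution \<Omega> F u \<and>
        (\<forall>x\<in>frontier \<Omega>. v x \<le> u x) \<longrightarrow> (\<forall>x\<in>\<Omega>. v x \<le> u x))"

end

theory Submission
  imports Defs
begin

text \<open>The variables are doubled: \<open>v(x) + \<epsilon>/2 |x|\<^sup>2 - u(y) - \<alpha>/2 |x - y|\<^sup>2\<close> is maximised, and the theorem
  on sums gives test matrices \<open>X\<close> for \<open>v\<close> and \<open>Y\<close> for \<open>u\<close> at nearby points \<open>x\<close>, \<open>y\<close>, with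
  \<open>X + \<epsilon>/2 \<le> Y\<close> and \<open>|X| = O(\<alpha>)\<close>. As \<open>\<alpha> |x - y|\<^sup>2 \<rightarrow> 0\<close>, the matrix \<open>X\<close> lies in the range in which
  \<open>\<Theta>\<^sub>+(x)\<close> and \<open>\<Theta>\<^sub>+(y)\<close> are close, so that some \<open>X'\<close> in \<open>\<Theta>\<^sub>+(y)\<close> is strictly below \<open>Y\<close> in \<open>\<Theta>\<^sub>-(y)\<close>.
  This contradicts the coincidence of the two boundaries.

  The theorem on sums rests on Alexandrov's theorem and Jensen's lemma. Both are obtained from
  Rademacher's theorem for the resolvent of the subdifferential of a convex function.\<close>

section \<open>Differentiability of Lipschitz functions of one variable\<close>

text \<open>Ellipticity at 0 only makes the sign of \<open>F\<close> monotone in the matrix; it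
  gives neither strict monotonicity nor continuity. Two features of the proof come from this.
  Ordered test matrices alone contradict nothing, so a strict margin is needed: the term with
  \<epsilon> produces it, with \<epsilon> small enough to keep the maximum of the perturbed
  difference inside \<Omega>, and every later error is charged against that margin. Moreover, with
  no continuity of \<open>F\<close> assumed, \<open>F \<ge> 0\<close> cannot simply be passed to a
  limit of jets. The theorem on sums therefore delivers exact jets at approximate maximum points,
  their remainders are absorbed into the matrices, and the contradiction appears at one fixed large
  \<alpha>. Sup-convolution makes a semicontinuous function convex up to a quadratic. The
  subdifferential of a convex function may be multivalued, but its resolvent is everywhere defined,
  single-valued and 1-Lipschitz, so that second derivatives of the function become first derivatives
  of a Lipschitz map.\<close>

text \<open>The lower slope bound makes \<open>H\<close> a bijection of the line. Pushing Lebesgue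
  measure forward along its inverse gives a measure with value \<open>H b - H a\<close> on
  \<open>{a..b}\<close>; it is absolutely continuous because the Lipschitz map \<open>H\<close>
  sends null sets to null sets. The function \<open>g\<close> is its Radon-Nikodym density.\<close>

lemma lipschitz_real_integral_representation:
  fixes H :: "real \<Rightarrow> real"
  assumes lower: "\<And>x y. x \<le> y \<Longrightarrow> y - x \<le> H y - H x"
    and upper: "\<And>x y. x \<le> y \<Longrightarrow> H y - H x \<le> K * (y - x)"
  obtains g where "\<And>a b. a \<le> b \<Longrightarrow> (g has_integral (H b - H a)) {a..b}"
proof -
  have Hlip: "\<bar>H x - H y\<bar> \<le> K * \<bar>x - y\<bar>" for x y
    using lower[of x y] upper[of x y] lower[of y x] upper[of y x] by (cases "x \<le> y") auto
  have K: "K \<ge> 1" using lower[of 0 1] upper[of 0 1] by simp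
  have Hmono: "H x \<le> H y \<longleftrightarrow> x \<le> y" for x y
    using lower[of x y] lower[of y x] by (cases "x \<le> y") auto
  have contH: "continuous_on S H" for S
    using Hlip K by (intro lipschitz_on_continuous_on[of K] lipschitz_onI) (auto simp: dist_real_def)
  have "\<exists>x. H x = z" for z
  proof -
    define M where "M = \<bar>z - H 0\<bar>"
    have "H (- M) \<le> z" "z \<le> H M"
      using lower[of "-M" 0] lower[of 0 M] by (auto simp: M_def)
    then show ?thesis using IVT'[of H "-M" z M] contH by (auto simp: M_def)
  qed
  then have "surj H" by (metis surjI)
  define I where "I = inv H"
  have "inj H" using Hmono by (intro injI antisym) (metis order_refl)+
  then have HI: "H (I z) = z" and IH: "I (H x) = x" for z x
    using \<open>surj H\<close> by (auto simp: I_def surj_f_inv_f)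
  have Imono: "I x \<le> I y \<longleftrightarrow> x \<le> y" for x y
    using Hmono[of "I x" "I y"] by (simp add: HI)
  have [measurable]: "I \<in> borel_measurable borel"
    by (rule borel_measurable_mono) (simp add: mono_def Imono)
  define \<mu> where "\<mu> = distr lborel borel I"
  have [measurable_cong, simp]: "sets \<mu> = sets borel" by (simp add: \<mu>_def)
  have Icc: "emeasure \<mu> {a..b} = ennreal (H b - H a)" if "a \<le> b" for a b
  proof -
    have "I x \<in> {a..b} \<longleftrightarrow> x \<in> {H a..H b}" for x
      using Hmono[of a "I x"] Hmono[of "I x" b] by (simp add: HI)
    then have "I -` {a..b} = {H a..H b}" by auto
    then show ?thesis using that Hmono by (simp add: \<mu>_def emeasure_distr)
  qed
  have "absolutely_continuous lborel \<mu>"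
    unfolding absolutely_continuous_def
  proof
    fix N assume N: "N \<in> null_sets (lborel :: real measure)"
    then have Nb[measurable]: "N \<in> sets borel" by auto
    have "negligible (H ` N)"
    proof (rule negligible_locally_Lipschitz_image)
      show "negligible N" using N by (simp add: negligible_iff_null_sets null_sets_completionI)
      show "\<exists>T B. open T \<and> x \<in> T \<and> (\<forall>y\<in>N \<inter> T. norm (H y - H x) \<le> B * norm (y - x))" for x
        using Hlip by (intro exI[of _ UNIV] exI[of _ K]) auto
    qed simp
    moreover have "H ` N = I -` N"
    proof -
      have "x \<in> H ` N" if "I x \<in> N" for x using that HI[of x] by (metis imageI)
      then show ?thesis using IH by auto
    qed
    moreover have "I -` N \<in> sets borel" using measurable_sets[of I borel borel N] by simp
    ultimately have "I -` N \<in> null_sets lborel"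
      by (simp add: negligible_iff_null_sets null_sets_completion_iff)
    then show "N \<in> null_sets \<mu>" by (auto simp: \<mu>_def null_sets_def emeasure_distr)
  qed
  then obtain g where g[measurable]: "g \<in> borel_measurable lborel" and dens: "density lborel g = \<mu>"
    using sigma_finite_measure.Radon_Nikodym[OF sigma_finite_lborel, of \<mu>] by auto
  have nn: "(\<integral>\<^sup>+x. g x * indicator {a..b} x \<partial>lborel) = ennreal (H b - H a)" if "a \<le> b" for a b
    using Icc[OF that] by (simp flip: dens add: emeasure_density)
  have "((\<lambda>x. enn2real (g x)) has_integral (H b - H a)) {a..b}" if "a \<le> b" for a b
  proof -
    \<comment> \<open>The density has values in \<open>ennreal\<close>. It is finite almost
      everywhere on a bounded interval since its integral there is finite, so
      \<open>enn2real\<close> changes it only on a null set.\<close>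
    have "AE x in lborel. g x * indicator {a..b} x \<noteq> \<infinity>"
      using nn[OF that] by (intro nn_integral_PInf_AE) auto
    then have "(\<integral>\<^sup>+x. ennreal (if x \<in> {a..b} then enn2real (g x) else 0) \<partial>lborel)
        = (\<integral>\<^sup>+x. g x * indicator {a..b} x \<partial>lborel)"
      by (intro nn_integral_cong_AE) (auto simp: indicator_def less_top)
    then have "((\<lambda>x. if x \<in> {a..b} then enn2real (g x) else 0) has_integral (H b - H a)) UNIV"
      using nn[OF that] Hmono[of a b] that by (intro nn_integral_has_integral) auto
    then show ?thesis by (simp only: has_integral_restrict_UNIV)
  qed
  then show thesis by (rule that)
qed

text \<open>Adding \<open>(K + 1) * x\<close> raises all slopes to at least 1, so the sum is an
  indefinite integral, and Lebesgue's differentiation theorem applies to it.\<close>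

lemma lipschitz_real_ae_differentiable:
  fixes f :: "real \<Rightarrow> real"
  assumes lip: "\<And>x y. \<bar>f x - f y\<bar> \<le> K * \<bar>x - y\<bar>"
  shows "negligible {x. \<not> f differentiable (at x)}"
proof -
  define H where "H x = f x + (K + 1) * x" for x
  have "y - x \<le> H y - H x" "H y - H x \<le> (2 * K + 1) * (y - x)" if "x \<le> y" for x y
    using lip[of x y] that by (auto simp: H_def abs_le_iff algebra_simps)
  then obtain g where g: "\<And>a b. a \<le> b \<Longrightarrow> (g has_integral (H b - H a)) {a..b}"
    using lipschitz_real_integral_representation[of H "2 * K + 1"] by blast
  have gi: "g integrable_on cbox a b" for a b
    using g[of a b] by (cases "a \<le> b") auto
  \<comment> \<open>The differentiation theorem is used for intervals to the right of a point;
    applied to the reflected density, it controls the quotients from the left.\<close>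
  then have gi': "(\<lambda>x. g (- x)) integrable_on cbox a b" for a b
    using integrable_reflect[of g "-a" "-b"] gi[of "-b" "-a"] by simp
  obtain N where N: "negligible N" and
    N': "\<And>x e. \<lbrakk>x \<notin> N; 0 < e\<rbrakk> \<Longrightarrow> \<exists>d>0. \<forall>h. 0 < h \<and> h < d \<longrightarrow>
       norm (integral (cbox x (x + h *\<^sub>R One)) g /\<^sub>R h ^ DIM(real) - g x) < e"
    using integrable_ccontinuous_explicit[OF gi] by blast
  obtain M where M: "negligible M" and
    M': "\<And>x e. \<lbrakk>x \<notin> M; 0 < e\<rbrakk> \<Longrightarrow> \<exists>d>0. \<forall>h. 0 < h \<and> h < d \<longrightarrow>
       norm (integral (cbox x (x + h *\<^sub>R One)) (\<lambda>x. g (- x)) /\<^sub>R h ^ DIM(real) - g (- x)) < e"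
    using integrable_ccontinuous_explicit[OF gi'] by blast
  have "f differentiable (at x)" if x: "x \<notin> N" "- x \<notin> M" for x
  proof -
    have right: "\<exists>d>0. \<forall>h. 0 < h \<and> h < d \<longrightarrow> \<bar>(H (x + h) - H x) / h - g x\<bar> < e" if "0 < e" for e
    proof -
      have eq: "integral (cbox x (x + h *\<^sub>R One)) g = H (x + h) - H x" if "h > 0" for h
        using g[of x "x + h"] that by (simp add: integral_unique)
      obtain d where d: "d > 0" "\<And>h. 0 < h \<and> h < d \<Longrightarrow>
          norm (integral (cbox x (x + h *\<^sub>R One)) g /\<^sub>R h ^ DIM(real) - g x) < e"
        using N'[OF x(1) \<open>0 < e\<close>] by blast
      have "\<bar>(H (x + h) - H x) / h - g x\<bar> < e" if "0 < h \<and> h < d" for h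
        using d(2)[OF that] that unfolding eq[OF that[THEN conjunct1]]
        by (simp add: divide_inverse mult.commute)
      then show ?thesis using d(1) by blast
    qed
    have left: "\<exists>d>0. \<forall>h. 0 < h \<and> h < d \<longrightarrow> \<bar>(H x - H (x - h)) / h - g x\<bar> < e" if "0 < e" for e
    proof -
      have eq: "integral (cbox (- x) (- x + h *\<^sub>R One)) (\<lambda>x. g (- x)) = H x - H (x - h)" if "h > 0" for h
        using integral_reflect[of x "x - h" g] g[of "x - h" x] that by (simp add: integral_unique)
      obtain d where d: "d > 0" "\<And>h. 0 < h \<and> h < d \<Longrightarrow>
          norm (integral (cbox (- x) (- x + h *\<^sub>R One)) (\<lambda>x. g (- x)) /\<^sub>R h ^ DIM(real) - g (- (- x))) < e"
        using M'[OF x(2) \<open>0 < e\<close>] by blast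
      have "\<bar>(H x - H (x - h)) / h - g x\<bar> < e" if "0 < h \<and> h < d" for h
        using d(2)[OF that] that unfolding eq[OF that[THEN conjunct1]]
        by (simp add: divide_inverse mult.commute)
      then show ?thesis using d(1) by blast
    qed
    have "((\<lambda>h. (H (x + h) - H x) / h) \<longlongrightarrow> g x) (at 0)"
      unfolding LIM_eq
    proof (intro allI impI)
      fix e :: real assume "0 < e"
      obtain d1 where d1: "d1 > 0" "\<And>h. 0 < h \<Longrightarrow> h < d1 \<Longrightarrow> \<bar>(H (x + h) - H x) / h - g x\<bar> < e"
        using right[OF \<open>0 < e\<close>] by blast
      obtain d2 where d2: "d2 > 0" "\<And>h. 0 < h \<Longrightarrow> h < d2 \<Longrightarrow> \<bar>(H x - H (x - h)) / h - g x\<bar> < e"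
        using left[OF \<open>0 < e\<close>] by blast
      show "\<exists>s>0. \<forall>h. h \<noteq> 0 \<and> norm (h - 0) < s \<longrightarrow> norm ((H (x + h) - H x) / h - g x) < e"
      proof (intro exI[of _ "min d1 d2"] conjI allI impI)
        fix h :: real assume h: "h \<noteq> 0 \<and> norm (h - 0) < min d1 d2"
        show "norm ((H (x + h) - H x) / h - g x) < e"
        proof (cases "h > 0")
          case True then show ?thesis using d1(2)[of h] h by simp
        next
          case False
          then have "(H x - H (x - - h)) / - h = (H (x + h) - H x) / h"
            using h by (simp add: field_simps)
          then show ?thesis using False d2(2)[of "- h"] h by simp
        qed
      qed (use d1 d2 in auto)
    qed
    then have "(H has_field_derivative g x) (at x)" by (simp add: DERIV_def)
    then have "((\<lambda>x. H x - (K + 1) * x) has_field_derivative (g x - (K + 1))) (at x)"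
      by (auto intro!: derivative_eq_intros)
    then show ?thesis by (auto simp: H_def real_differentiable_def)
  qed
  then have "{x. \<not> f differentiable (at x)} \<subseteq> N \<union> uminus ` M"
    by (auto simp: image_iff) (metis minus_minus)
  moreover have "negligible (uminus ` M)"
    using M by (intro negligible_differentiable_image_negligible) (auto intro: derivative_intros)
  ultimately show ?thesis using N negligible_Un negligible_subset by blast
qed

section \<open>Rademacher's theorem\<close>

text \<open>Near each of its points the set misses a ball of comparable size, at arbitrarily small
  scales. By Vitali's theorem, an open superset is exhausted up to a null part by disjoint balls,
  from each of which a fixed proportion can be removed. So the infimum \<open>m\<close> of the
  measures of open supersets satisfies \<open>m \<le> (1 - c) * m\<close>. Open supersets are used
  because \<open>P\<close> is an arbitrary set.\<close>

lemma negligible_self_porous: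
  fixes P :: "'a::euclidean_space set"
  assumes "0 < e"
    and porous: "\<And>x d. x \<in> P \<Longrightarrow> 0 < d \<Longrightarrow>
      \<exists>h. h \<noteq> 0 \<and> norm h < d \<and> ball (x + h) (e * norm h) \<inter> P = {}"
  shows "negligible P"
proof -
  \<comment> \<open>With \<open>\<epsilon> \<le> 1\<close> the hole of radius
    \<open>\<epsilon> * norm h\<close> around \<open>x + h\<close> stays inside the Vitali ball of
    radius \<open>2 * norm h\<close> around \<open>x\<close>.\<close>
  define \<epsilon> where "\<epsilon> = min e 1"
  have \<epsilon>: "0 < \<epsilon>" "\<epsilon> \<le> 1" using \<open>0 < e\<close> by (auto simp: \<epsilon>_def)
  have porous': "\<exists>h. h \<noteq> 0 \<and> norm h < d \<and> ball (x + h) (\<epsilon> * norm h) \<inter> P = {}" if "x \<in> P" "0 < d" for x d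
  proof -
    obtain h where h: "h \<noteq> 0" "norm h < d" "ball (x + h) (e * norm h) \<inter> P = {}"
      using porous[OF \<open>x \<in> P\<close> \<open>0 < d\<close>] by blast
    have "ball (x + h) (\<epsilon> * norm h) \<subseteq> ball (x + h) (e * norm h)"
      by (intro subset_ball) (auto simp: \<epsilon>_def mult_right_mono)
    then show ?thesis using h by blast
  qed
  \<comment> \<open>The ratio of the volume of a hole to that of its Vitali ball.\<close>
  define c where "c = (\<epsilon> / 2) ^ DIM('a)"
  have c: "0 < c" "c \<le> 1" using \<epsilon> by (auto simp: c_def intro!: power_le_one)
  have shrink: "\<exists>V. open V \<and> Q \<subseteq> V \<and> V \<in> lmeasurable \<and> measure lebesgue V \<le> (1 - c) * measure lebesgue U + \<eta>"
    if U: "open U" "Q \<subseteq> U" "U \<in> lmeasurable" and "0 < \<eta>" and QP: "Q \<subseteq> P" for U \<eta> Q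
  proof -
    define K where "K = {(x, h). h \<noteq> 0 \<and> ball x (2 * norm h) \<subseteq> U \<and> ball (x + h) (\<epsilon> * norm h) \<inter> P = {}}"
    have vit: "\<exists>i. i \<in> K \<and> x \<in> ball (fst i) (2 * norm (snd i)) \<and> 2 * norm (snd i) < d" if "x \<in> Q" "0 < d" for x d
    proof -
      obtain r where r: "0 < r" "ball x r \<subseteq> U" using U \<open>x \<in> Q\<close> openE by blast
      obtain h where h: "h \<noteq> 0" "norm h < min (d/2) (r/2)" "ball (x + h) (\<epsilon> * norm h) \<inter> P = {}"
        using porous'[of x "min (d/2) (r/2)"] \<open>0 < d\<close> r subsetD[OF QP \<open>x \<in> Q\<close>] by auto
      then have "ball x (2 * norm h) \<subseteq> U" using r subset_ball[of "2 * norm h" r x] by auto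
      then have "(x, h) \<in> K" using h by (simp add: K_def)
      then show ?thesis using h by (intro exI[of _ "(x, h)"]) auto
    qed
    obtain C where C: "countable C" "C \<subseteq> K"
      "pairwise (\<lambda>i j. disjnt (ball (fst i) (2 * norm (snd i))) (ball (fst j) (2 * norm (snd j)))) C"
      "negligible (Q - (\<Union>i\<in>C. ball (fst i) (2 * norm (snd i))))"
      using Vitali_covering_theorem_balls[of Q K fst "\<lambda>i. 2 * norm (snd i)"] vit by blast
    define B where "B i = ball (fst i) (2 * norm (snd i))" for i :: "'a \<times> 'a"
    define H where "H i = ball (fst i + snd i) (\<epsilon> * norm (snd i))" for i :: "'a \<times> 'a"
    have HB: "H i \<subseteq> B i" for i
    proof
      fix y assume "y \<in> H i"
      then have "dist (fst i + snd i) y < norm (snd i)"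
        using mult_right_mono[OF \<epsilon>(2) norm_ge_zero[of "snd i"]] by (simp add: H_def)
      moreover have "dist (fst i) y \<le> norm (snd i) + dist (fst i + snd i) y"
        using norm_triangle_ineq[of "- snd i" "fst i + snd i - y"]
        by (simp add: dist_norm algebra_simps)
      ultimately show "y \<in> B i" by (simp add: B_def)
    qed
    have disj: "disjoint_family_on B C"
      using C(3) by (auto simp: disjoint_family_on_def pairwise_def B_def disjnt_def)
    then have disjH: "disjoint_family_on H C"
      using HB by (fastforce simp: disjoint_family_on_def)
    have em: "emeasure lebesgue (H i) = ennreal c * emeasure lebesgue (B i)" for i
    proof -
      have "measure lborel (H i) = c * measure lborel (B i)"
        using \<epsilon> unfolding H_def B_def c_def
        by (subst (1 2) content_ball_conv_unit_ball) (auto simp: power_mult_distrib power_divide)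
      moreover have "emeasure lebesgue (ball x r) = ennreal (measure lborel (ball x r))" for x :: 'a and r
        using emeasure_lborel_ball_finite[of x r] by (subst emeasure_eq_ennreal_measure) auto
      ultimately show ?thesis using c by (simp add: H_def B_def ennreal_mult')
    qed
    have [measurable]: "B i \<in> sets lebesgue" "H i \<in> sets lebesgue" for i by (auto simp: B_def H_def)
    have "emeasure lebesgue (\<Union>i\<in>C. H i) = (\<integral>\<^sup>+i. emeasure lebesgue (H i) \<partial>count_space C)"
      using C(1) disjH by (intro emeasure_UN_countable) auto
    also have "\<dots> = ennreal c * (\<integral>\<^sup>+i. emeasure lebesgue (B i) \<partial>count_space C)"
      unfolding em by (intro nn_integral_cmult) auto
    also have "(\<integral>\<^sup>+i. emeasure lebesgue (B i) \<partial>count_space C) = emeasure lebesgue (\<Union>i\<in>C. B i)"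
      using C(1) disj by (intro emeasure_UN_countable[symmetric]) auto
    finally have emU: "emeasure lebesgue (\<Union>i\<in>C. H i) = ennreal c * emeasure lebesgue (\<Union>i\<in>C. B i)" .
    have BU: "(\<Union>i\<in>C. B i) \<subseteq> U" using C(2) by (fastforce simp: B_def K_def subset_iff)
    have Vs: "(\<Union>i\<in>C. B i) \<in> sets lebesgue" "(\<Union>i\<in>C. H i) \<in> sets lebesgue" using C(1) by auto
    have Bm: "(\<Union>i\<in>C. B i) \<in> lmeasurable" using U(3) Vs BU by (meson fmeasurableI2)
    have Hm: "(\<Union>i\<in>C. H i) \<in> lmeasurable" using fmeasurableI2[OF Bm _ Vs(2)] HB by blast
    have mH: "measure lebesgue (\<Union>i\<in>C. H i) = c * measure lebesgue (\<Union>i\<in>C. B i)"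
      using emU c by (simp add: measure_def enn2real_mult)
    \<comment> \<open>What is left to cover: the balls without their holes, and the null part of
      \<open>Q\<close> that the balls miss.\<close>
    define T where "T = ((\<Union>i\<in>C. B i) - (\<Union>i\<in>C. H i)) \<union> (Q - (\<Union>i\<in>C. B i))"
    have "H i \<inter> P = {}" if "i \<in> C" for i
      using subsetD[OF C(2) that] by (auto simp: H_def K_def)
    then have QT: "Q \<subseteq> T" using QP unfolding T_def by blast
    have neg: "negligible (Q - (\<Union>i\<in>C. B i))" using C(4) by (simp add: B_def)
    have Tm: "T \<in> lmeasurable"
      unfolding T_def by (intro fmeasurable.Un fmeasurable.Diff Bm Hm negligible_imp_measurable neg)
    have "measure lebesgue T \<le> measure lebesgue ((\<Union>i\<in>C. B i) - (\<Union>i\<in>C. H i)) + 0"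
      unfolding T_def using Bm Hm neg
      by (intro order_trans[OF measure_Un_le]) (auto simp: negligible_imp_measure0 negligible_imp_sets)
    also have "measure lebesgue ((\<Union>i\<in>C. B i) - (\<Union>i\<in>C. H i)) = (1 - c) * measure lebesgue (\<Union>i\<in>C. B i)"
      using HB by (subst measurable_measure_Diff[OF Bm Vs(2)]) (auto simp: mH algebra_simps)
    also have "\<dots> \<le> (1 - c) * measure lebesgue U"
      using c BU U(3) Vs by (intro mult_left_mono measure_mono_fmeasurable) auto
    finally have mT: "measure lebesgue T \<le> (1 - c) * measure lebesgue U" by simp
    obtain V where V: "open V" "T \<subseteq> V" "V - T \<in> lmeasurable" "emeasure lebesgue (V - T) < ennreal \<eta>"
      using sets_lebesgue_outer_open[of T \<eta>] Tm \<open>0 < \<eta>\<close> by blast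
    have VT: "V = T \<union> (V - T)" using V by blast
    have Vm: "V \<in> lmeasurable" using Tm V(3) VT by (metis fmeasurable.Un)
    have "measure lebesgue V \<le> measure lebesgue T + measure lebesgue (V - T)"
      using VT measure_Un_le[of T lebesgue "V - T"] Tm V(3) by auto
    moreover have "measure lebesgue (V - T) \<le> \<eta>"
      using V(4) \<open>0 < \<eta>\<close> by (simp add: measure_def enn2real_leI)
    ultimately show ?thesis using V Vm QT mT by (intro exI[of _ V]) auto
  qed
  have bounded_case: "negligible Q" if "Q \<subseteq> P" "bounded Q" for Q
  proof -
    define S where "S = {measure lebesgue U | U. open U \<and> Q \<subseteq> U \<and> U \<in> lmeasurable}"
    obtain r where "Q \<subseteq> ball 0 r" using \<open>bounded Q\<close> bounded_subset_ballD by blast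
    then have "S \<noteq> {}" by (auto simp: S_def intro!: exI[of _ "ball 0 r"])
    have bdd: "bdd_below S" by (auto simp: S_def intro!: bdd_belowI[of _ 0])
    define m where "m = Inf S"
    have m0: "0 \<le> m" unfolding m_def using \<open>S \<noteq> {}\<close> by (intro cInf_greatest) (auto simp: S_def)
    have step: "m \<le> (1 - c) * s + \<eta>" if "s \<in> S" "0 < \<eta>" for s \<eta>
    proof -
      obtain U where U: "open U" "Q \<subseteq> U" "U \<in> lmeasurable" "s = measure lebesgue U"
        using \<open>s \<in> S\<close> by (auto simp: S_def)
      obtain V where V: "open V" "Q \<subseteq> V" "V \<in> lmeasurable" "measure lebesgue V \<le> (1 - c) * measure lebesgue U + \<eta>"
        using shrink[OF U(1-3) \<open>0 < \<eta>\<close> \<open>Q \<subseteq> P\<close>] by blast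
      have "m \<le> measure lebesgue V"
        unfolding m_def
      proof (rule cInf_lower[OF _ bdd])
        show "measure lebesgue V \<in> S" unfolding S_def using V by blast
      qed
      then show ?thesis using V U by simp
    qed
    have "c * m \<le> 0"
    proof (rule field_le_epsilon)
      fix \<eta> :: real assume "0 < \<eta>"
      obtain s where s: "s \<in> S" "s < m + \<eta> / 2"
        using cInf_lessD[OF \<open>S \<noteq> {}\<close>, of "m + \<eta> / 2"] \<open>0 < \<eta>\<close> by (auto simp: m_def)
      have "(1 - c) * s \<le> (1 - c) * (m + \<eta> / 2)" using s c by (intro mult_left_mono) auto
      moreover have "(1 - c) * (m + \<eta> / 2) = m - c * m + \<eta> / 2 - c * \<eta> / 2" by (simp add: field_simps)
      moreover have "c * \<eta> \<ge> 0" using c \<open>0 < \<eta>\<close> by simp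
      moreover have "m \<le> (1 - c) * s + \<eta> / 2" using step[OF s(1), of "\<eta> / 2"] \<open>0 < \<eta>\<close> by simp
      ultimately show "c * m \<le> 0 + \<eta>" by linarith
    qed
    then have "m = 0" using m0 c by (simp add: mult_le_0_iff)
    show ?thesis
      unfolding negligible_outer_le
    proof (intro allI impI)
      fix \<eta> :: real assume "0 < \<eta>"
      obtain s where "s \<in> S" "s < \<eta>"
        using cInf_lessD[OF \<open>S \<noteq> {}\<close>, of \<eta>] \<open>0 < \<eta>\<close> \<open>m = 0\<close> by (auto simp: m_def)
      then show "\<exists>T. Q \<subseteq> T \<and> T \<in> lmeasurable \<and> measure lebesgue T \<le> \<eta>"
        by (auto simp: S_def intro: less_imp_le)
    qed
  qed
  have "P = (\<Union>n. P \<inter> ball 0 (real n))"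
    using reals_Archimedean2 by (fastforce simp: set_eq_iff)
  moreover have "negligible (\<Union>n. P \<inter> ball 0 (real n))"
    by (intro negligible_Union_nat)
      (auto intro!: bounded_case bounded_Int)
  ultimately show ?thesis by simp
qed

text \<open>Tonelli's theorem for the indicator of \<open>x + t *\<^sub>R e \<in> N\<close> on pairs
  \<open>(x, t)\<close>. Integrating over \<open>t\<close> gives 0 for every \<open>x\<close>;
  integrating over \<open>x\<close> gives, by translation invariance, the measure of
  \<open>N\<close> for every \<open>t\<close>. Then the measure of \<open>N\<close> times that of
  the line is 0. No coordinate has to be split off.\<close>

lemma negligible_by_line_sections:
  fixes N :: "'a::euclidean_space set"
  assumes N[measurable]: "N \<in> sets borel" and sect: "\<And>x. negligible {t::real. x + t *\<^sub>R e \<in> N}"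
  shows "negligible N"
proof -
  define f :: "'a \<times> real \<Rightarrow> ennreal" where "f = (\<lambda>(x, t). indicator N (x + t *\<^sub>R e))"
  have [measurable]: "f \<in> borel_measurable (lborel \<Otimes>\<^sub>M lborel)"
    unfolding f_def by measurable
  have "(\<integral>\<^sup>+t. f (x, t) \<partial>lborel) = 0" for x
  proof -
    have "{t. x + t *\<^sub>R e \<in> N} \<in> sets borel" by measurable
    then have "{t. x + t *\<^sub>R e \<in> N} \<in> null_sets lborel"
      using sect[of x] by (simp add: negligible_iff_null_sets null_sets_completion_iff)
    moreover have "(\<lambda>t. f (x, t)) = indicator {t. x + t *\<^sub>R e \<in> N}"
      by (auto simp: f_def indicator_def)
    ultimately show ?thesis by (simp add: null_sets_def)
  qed
  then have "0 = (\<integral>\<^sup>+t. (\<integral>\<^sup>+x. f (x, t) \<partial>lborel) \<partial>lborel)"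
    using lborel_pair.Fubini[of f] by simp
  moreover have "(\<integral>\<^sup>+x. f (x, t) \<partial>lborel) = emeasure lborel N" for t
  proof -
    have "emeasure lborel N = emeasure (distr lborel borel ((+) (t *\<^sub>R e))) N"
      by (simp add: lborel_distr_plus)
    also have "\<dots> = emeasure lborel ((+) (t *\<^sub>R e) -` N)"
      by (simp add: emeasure_distr)
    also have "\<dots> = (\<integral>\<^sup>+x. indicator ((+) (t *\<^sub>R e) -` N) x \<partial>lborel)"
      using measurable_sets[of "(+) (t *\<^sub>R e)" borel borel N] by (intro nn_integral_indicator[symmetric]) auto
    finally show ?thesis by (simp add: f_def indicator_def add.commute)
  qed
  ultimately have "emeasure lborel N * emeasure lborel (UNIV :: real set) = 0" by simp
  then have "N \<in> null_sets lborel" by (auto simp: null_sets_def)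
  then show ?thesis by (simp add: negligible_iff_null_sets null_sets_completionI)
qed

text \<open>The approximating functional may depend on the accuracy \<open>e\<close>. Functionals
  belonging to accuracies \<open>2^-m\<close> and \<open>2^-n\<close> are both good on a common
  ball, hence differ by at most the sum of the accuracies; they form a Cauchy sequence whose limit
  is the derivative.\<close>

lemma differentiable_if_approx_linear:
  fixes f :: "'a::euclidean_space \<Rightarrow> real"
  assumes approx: "\<And>e. 0 < e \<Longrightarrow> \<exists>c. \<exists>d>0. \<forall>h. norm h < d \<longrightarrow> \<bar>f (x + h) - f x - c \<bullet> h\<bar> \<le> e * norm h"
  shows "f differentiable (at x)"
proof -
  have "\<exists>c. \<forall>n::nat. \<exists>d>0. \<forall>h. norm h < d \<longrightarrow> \<bar>f (x + h) - f x - c n \<bullet> h\<bar> \<le> (1 / 2) ^ n * norm h"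
    using approx by (intro choice) auto
  then obtain c where c: "\<And>n::nat. \<exists>d>0. \<forall>h. norm h < d \<longrightarrow> \<bar>f (x + h) - f x - c n \<bullet> h\<bar> \<le> (1 / 2) ^ n * norm h"
    by blast
  have close: "norm (c m - c n) \<le> (1 / 2) ^ m + (1 / 2) ^ n" for m n
  proof (cases "c m = c n")
    case False
    obtain d1 where d1: "d1 > 0" "\<And>h. norm h < d1 \<Longrightarrow> \<bar>f (x + h) - f x - c m \<bullet> h\<bar> \<le> (1 / 2) ^ m * norm h"
      using c[of m] by blast
    obtain d2 where d2: "d2 > 0" "\<And>h. norm h < d2 \<Longrightarrow> \<bar>f (x + h) - f x - c n \<bullet> h\<bar> \<le> (1 / 2) ^ n * norm h"
      using c[of n] by blast
    \<comment> \<open>The two functionals are compared on their own difference, scaled into the ball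
      where both estimates hold.\<close>
    define s where "s = min d1 d2 / (2 * norm (c m - c n))"
    have s: "s > 0" using d1 d2 False by (simp add: s_def)
    define h where "h = s *\<^sub>R (c m - c n)"
    have nh: "norm h = min d1 d2 / 2" using False d1 d2 by (simp add: h_def s_def)
    then have "norm h < d1" "norm h < d2" using d1 d2 by auto
    then have "\<bar>(c m - c n) \<bullet> h\<bar> \<le> ((1 / 2) ^ m + (1 / 2) ^ n) * norm h"
      using d1(2)[of h] d2(2)[of h] by (simp add: inner_diff_left algebra_simps)
    moreover have "(c m - c n) \<bullet> h = norm (c m - c n) * norm h"
      using s by (simp add: h_def power2_norm_eq_inner flip: power2_eq_square)
    ultimately show ?thesis using nh d1 d2 by (simp add: abs_mult)
  qed simp
  have small: "\<exists>N. \<forall>n\<ge>N. (1 / 2 :: real) ^ n < e" if "0 < e" for e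
  proof -
    have "(\<lambda>n. (1 / 2 :: real) ^ n) \<longlonglongrightarrow> 0" by (intro LIMSEQ_realpow_zero) auto
    from order_tendstoD(2)[OF this that] show ?thesis by (simp only: eventually_sequentially)
  qed
  have "Cauchy c"
  proof (rule CauchyI)
    fix e :: real assume "0 < e"
    obtain N where N: "\<And>n. n \<ge> N \<Longrightarrow> (1 / 2 :: real) ^ n < e / 2" using small[of "e / 2"] \<open>0 < e\<close> by auto
    have "norm (c m - c n) < e" if "m \<ge> N" "n \<ge> N" for m n
      using close[of m n] N[OF that(1)] N[OF that(2)] by simp
    then show "\<exists>M. \<forall>m\<ge>M. \<forall>n\<ge>M. norm (c m - c n) < e" by blast
  qed
  then obtain l where l: "c \<longlonglongrightarrow> l" using Cauchy_convergent convergent_def by blast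
  have "(f has_derivative (\<lambda>h. l \<bullet> h)) (at x)"
    unfolding has_derivative_at_alt
  proof (intro conjI allI impI)
    show "bounded_linear (\<lambda>h. l \<bullet> h)" by (rule bounded_linear_inner_right)
    fix e :: real assume "0 < e"
    obtain N where N: "\<And>n. n \<ge> N \<Longrightarrow> (1 / 2 :: real) ^ n < e / 2" using small[of "e / 2"] \<open>0 < e\<close> by auto
    obtain M where M: "\<And>n. n \<ge> M \<Longrightarrow> norm (c n - l) < e / 2"
      using LIMSEQ_D[OF l, of "e / 2"] \<open>0 < e\<close> by auto
    define n where "n = max N M"
    obtain d where d: "d > 0" "\<And>h. norm h < d \<Longrightarrow> \<bar>f (x + h) - f x - c n \<bullet> h\<bar> \<le> (1 / 2) ^ n * norm h"
      using c[of n] by blast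
    have "norm (f y - f x - l \<bullet> (y - x)) \<le> e * norm (y - x)" if "norm (y - x) < d" for y
    proof -
      have "\<bar>(c n - l) \<bullet> (y - x)\<bar> \<le> e / 2 * norm (y - x)"
        using M[of n] by (intro order_trans[OF Cauchy_Schwarz_ineq2] mult_right_mono) (auto simp: n_def)
      moreover have "(1 / 2) ^ n * norm (y - x) \<le> e / 2 * norm (y - x)"
        using N[of n] by (intro mult_right_mono) (auto simp: n_def)
      moreover have "\<bar>f y - f x - c n \<bullet> (y - x)\<bar> \<le> (1 / 2) ^ n * norm (y - x)"
        using d(2)[OF that] by simp
      moreover have "\<bar>f y - f x - l \<bullet> (y - x)\<bar> \<le> \<bar>f y - f x - c n \<bullet> (y - x)\<bar> + \<bar>(c n - l) \<bullet> (y - x)\<bar>"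
        unfolding inner_diff_left by linarith
      ultimately show ?thesis unfolding real_norm_def by linarith
    qed
    then show "\<exists>d>0. \<forall>y. norm (y - x) < d \<longrightarrow> norm (f y - f x - l \<bullet> (y - x)) \<le> e * norm (y - x)"
      using d(1) by blast
  qed
  then show ?thesis by (auto simp: differentiable_def)
qed

text \<open>Every point outside a negligible set is a point of non-porosity, for every resolution, of a
  closed set on which all coordinate difference quotients are uniformly close to a constant; at such
  a point the increments along the coordinate directions can be added up.\<close>

theorem rademacher_real:
  fixes f :: "'a::euclidean_space \<Rightarrow> real"
  assumes lip: "\<And>x y. \<bar>f x - f y\<bar> \<le> K * norm (x - y)"
  shows "negligible {x. \<not> f differentiable (at x)}"
proof -
  have K0: "0 \<le> K"
    using lip[of "SOME i. i \<in> Basis" 0] by (metis abs_ge_zero diff_0_right norm_some_Basis mult.right_neutral order_trans)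
  have contf: "continuous_on S f" for S
    using lip K0 by (intro lipschitz_on_continuous_on[of K] lipschitz_onI) (auto simp: dist_real_def dist_norm)
  \<comment> \<open>Scales and slopes range over countable sets (\<open>q\<close> will be rational),
    so that countably many null sets have to be discarded. Continuity of \<open>f\<close> makes
    these sets closed, hence Borel, as the argument by line sections requires.\<close>
  define E where "E n k i q = {x. \<forall>t. \<bar>t\<bar> \<le> 1 / real (Suc k) \<longrightarrow>
      \<bar>f (x + t *\<^sub>R i) - f x - t * q\<bar> \<le> \<bar>t\<bar> / real (Suc n)}" for n k :: nat and i :: 'a and q :: real
  have closedE: "closed (E n k i q)" for n k i q
  proof -
    have "E n k i q = (\<Inter>t\<in>{t. \<bar>t\<bar> \<le> 1 / real (Suc k)}. {x. \<bar>f (x + t *\<^sub>R i) - f x - t * q\<bar> \<le> \<bar>t\<bar> / real (Suc n)})"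
      by (auto simp: E_def)
    also have "closed \<dots>"
      by (intro closed_INT ballI closed_Collect_le continuous_intros continuous_on_compose2[OF contf]) auto
    finally show ?thesis .
  qed
  define N where "N i = (\<Union>n. - (\<Union>k. \<Union>q\<in>\<rat>. E n k i q))" for i
  have negN: "negligible (N i)" for i
  proof (rule negligible_by_line_sections[where e = i])
    have "(\<Union>q\<in>\<rat>. E n k i q) \<in> sets borel" for n k
      by (rule sets.countable_UN'[OF countable_rat]) (auto intro: borel_closed closedE)
    then show "N i \<in> sets borel" unfolding N_def by (intro sets.countable_UN image_subsetI borel_comp)
    fix x
    define g where "g t = f (x + t *\<^sub>R i)" for t
    have "\<bar>g s - g t\<bar> \<le> (K * norm i) * \<bar>s - t\<bar>" for s t
      using lip[of "x + s *\<^sub>R i" "x + t *\<^sub>R i"] by (simp add: g_def flip: scaleR_diff_left) (simp add: ac_simps)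
    then have neg: "negligible {t. \<not> g differentiable (at t)}"
      by (rule lipschitz_real_ae_differentiable)
    have "x + t *\<^sub>R i \<notin> N i" if t: "g differentiable (at t)" for t
    proof -
      obtain D where D: "(g has_derivative (\<lambda>h. h * D)) (at t)"
        using t by (auto simp: real_differentiable_def has_field_derivative_def mult_commute_abs)
      have "\<exists>k. \<exists>q\<in>\<rat>. x + t *\<^sub>R i \<in> E n k i q" for n
      proof -
        define e where "e = 1 / real (Suc n) / 2"
        have e: "e > 0" by (simp add: e_def)
        obtain q where q: "q \<in> \<rat>" "D - e < q" "q < D + e"
          using Rats_dense_in_real[of "D - e" "D + e"] e by auto
        obtain d where d: "d > 0" "\<And>y. \<bar>y - t\<bar> < d \<Longrightarrow> \<bar>g y - g t - (y - t) * D\<bar> \<le> e * \<bar>y - t\<bar>"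
          using D e unfolding has_derivative_at_alt by fastforce
        obtain k where k: "1 / real (Suc k) < d" using d(1) nat_approx_posE by blast
        have "\<bar>f ((x + t *\<^sub>R i) + s *\<^sub>R i) - f (x + t *\<^sub>R i) - s * q\<bar> \<le> \<bar>s\<bar> / real (Suc n)"
          if "\<bar>s\<bar> \<le> 1 / real (Suc k)" for s
        proof -
          have "\<bar>g (t + s) - g t - s * D\<bar> \<le> e * \<bar>s\<bar>" using d(2)[of "t + s"] that k by simp
          moreover have "\<bar>s * D - s * q\<bar> \<le> e * \<bar>s\<bar>"
          proof -
            have "\<bar>s\<bar> * \<bar>D - q\<bar> \<le> \<bar>s\<bar> * e" using q by (intro mult_left_mono) (auto simp: abs_le_iff)
            then show ?thesis by (simp add: mult.commute[of e] flip: right_diff_distrib abs_mult)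
          qed
          ultimately have "\<bar>g (t + s) - g t - s * q\<bar> \<le> (e + e) * \<bar>s\<bar>" by (simp add: algebra_simps)
          moreover have "e + e = 1 / real (Suc n)" unfolding e_def by (rule field_sum_of_halves)
          ultimately show ?thesis by (simp add: g_def scaleR_left_distrib add_ac)
        qed
        then have "x + t *\<^sub>R i \<in> E n k i q" by (auto simp: E_def)
        then show ?thesis using q(1) by blast
      qed
      then show ?thesis by (auto simp: N_def)
    qed
    then have "{t. x + t *\<^sub>R i \<in> N i} \<subseteq> {t. \<not> g differentiable (at t)}" by blast
    then show "negligible {t. x + t *\<^sub>R i \<in> N i}" using neg negligible_subset by blast
  qed
  define A where "A n k q = (\<Inter>i\<in>Basis. E n k i (q i))" for n k and q :: "'a \<Rightarrow> real"
  define P where "P n k q = {x \<in> A n k q. \<forall>d>0. \<exists>h. h \<noteq> 0 \<and> norm h < d \<and>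
      ball (x + h) (1 / real (Suc n) * norm h) \<inter> A n k q = {}}" for n k and q :: "'a \<Rightarrow> real"
  have negP: "negligible (P n k q)" for n k q
  proof (rule negligible_self_porous)
    show "0 < 1 / real (Suc n)" by simp
    fix x and d :: real assume "x \<in> P n k q" "0 < d"
    then obtain h where "h \<noteq> 0" "norm h < d" "ball (x + h) (1 / real (Suc n) * norm h) \<inter> A n k q = {}"
      unfolding P_def by blast
    moreover have "P n k q \<subseteq> A n k q" by (auto simp: P_def)
    ultimately show "\<exists>h. h \<noteq> 0 \<and> norm h < d \<and> ball (x + h) (1 / real (Suc n) * norm h) \<inter> P n k q = {}"
      by blast
  qed
  \<comment> \<open>The extensional function space: with free values outside \<open>Basis\<close>
    the family would not be countable.\<close>
  define Q where "Q = (Basis \<rightarrow>\<^sub>E \<rat> :: ('a \<Rightarrow> real) set)"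
  have "countable Q" unfolding Q_def by (intro countable_PiE) (auto simp: countable_rat)
  define Z where "Z = (\<Union>i\<in>Basis. N i) \<union> (\<Union>(n, k, q)\<in>UNIV \<times> UNIV \<times> Q. P n k q)"
  have "negligible Z"
    unfolding Z_def using negN negP \<open>countable Q\<close>
    by (intro negligible_Un negligible_Union negligible_countable_Union) (auto intro!: countable_image countable_SIGMA)
  moreover have "f differentiable (at x)" if x: "x \<notin> Z" for x
  proof (rule differentiable_if_approx_linear)
    fix e :: real assume "0 < e"
    define C where "C = real DIM('a) * (2 * K + 1)"
    have C: "C > 0" using K0 by (simp add: C_def)
    obtain n where n: "1 / real (Suc n) < e / C" using \<open>0 < e\<close> C nat_approx_posE[of "e / C"] by auto
    define \<epsilon> where "\<epsilon> = 1 / real (Suc n)"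
    have \<epsilon>: "\<epsilon> > 0" "C * \<epsilon> \<le> e" using n C by (auto simp: \<epsilon>_def field_simps)
    have "\<exists>k q. q \<in> \<rat> \<and> x \<in> E n k i q" if "i \<in> Basis" for i
    proof -
      have "x \<notin> N i" using x that by (auto simp: Z_def)
      then show ?thesis unfolding N_def by blast
    qed
    then obtain k q where kq: "\<And>i. i \<in> Basis \<Longrightarrow> q i \<in> \<rat> \<and> x \<in> E n (k i) i (q i)"
      by metis
    define k' where "k' = Max (k ` Basis)"
    define q' where "q' = restrict q Basis"
    have "q' \<in> Q" using kq by (auto simp: Q_def q'_def)
    have "x \<in> A n k' q'"
      unfolding A_def
    proof
      fix i :: 'a assume i: "i \<in> Basis"
      have "1 / real (Suc k') \<le> 1 / real (Suc (k i))"
        using i by (intro divide_left_mono) (auto simp: k'_def)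
      then have "E n (k i) i (q i) \<subseteq> E n k' i (q i)" by (auto simp: E_def)
      then show "x \<in> E n k' i (q' i)" using kq[OF i] i by (auto simp: q'_def)
    qed
    moreover have "x \<notin> P n k' q'" using x \<open>q' \<in> Q\<close> by (auto simp: Z_def)
    ultimately obtain d0 where d0: "d0 > 0"
      "\<And>h. h \<noteq> 0 \<Longrightarrow> norm h < d0 \<Longrightarrow> ball (x + h) (\<epsilon> * norm h) \<inter> A n k' q' \<noteq> {}"
      by (auto simp: P_def \<epsilon>_def)
    define d where "d = min d0 (1 / real (Suc k'))"
    have d: "d > 0" using d0 by (simp add: d_def)
    define c where "c = (\<Sum>i\<in>Basis. q' i *\<^sub>R i)"
    \<comment> \<open>The path from \<open>x\<close> to \<open>x + h\<close> runs parallel to the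
      axes. The start \<open>x + z\<close> of a leg need not lie in \<open>A n k' q'\<close>, but a
      point \<open>y\<close> of that set lies within \<open>\<epsilon> * norm h\<close>. Moving both
      ends of the leg to \<open>y\<close> costs \<open>K * (\<epsilon> * norm h)\<close> twice, and
      the difference quotient at \<open>y\<close> costs \<open>\<epsilon> * norm h\<close>.\<close>
    have main: "\<bar>f (x + (\<Sum>i\<in>S. (h \<bullet> i) *\<^sub>R i)) - f x - (\<Sum>i\<in>S. (h \<bullet> i) * q' i)\<bar> \<le> real (card S) * ((2 * K + 1) * (\<epsilon> * norm h))"
      if h: "norm h < d" and S: "S \<subseteq> Basis" for h S
      using finite_subset[OF S finite_Basis] S
    proof (induction S)
      case empty then show ?case by simp
    next
      case (insert i S)
      define z where "z = (\<Sum>i\<in>S. (h \<bullet> i) *\<^sub>R i)"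
      have "norm z \<le> norm h"
      proof (rule norm_le_componentwise)
        fix b :: 'a assume b: "b \<in> Basis"
        have "z \<bullet> b = (\<Sum>i\<in>S. if i = b then h \<bullet> b else 0)"
          unfolding z_def inner_sum_left using insert b by (intro sum.cong) (auto simp: inner_Basis)
        then show "\<bar>z \<bullet> b\<bar> \<le> \<bar>h \<bullet> b\<bar>" using insert by simp
      qed
      obtain y where y: "y \<in> A n k' q'" "norm (x + z - y) \<le> \<epsilon> * norm h"
      proof (cases "z = 0")
        case True then show ?thesis using \<open>x \<in> A n k' q'\<close> \<epsilon> that[of x] by simp
      next
        case False
        then obtain y where "y \<in> ball (x + z) (\<epsilon> * norm z)" "y \<in> A n k' q'"
          using d0(2)[of z] \<open>norm z \<le> norm h\<close> h by (auto simp: d_def)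
        moreover have "\<epsilon> * norm z \<le> \<epsilon> * norm h" using \<open>norm z \<le> norm h\<close> \<epsilon> by simp
        ultimately show ?thesis using that[of y] by (simp add: dist_norm)
      qed
      have hi: "\<bar>h \<bullet> i\<bar> \<le> norm h" using insert by (simp add: Basis_le_norm)
      have "y \<in> E n k' i (q' i)" using y(1) insert by (auto simp: A_def)
      then have "\<bar>f (y + (h \<bullet> i) *\<^sub>R i) - f y - (h \<bullet> i) * q' i\<bar> \<le> \<bar>h \<bullet> i\<bar> * \<epsilon>"
        using hi h by (auto simp: E_def d_def \<epsilon>_def)
      also have "\<dots> \<le> \<epsilon> * norm h" using hi \<epsilon> by (simp add: mult.commute)
      finally have 1: "\<bar>f (y + (h \<bullet> i) *\<^sub>R i) - f y - (h \<bullet> i) * q' i\<bar> \<le> \<epsilon> * norm h" .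
      have 2: "\<bar>f (x + z + (h \<bullet> i) *\<^sub>R i) - f (y + (h \<bullet> i) *\<^sub>R i)\<bar> \<le> K * (\<epsilon> * norm h)"
        using lip[of "x + z + (h \<bullet> i) *\<^sub>R i" "y + (h \<bullet> i) *\<^sub>R i"] mult_left_mono[OF y(2) K0] by simp
      have 3: "\<bar>f (x + z) - f y\<bar> \<le> K * (\<epsilon> * norm h)"
        using lip[of "x + z" y] mult_left_mono[OF y(2) K0] by simp
      have 4: "\<bar>f (x + z) - f x - (\<Sum>i\<in>S. (h \<bullet> i) * q' i)\<bar> \<le> real (card S) * ((2 * K + 1) * (\<epsilon> * norm h))"
        using insert unfolding z_def by simp
      have "\<bar>f (x + z + (h \<bullet> i) *\<^sub>R i) - f x - ((\<Sum>i\<in>S. (h \<bullet> i) * q' i) + (h \<bullet> i) * q' i)\<bar>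
          \<le> real (card S) * ((2 * K + 1) * (\<epsilon> * norm h)) + (2 * (K * (\<epsilon> * norm h)) + \<epsilon> * norm h)"
        using 1 2 3 4 by linarith
      also have "\<dots> = real (Suc (card S)) * ((2 * K + 1) * (\<epsilon> * norm h))"
        by (simp add: algebra_simps)
      finally show ?case using insert(1,2) by (simp add: z_def add_ac)
    qed
    have "\<bar>f (x + h) - f x - c \<bullet> h\<bar> \<le> e * norm h" if "norm h < d" for h
    proof -
      have "c \<bullet> h = (\<Sum>i\<in>Basis. (h \<bullet> i) * q' i)"
        unfolding c_def inner_sum_left by (intro sum.cong) (simp_all add: inner_commute)
      then have "\<bar>f (x + h) - f x - c \<bullet> h\<bar> \<le> C * \<epsilon> * norm h"
        using main[OF that order_refl] unfolding euclidean_representation C_def by (simp add: mult_ac)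
      also have "\<dots> \<le> e * norm h" using \<epsilon> by (intro mult_right_mono) auto
      finally show ?thesis .
    qed
    then show "\<exists>c. \<exists>d>0. \<forall>h. norm h < d \<longrightarrow> \<bar>f (x + h) - f x - c \<bullet> h\<bar> \<le> e * norm h"
      using d by blast
  qed
  then have "{x. \<not> f differentiable (at x)} \<subseteq> Z" by blast
  ultimately show ?thesis using negligible_subset by blast
qed

corollary rademacher:
  fixes f :: "'a::euclidean_space \<Rightarrow> 'b::euclidean_space"
  assumes lip: "\<And>x y. norm (f x - f y) \<le> K * norm (x - y)"
  shows "negligible {x. \<not> f differentiable (at x)}"
proof -
  have "negligible {x. \<not> (\<lambda>x. f x \<bullet> i) differentiable (at x)}" if "i \<in> Basis" for i
  proof (rule rademacher_real)
    show "\<bar>f x \<bullet> i - f y \<bullet> i\<bar> \<le> K * norm (x - y)" for x y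
      using order_trans[OF Basis_le_norm[OF that, of "f x - f y"] lip] by (simp add: inner_diff_left)
  qed
  then have "negligible (\<Union>i\<in>Basis. {x. \<not> (\<lambda>x. f x \<bullet> i) differentiable (at x)})"
    by (intro negligible_Union) auto
  moreover have "{x. \<not> f differentiable (at x)} = (\<Union>i\<in>Basis. {x. \<not> (\<lambda>x. f x \<bullet> i) differentiable (at x)})"
    by (subst differentiable_componentwise_within) auto
  ultimately show ?thesis by simp
qed

section \<open>Second-order differentiability of convex functions\<close>

text \<open>Convexity is expressed throughout as the existence of a global subgradient at every
  point, which is the form in which sup-convolutions supply it.\<close>

definition is_subgradient :: "('a::real_inner \<Rightarrow> real) \<Rightarrow> 'a \<Rightarrow> 'a \<Rightarrow> bool" where
  "is_subgradient f z p \<longleftrightarrow> (\<forall>w. f z + p \<bullet> (w - z) \<le> f w)"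

lemma is_subgradientD: "is_subgradient f z p \<Longrightarrow> f z + p \<bullet> (w - z) \<le> f w"
  by (simp add: is_subgradient_def)

lemma lipschitz_if_bounded_subgradients:
  fixes f :: "'a::real_inner \<Rightarrow> real"
  assumes sub: "\<And>z. \<exists>p. norm p \<le> C \<and> is_subgradient f z p"
  shows "C-lipschitz_on UNIV f"
proof (rule lipschitz_onI)
  have le: "f x - f y \<le> C * norm (x - y)" for x y
  proof -
    obtain p where p: "norm p \<le> C" "is_subgradient f x p" using sub by blast
    have "f x - f y \<le> p \<bullet> (x - y)" using is_subgradientD[OF p(2), of y] by (simp add: inner_diff_right)
    also have "\<dots> \<le> norm p * norm (x - y)" by (rule norm_cauchy_schwarz)
    also have "\<dots> \<le> C * norm (x - y)" using p by (intro mult_right_mono) auto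
    finally show ?thesis .
  qed
  show "dist (f x) (f y) \<le> C * dist x y" for x y
    using le[of x y] le[of y x] by (simp add: dist_real_def dist_norm norm_minus_commute abs_le_iff)
  show "0 \<le> C" using sub[of 0] norm_ge_zero order_trans by blast
qed

text \<open>Here \<open>z\<close> is the resolvent of the subdifferential at \<open>w\<close>.
  Adding the two subgradient inequalities yields monotonicity of the subdifferential, and
  Cauchy-Schwarz does the rest. With \<open>w = w'\<close> this is uniqueness of the resolvent
  point.\<close>

lemma resolvent_nonexpansive:
  assumes "is_subgradient f z (w - z)" "is_subgradient f z' (w' - z')"
  shows "norm (z - z') \<le> norm (w - w')"
proof -
  have "f z + (w - z) \<bullet> (z' - z) \<le> f z'" "f z' + (w' - z') \<bullet> (z - z') \<le> f z"
    using assms by (auto dest: is_subgradientD)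
  then have "(z - z') \<bullet> (z - z') \<le> (w - w') \<bullet> (z - z')"
    by (simp add: inner_diff_left inner_diff_right)
  also have "\<dots> \<le> norm (w - w') * norm (z - z')" by (rule norm_cauchy_schwarz)
  finally have "norm (z - z') * norm (z - z') \<le> norm (w - w') * norm (z - z')"
    by (simp add: power2_norm_eq_inner flip: power2_eq_square)
  then show ?thesis by (cases "z = z'") auto
qed

text \<open>The point minimises the Moreau functional
  \<open>f z + (norm (z - w))\<^sup>2 / 2\<close>; the subgradient relation is its first-order
  condition.\<close>

lemma resolvent_exists:
  fixes f :: "'a::euclidean_space \<Rightarrow> real"
  assumes sub: "\<And>z. \<exists>p. norm p \<le> C \<and> is_subgradient f z p"
  shows "\<exists>z. is_subgradient f z (w - z)"
proof -
  note lip = lipschitz_if_bounded_subgradients[OF sub]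
  have C: "0 \<le> C" using lip by (rule lipschitz_on_nonneg)
  have lip1: "f x - f y \<le> C * norm (x - y)" for x y
    using lipschitz_onD[OF lip, of x y] by (simp add: dist_real_def dist_norm)
  have contf: "continuous_on S f" for S
    using lipschitz_on_continuous_on[OF lip] continuous_on_subset by blast
  define g where "g z = f z + (norm (z - w))\<^sup>2 / 2" for z
  have "continuous_on (cball w (2 * C)) g"
    unfolding g_def by (intro continuous_intros contf) auto
  then obtain z where z: "z \<in> cball w (2 * C)" "\<And>y. y \<in> cball w (2 * C) \<Longrightarrow> g z \<le> g y"
    using continuous_attains_inf[of "cball w (2 * C)" g] C by auto
  \<comment> \<open>At distance more than \<open>2 * C\<close> from \<open>w\<close> the quadratic
    term exceeds whatever the \<open>C\<close>-Lipschitz function \<open>f\<close> can gain, so the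
    minimum over the ball is global.\<close>
  have min: "g z \<le> g y" for y
  proof (cases "y \<in> cball w (2 * C)")
    case False
    then have r: "norm (y - w) > 2 * C" by (simp add: dist_norm norm_minus_commute)
    have "f w - f y \<le> C * norm (y - w)" using lip1[of w y] by (simp add: norm_minus_commute)
    also have "\<dots> \<le> (norm (y - w) / 2) * norm (y - w)" using r by (intro mult_right_mono) auto
    finally have "g w \<le> g y" by (simp add: g_def power2_eq_square)
    then show ?thesis using z(2)[of w] C by simp
  qed (use z in auto)
  have "f z + (w - z) \<bullet> (v - z) \<le> f v" for v
  proof (rule field_le_epsilon)
    fix e :: real assume e: "0 < e"
    define d where "d = v - z"
    \<comment> \<open>The minimality of \<open>z\<close> is tested at
      \<open>z + s *\<^sub>R d\<close>. After division by \<open>s\<close> the quadratic term leaves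
      the error \<open>s * (norm d)\<^sup>2 / 2\<close>, which this choice keeps below
      \<open>e\<close>.\<close>
    define s where "s = min 1 (e / ((norm d)\<^sup>2 + 1))"
    have s: "0 < s" "s \<le> 1" using e by (auto simp: s_def intro!: divide_pos_pos add_nonneg_pos)
    have "s * (norm d)\<^sup>2 \<le> e / ((norm d)\<^sup>2 + 1) * (norm d)\<^sup>2"
      by (intro mult_right_mono) (auto simp: s_def)
    also have "\<dots> \<le> e" using e by (simp add: divide_le_eq add_nonneg_pos not_less algebra_simps)
    finally have se: "s * (norm d)\<^sup>2 \<le> e" .
    define m where "m = z + s *\<^sub>R d"
    \<comment> \<open>A subgradient at the intermediate point, evaluated at both ends, gives the
      convexity inequality on the segment.\<close>
    obtain p where p: "is_subgradient f m p" using sub by blast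
    have 1: "f m - s * (p \<bullet> d) \<le> f z"
      using is_subgradientD[OF p, of z] by (simp add: m_def)
    have "v - m = (1 - s) *\<^sub>R d" by (simp add: m_def d_def algebra_simps)
    then have 2: "f m + (1 - s) * (p \<bullet> d) \<le> f v"
      using is_subgradientD[OF p, of v] by simp
    have conv: "f m \<le> (1 - s) * f z + s * f v"
      using mult_left_mono[OF 1, of "1 - s"] mult_left_mono[OF 2, of s] s by (simp add: algebra_simps)
    have "f z + (norm (z - w))\<^sup>2 / 2 \<le> f m + (norm (z - w + s *\<^sub>R d))\<^sup>2 / 2"
      using min[of m] by (simp add: g_def m_def algebra_simps)
    also have "(norm (z - w + s *\<^sub>R d))\<^sup>2 = (norm (z - w))\<^sup>2 + 2 * s * ((z - w) \<bullet> d) + s\<^sup>2 * (norm d)\<^sup>2"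
      unfolding power2_norm_eq_inner by (simp add: inner_add inner_commute algebra_simps power2_eq_square)
    finally have "s * ((w - z) \<bullet> d) \<le> f m - f z + s\<^sup>2 * (norm d)\<^sup>2 / 2"
      by (simp add: inner_diff_left field_simps)
    also have "\<dots> \<le> s * (f v - f z) + s * (s * (norm d)\<^sup>2 / 2)"
      using conv by (simp add: algebra_simps power2_eq_square)
    also have "\<dots> = s * (f v - f z + s * (norm d)\<^sup>2 / 2)" by (simp add: algebra_simps)
    finally have "(w - z) \<bullet> d \<le> f v - f z + s * (norm d)\<^sup>2 / 2" using s by simp
    then show "f z + (w - z) \<bullet> (v - z) \<le> f v + e" using se e by (simp add: d_def)
  qed
  then show ?thesis by (auto simp: is_subgradient_def)
qed

text \<open>The Riemann sums of the subgradients along the segment from \<open>z\<close> to \<open>z + h\<close> bracket the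
  increment of \<open>f\<close>.\<close>

lemma second_order_expansion_from_subgradients:
  fixes f :: "'a::euclidean_space \<Rightarrow> real"
  assumes sub: "\<And>z. \<exists>p. is_subgradient f z p"
    and A: "linear A"
    and lin: "\<And>e. 0 < e \<Longrightarrow> \<exists>d>0. \<forall>z' p'. norm (z' - z) < d \<and> is_subgradient f z' p' \<longrightarrow>
      norm (p' - p - A (z' - z)) \<le> e * norm (z' - z)"
    and "0 < e"
  shows "\<exists>d>0. \<forall>h. norm h < d \<longrightarrow> \<bar>f (z + h) - f z - p \<bullet> h - h \<bullet> A h / 2\<bar> \<le> e * (norm h)\<^sup>2"
proof -
  obtain d where d: "d > 0" and lin': "\<And>z' p'. norm (z' - z) < d \<Longrightarrow> is_subgradient f z' p' \<Longrightarrow>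
      norm (p' - p - A (z' - z)) \<le> e * norm (z' - z)"
    using lin[OF \<open>0 < e\<close>] by blast
  obtain P where P: "\<And>z. is_subgradient f z (P z)" using sub by metis
  have "\<bar>f (z + h) - f z - p \<bullet> h - h \<bullet> A h / 2\<bar> \<le> e * (norm h)\<^sup>2" if h: "norm h < d" for h
  proof -
    define a where "a = h \<bullet> A h"
    have bound: "\<bar>f (z + h) - f z - p \<bullet> h - a / 2\<bar> \<le> e * (norm h)\<^sup>2 + \<bar>a\<bar> / 2 * (1 / real m)" if m: "m > 0" for m :: nat
    proof -
      define x where "x j = z + (real j / real m) *\<^sub>R h" for j
      have Px: "\<bar>P (x j) \<bullet> h - p \<bullet> h - real j / real m * a\<bar> \<le> e * (norm h)\<^sup>2" if j: "j \<le> m" for j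
      proof -
        have xj: "x j - z = (real j / real m) *\<^sub>R h" by (simp add: x_def)
        have "norm (x j - z) \<le> 1 * norm h"
          unfolding xj norm_scaleR using j m by (intro mult_right_mono) auto
        then have nx: "norm (x j - z) \<le> norm h" by simp
        have "norm (P (x j) - p - A (x j - z)) \<le> e * norm (x j - z)"
          using nx h P by (intro lin') auto
        also have "\<dots> \<le> e * norm h" using nx \<open>0 < e\<close> by simp
        finally have "norm (P (x j) - p - A (x j - z)) * norm h \<le> e * norm h * norm h"
          by (rule mult_right_mono) auto
        then have "\<bar>(P (x j) - p - A (x j - z)) \<bullet> h\<bar> \<le> e * norm h * norm h"
          by (rule order_trans[OF Cauchy_Schwarz_ineq2])
        moreover have "A (x j - z) = (real j / real m) *\<^sub>R A h" by (simp add: xj linear_scale[OF A])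
        ultimately show ?thesis
          by (simp add: inner_diff_left inner_diff_right a_def inner_commute power2_eq_square mult.assoc)
      qed
      have diff: "x (Suc j) - x j = (1 / real m) *\<^sub>R h" for j
        by (simp add: x_def add_divide_distrib flip: scaleR_diff_left)
      define E where "E = e * (norm h)\<^sup>2"
      \<comment> \<open>The subgradient at the right end of a step bounds the increment from above,
        which produces the sum \<open>1 + ... + j\<close>. For \<open>low\<close> the left end is
        used, with the sum \<open>0 + ... + (j - 1)\<close>. The two differ by a term of order
        \<open>1 / m\<close>.\<close>
      have up: "f (x j) \<le> f z + real j / real m * (p \<bullet> h + E) + a * (real j * (real j + 1) / (2 * (real m)\<^sup>2))"
        if "j \<le> m" for j
        using that
      proof (induction j)
        case 0 then show ?case by (simp add: x_def)
      next
        case (Suc j)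
        have "x j - x (Suc j) = - ((1 / real m) *\<^sub>R h)" using diff[of j] by (metis minus_diff_eq)
        then have "f (x (Suc j)) \<le> f (x j) + (P (x (Suc j)) \<bullet> h) / real m"
          using is_subgradientD[OF P, of "x (Suc j)" "x j"] by (simp add: divide_inverse mult.commute)
        also have "\<dots> \<le> f (x j) + (p \<bullet> h + real (Suc j) / real m * a + E) / real m"
          using Px[OF Suc.prems] m by (intro add_left_mono divide_right_mono) (auto simp: E_def)
        also have "\<dots> \<le> f z + real j / real m * (p \<bullet> h + E) + a * (real j * (real j + 1) / (2 * (real m)\<^sup>2))
            + (p \<bullet> h + real (Suc j) / real m * a + E) / real m"
          using Suc by simp
        also have "\<dots> = f z + real (Suc j) / real m * (p \<bullet> h + E) + a * (real (Suc j) * (real (Suc j) + 1) / (2 * (real m)\<^sup>2))"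
          using m by (simp add: field_simps power2_eq_square)
        finally show ?case .
      qed
      have low: "f (x j) \<ge> f z + real j / real m * (p \<bullet> h - E) + a * (real j * (real j - 1) / (2 * (real m)\<^sup>2))"
        if "j \<le> m" for j
        using that
      proof (induction j)
        case 0 then show ?case by (simp add: x_def)
      next
        case (Suc j)
        have "f z + real (Suc j) / real m * (p \<bullet> h - E) + a * (real (Suc j) * (real (Suc j) - 1) / (2 * (real m)\<^sup>2))
          = f z + real j / real m * (p \<bullet> h - E) + a * (real j * (real j - 1) / (2 * (real m)\<^sup>2))
            + (p \<bullet> h + real j / real m * a - E) / real m"
          using m by (simp add: field_simps power2_eq_square)
        also have "\<dots> \<le> f (x j) + (p \<bullet> h + real j / real m * a - E) / real m"
          using Suc by simp
        also have "\<dots> \<le> f (x j) + (P (x j) \<bullet> h) / real m"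
          using Px[of j] Suc.prems m by (intro add_left_mono divide_right_mono) (auto simp: E_def)
        also have "\<dots> \<le> f (x (Suc j))"
          using is_subgradientD[OF P, of "x j" "x (Suc j)"] diff[of j] by (simp add: divide_inverse mult.commute)
        finally show ?case .
      qed
      have xm: "x m = z + h" using m by (simp add: x_def)
      define b where "b = a / 2 * (1 / real m)"
      have "a * (real m * (real m + 1) / (2 * (real m)\<^sup>2)) = a / 2 + b"
        "a * (real m * (real m - 1) / (2 * (real m)\<^sup>2)) = a / 2 - b"
        using m by (simp_all add: b_def field_simps power2_eq_square)
      then have "f (z + h) \<le> f z + (p \<bullet> h + E) + (a / 2 + b)"
        "f (z + h) \<ge> f z + (p \<bullet> h - E) + (a / 2 - b)"
        using up[of m] low[of m] m by (simp_all add: xm)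
      then have "\<bar>f (z + h) - f z - p \<bullet> h - a / 2\<bar> \<le> E + \<bar>b\<bar>"
        by linarith
      then show ?thesis by (simp add: E_def b_def abs_mult)
    qed
    have "(\<lambda>m. e * (norm h)\<^sup>2 + \<bar>a\<bar> / 2 * (1 / real m)) \<longlonglongrightarrow> e * (norm h)\<^sup>2 + \<bar>a\<bar> / 2 * 0"
      by (intro tendsto_intros lim_1_over_n)
    then have "\<bar>f (z + h) - f z - p \<bullet> h - a / 2\<bar> \<le> e * (norm h)\<^sup>2 + \<bar>a\<bar> / 2 * 0"
      by (rule LIMSEQ_le_const) (use bound in \<open>auto intro!: exI[of _ 1]\<close>)
    then show ?thesis by (simp add: a_def)
  qed
  then show ?thesis using d by blast
qed

text \<open>By homogeneity of degree two the bound near 0 holds for all \<open>h\<close>, and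
  \<open>e\<close> is arbitrary. It serves to turn inequalities between second-order expansions into
  inequalities between their quadratic forms.\<close>

lemma quadratic_nonpos_if_little_o:
  fixes X :: "'a::real_normed_vector \<Rightarrow> real"
  assumes hom: "\<And>t h. X (t *\<^sub>R h) = t\<^sup>2 * X h"
    and small: "\<And>e. 0 < e \<Longrightarrow> \<exists>d>0. \<forall>h. norm h < d \<longrightarrow> X h \<le> e * (norm h)\<^sup>2"
  shows "X h \<le> 0"
proof (rule field_le_epsilon)
  fix e :: real assume "0 < e"
  define e' where "e' = e / ((norm h)\<^sup>2 + 1)"
  have "e' > 0" using \<open>0 < e\<close> by (auto simp: e'_def intro!: divide_pos_pos add_nonneg_pos)
  then obtain d where d: "d > 0" "\<And>h. norm h < d \<Longrightarrow> X h \<le> e' * (norm h)\<^sup>2" using small by blast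
  define t where "t = d / (norm h + 1)"
  have t: "t > 0" using d by (auto simp: t_def intro!: divide_pos_pos add_nonneg_pos)
  have "norm (t *\<^sub>R h) < d" using d(1) by (simp add: t_def divide_less_eq add_nonneg_pos)
  then have "t\<^sup>2 * X h \<le> t\<^sup>2 * (e' * (norm h)\<^sup>2)"
    using d(2)[of "t *\<^sub>R h"] t by (simp add: hom power_mult_distrib mult_ac)
  then have "X h \<le> e' * (norm h)\<^sup>2" using t by simp
  also have "\<dots> \<le> e" using \<open>0 < e\<close> by (simp add: e'_def divide_le_eq add_nonneg_pos not_less algebra_simps)
  finally show "X h \<le> 0 + e" by simp
qed

text \<open>Jensen's lemma and Alexandrov's theorem in one: where the tilted function \<open>f - P - q\<close> is
  maximal, \<open>f\<close> is trapped between a plane and a paraboloid, so the resolvent \<open>J = (I + \<partial>f)\<inverse>\<close>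
  has a Lipschitz inverse there. The tilt \<open>q\<close> is a Lipschitz function of the argument of \<open>J\<close>, hence
  the arguments reached in this way are not negligible and Rademacher's theorem provides one of
  them at which \<open>J\<close> is differentiable, with an invertible derivative.\<close>

theorem jensen_alexandrov:
  fixes f :: "'a::euclidean_space \<Rightarrow> real"
  assumes sub: "\<And>z. \<exists>p. norm p \<le> C \<and> is_subgradient f z p"
    and L: "linear L" and Lsym: "\<And>x y. x \<bullet> L y = y \<bullet> L x"
    and touch: "\<And>z. f z \<le> f z0 + g \<bullet> (z - z0) + (z - z0) \<bullet> L (z - z0) / 2"
    and \<delta>: "0 < \<delta>"
  obtains z p A where "norm (z - z0) < \<delta>" "linear A"
    "\<forall>h. 0 \<le> h \<bullet> A h" "\<forall>h. h \<bullet> A h \<le> h \<bullet> L h + \<delta> * (norm h)\<^sup>2"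
    "\<forall>e>0. \<exists>d>0. \<forall>h. norm h < d \<longrightarrow>
      \<bar>f (z + h) - f z - p \<bullet> h - h \<bullet> A h / 2\<bar> \<le> e * (norm h)\<^sup>2"
proof -
  obtain B0 where B0: "B0 > 0" "\<And>x. norm (L x) \<le> B0 * norm x"
    using linear_bounded_pos[OF L] by blast
  have LL: "h \<bullet> L h \<le> B0 * (norm h)\<^sup>2" for h
    using order_trans[OF norm_cauchy_schwarz[of h "L h"] mult_left_mono[OF B0(2)[of h] norm_ge_zero[of h]]]
    by (simp add: power2_eq_square mult_ac)
  define \<Lambda> where "\<Lambda> = B0 + \<delta>"
  have \<Lambda>: "\<Lambda> > 0" using B0 \<delta> by (simp add: \<Lambda>_def)
  have contf: "continuous_on S f" for S
    using lipschitz_on_continuous_on[OF lipschitz_if_bounded_subgradients[OF sub]] continuous_on_subset by blast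
  have contL: "continuous_on S L" for S using L by (simp add: linear_continuous_on linear_linear)
  obtain J where J: "\<And>w. is_subgradient f (J w) (w - J w)"
    using resolvent_exists[of C f, OF sub] by metis
  have J1: "norm (J w - J w') \<le> norm (w - w')" for w w'
    by (rule resolvent_nonexpansive[OF J J])
  have Juniq: "J (z + p) = z" if "is_subgradient f z p" for z p
    using resolvent_nonexpansive[OF J[of "z + p"], of z "z + p"] that by simp
  \<comment> \<open>\<open>w\<close> is the argument of the resolvent, so \<open>w - J w\<close> is
    the subgradient at the contact point \<open>J w\<close>. The paraboloid touching there from
    above has this slope and the Hessian \<open>L\<close> plus \<delta>.\<close>
  define touched where "touched w \<longleftrightarrow> norm (J w - z0) < \<delta> \<and>
    (\<forall>h. f (J w + h) \<le> f (J w) + (w - J w) \<bullet> h + h \<bullet> L h / 2 + \<delta> / 2 * (norm h)\<^sup>2)" for w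
  \<comment> \<open>Recovers the tilt: at a maximum of the tilted function the subgradient
    \<open>w - J w\<close> equals the gradient of the touching paraboloid plus
    \<open>q\<close>.\<close>
  define T where "T w = w - J w - g - L (J w - z0) - \<delta> *\<^sub>R (J w - z0)" for w
  have T_onto: "\<exists>w. touched w \<and> T w = q" if q: "norm q < \<delta>\<^sup>2 / 4" for q
  proof -
    define \<phi> where "\<phi> z = f z - (f z0 + g \<bullet> (z - z0) + (z - z0) \<bullet> L (z - z0) / 2)
      - \<delta> / 2 * (norm (z - z0))\<^sup>2 - q \<bullet> (z - z0)" for z
    have "continuous_on (cball z0 \<delta>) \<phi>"
      unfolding \<phi>_def by (intro continuous_intros contf continuous_on_compose2[OF contL[of UNIV]]) auto
    then obtain z where z: "z \<in> cball z0 \<delta>" "\<And>y. y \<in> cball z0 \<delta> \<Longrightarrow> \<phi> y \<le> \<phi> z"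
      using continuous_attains_sup[of "cball z0 \<delta>" \<phi>] \<delta> by auto
    have \<phi>0: "\<phi> z0 = 0" by (simp add: \<phi>_def linear_0[OF L])
    \<comment> \<open>The bound \<open>\<delta>\<^sup>2 / 4\<close> on the tilt is chosen for this:
      beyond distance \<open>\<delta> / 2\<close> the quadratic penalty outweighs the tilt, so the
      maximum over the ball is a global one and close to \<open>z0\<close>.\<close>
    have neg: "\<phi> y < 0" if "norm (y - z0) > \<delta> / 2" for y
    proof -
      have "- (q \<bullet> (y - z0)) \<le> norm q * norm (y - z0)"
        using norm_cauchy_schwarz[of "- q" "y - z0"] by simp
      moreover have "norm q * norm (y - z0) < \<delta>\<^sup>2 / 4 * norm (y - z0)"
        using q that \<delta> by (intro mult_strict_right_mono) auto
      moreover have "\<delta>\<^sup>2 / 4 * norm (y - z0) \<le> \<delta> / 2 * (norm (y - z0))\<^sup>2"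
      proof -
        have "\<delta> / 2 * (norm (y - z0)) * (\<delta> / 2) \<le> \<delta> / 2 * (norm (y - z0)) * norm (y - z0)"
          using that \<delta> by (intro mult_left_mono) auto
        then show ?thesis by (simp add: power2_eq_square mult_ac)
      qed
      ultimately show ?thesis using touch[of y] unfolding \<phi>_def by linarith
    qed
    have \<phi>z: "\<phi> z \<ge> 0" using z(2)[of z0] \<phi>0 \<delta> by simp
    then have zz: "norm (z - z0) \<le> \<delta> / 2" using neg[of z] by (meson not_le)
    have max: "\<phi> y \<le> \<phi> z" for y
      using z(2)[of y] neg[of y] \<phi>z \<delta> by (cases "y \<in> cball z0 \<delta>") (auto simp: dist_norm norm_minus_commute)
    define p where "p = g + L (z - z0) + \<delta> *\<^sub>R (z - z0) + q"
    have up: "f (z + h) \<le> f z + p \<bullet> h + h \<bullet> L h / 2 + \<delta> / 2 * (norm h)\<^sup>2" for h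
    proof -
      have 1: "(z + h - z0) \<bullet> L (z + h - z0) = (z - z0) \<bullet> L (z - z0) + 2 * (L (z - z0) \<bullet> h) + h \<bullet> L h"
      proof -
        have "z + h - z0 = (z - z0) + h" by simp
        then show ?thesis using Lsym[of "z - z0" h]
          by (simp only: linear_add[OF L] inner_add) (simp add: inner_commute)
      qed
      have 2: "(norm (z + h - z0))\<^sup>2 = (norm (z - z0))\<^sup>2 + 2 * ((z - z0) \<bullet> h) + (norm h)\<^sup>2"
      proof -
        have "z + h - z0 = (z - z0) + h" by simp
        then show ?thesis unfolding power2_norm_eq_inner by (simp only: inner_add) (simp add: inner_commute)
      qed
      have 3: "\<delta> / 2 * ((norm (z - z0))\<^sup>2 + 2 * ((z - z0) \<bullet> h) + (norm h)\<^sup>2)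
          = \<delta> / 2 * (norm (z - z0))\<^sup>2 + \<delta> * ((z - z0) \<bullet> h) + \<delta> / 2 * (norm h)\<^sup>2"
        by (simp add: field_simps)
      have 4: "g \<bullet> (z + h - z0) = g \<bullet> (z - z0) + g \<bullet> h" "q \<bullet> (z + h - z0) = q \<bullet> (z - z0) + q \<bullet> h"
        by (simp_all add: inner_add_right inner_diff_right)
      show ?thesis using max[of "z + h"] unfolding \<phi>_def 1 2 3 4 p_def inner_add_left inner_scaleR_left by (simp add: add_divide_distrib)
    qed
    obtain s where s: "is_subgradient f z s" using sub by blast
    \<comment> \<open>A plane below and a paraboloid above with the same contact point have the same
      slope there. The test vector has the factor \<open>1 / \<Lambda>\<close>, which minimises the
      quadratic bound.\<close>
    have "s = p"
    proof (rule ccontr)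
      assume "s \<noteq> p"
      define r where "r = norm (s - p)"
      have r: "r > 0" using \<open>s \<noteq> p\<close> by (simp add: r_def)
      define t where "t = 1 / \<Lambda>"
      have t: "t > 0" using \<Lambda> by (simp add: t_def)
      define h where "h = t *\<^sub>R (s - p)"
      have "s \<bullet> h \<le> p \<bullet> h + B0 * (norm h)\<^sup>2 / 2 + \<delta> / 2 * (norm h)\<^sup>2"
        using is_subgradientD[OF s, of "z + h"] up[of h] LL[of h] by simp
      then have "(s - p) \<bullet> h \<le> \<Lambda> / 2 * (norm h)\<^sup>2" by (simp add: \<Lambda>_def inner_diff_left field_simps)
      moreover have "(s - p) \<bullet> h = t * r\<^sup>2" by (simp add: h_def r_def power2_norm_eq_inner)
      moreover have "\<Lambda> / 2 * (norm h)\<^sup>2 = t * r\<^sup>2 / 2"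
        using t \<Lambda> by (simp add: h_def r_def power_mult_distrib) (simp add: t_def power2_eq_square)
      ultimately show False using t r by simp
    qed
    then have "J (z + p) = z" using s Juniq by blast
    then have "touched (z + p)" using zz up \<delta> by (auto simp: touched_def)
    moreover have "T (z + p) = q" using \<open>J (z + p) = z\<close> by (simp add: T_def p_def)
    ultimately show ?thesis by blast
  qed
  have Tlip: "norm (T w - T w') \<le> (2 + B0 + \<delta>) * norm (w - w')" for w w'
  proof -
    have "T w - T w' = (w - w') - (J w - J w') - L (J w - J w') - \<delta> *\<^sub>R (J w - J w')"
      by (simp add: T_def linear_diff[OF L] algebra_simps)
    also have "norm \<dots> \<le> norm (w - w') + norm (J w - J w') + norm (L (J w - J w')) + norm (\<delta> *\<^sub>R (J w - J w'))"
      by (intro order_trans[OF norm_triangle_ineq4] add_right_mono order_refl)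
    also have "\<dots> \<le> norm (w - w') + norm (w - w') + B0 * norm (w - w') + \<delta> * norm (w - w')"
      using J1[of w w'] \<delta> B0(1) order_trans[OF B0(2) mult_left_mono[OF J1[of w w'], of B0]]
      by (intro add_mono) auto
    finally show ?thesis by (simp add: algebra_simps)
  qed
  have "\<not> negligible {w. touched w}"
  proof
    assume "negligible {w. touched w}"
    then have "negligible (T ` {w. touched w})"
      using Tlip by (intro negligible_locally_Lipschitz_image)
        (auto intro!: exI[of _ UNIV] exI[of _ "2 + B0 + \<delta>"])
    moreover have "ball 0 (\<delta>\<^sup>2 / 4) \<subseteq> T ` {w. touched w}" using T_onto by force
    ultimately have "negligible (ball (0::'a) (\<delta>\<^sup>2 / 4))" using negligible_subset by blast
    then show False using \<delta> open_not_negligible[of "ball (0::'a) (\<delta>\<^sup>2 / 4)"] by simp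
  qed
  moreover have "negligible {w. \<not> J differentiable (at w)}"
    using rademacher[of J 1] J1 by simp
  ultimately obtain w where w: "touched w" "J differentiable (at w)"
    by (metis (mono_tags, lifting) mem_Collect_eq negligible_subset subsetI)
  define z where "z = J w"
  define p where "p = w - z"
  have zp: "is_subgradient f z p" using J[of w] by (simp add: z_def p_def)
  have up: "f (z + h) \<le> f z + p \<bullet> h + h \<bullet> L h / 2 + \<delta> / 2 * (norm h)\<^sup>2" for h
    using w(1) by (simp add: touched_def z_def p_def)
  have up': "f (z + h) \<le> f z + p \<bullet> h + \<Lambda> / 2 * (norm h)\<^sup>2" for h
    using up[of h] LL[of h] by (simp add: \<Lambda>_def field_simps)
  \<comment> \<open>At \<open>z' + k\<close>, with \<open>k\<close> a multiple of
    \<open>p' - p\<close>, the subgradient inequality at \<open>z'\<close> pushes \<open>f\<close>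
    up while the paraboloid at \<open>z\<close> holds it down. This forces
    \<open>2 * norm k \<le> norm (d + k)\<close>, impossible if
    \<open>norm d < norm k\<close>.\<close>
  have grad_lip: "norm (p' - p) \<le> 2 * \<Lambda> * norm (z' - z)" if zp': "is_subgradient f z' p'" for z' p'
  proof (rule ccontr)
    assume neg: "\<not> ?thesis"
    define r where "r = norm (p' - p)"
    define d where "d = z' - z"
    have r: "r > 2 * \<Lambda> * norm d" using neg by (simp add: r_def d_def)
    then have r0: "r > 0" using \<Lambda> by (smt (verit) mult_nonneg_nonneg norm_ge_zero)
    define k where "k = (1 / (2 * \<Lambda>)) *\<^sub>R (p' - p)"
    have nk: "norm k = r / (2 * \<Lambda>)" using \<Lambda> by (simp add: k_def r_def)
    have dk: "norm d < norm k" using r \<Lambda> unfolding nk by (simp add: field_simps)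
    have "f z' + p' \<bullet> k \<le> f (z' + k)" using is_subgradientD[OF zp', of "z' + k"] by simp
    also have "z' + k = z + (d + k)" by (simp add: d_def)
    also have "f (z + (d + k)) \<le> f z + p \<bullet> (d + k) + \<Lambda> / 2 * (norm (d + k))\<^sup>2" by (rule up')
    finally have "(p' - p) \<bullet> k \<le> \<Lambda> / 2 * (norm (d + k))\<^sup>2"
      using is_subgradientD[OF zp, of z'] by (simp add: d_def inner_add inner_diff_left inner_diff_right)
    also have "(p' - p) \<bullet> k = 2 * \<Lambda> * (norm k)\<^sup>2"
      using \<Lambda> unfolding nk by (simp add: k_def r_def power2_norm_eq_inner power_divide) (simp add: power2_eq_square)
    finally have "4 * (norm k)\<^sup>2 \<le> (norm (d + k))\<^sup>2" using \<Lambda> by simp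
    then have "(2 * norm k)\<^sup>2 \<le> (norm (d + k))\<^sup>2" by (simp add: power_mult_distrib)
    then have "2 * norm k \<le> norm (d + k)" by (rule power2_le_imp_le) simp
    then show False using norm_triangle_ineq[of d k] dk by simp
  qed
  define M where "M = 1 + 2 * \<Lambda>"
  have M: "M > 0" using \<Lambda> by (simp add: M_def)
  have Jlow: "norm (z' + p' - w) \<le> M * norm (z' - z)" if "is_subgradient f z' p'" for z' p'
  proof -
    have "z' + p' - w = (z' - z) + (p' - p)" by (simp add: p_def)
    then show ?thesis
      using grad_lip[OF that] norm_triangle_ineq[of "z' - z" "p' - p"] by (simp add: M_def algebra_simps)
  qed
  obtain B where B: "(J has_derivative B) (at w)" using w(2) by (auto simp: differentiable_def)
  have linB: "linear B" using B has_derivative_linear by blast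
  \<comment> \<open>By \<open>Jlow\<close>, \<open>J\<close> contracts distances from
    \<open>w\<close> at most by the factor \<open>M\<close>. The derivative inherits this and is
    therefore injective.\<close>
  have Blow: "norm k \<le> M * norm (B k)" for k
  proof (cases "k = 0")
    case False
    show ?thesis
    proof (rule field_le_epsilon)
      fix e :: real assume e: "0 < e"
      define e' where "e' = e / (M * norm k)"
      have e': "e' > 0" using e M False by (simp add: e'_def)
      obtain d where d: "d > 0" "\<And>y. norm (y - w) < d \<Longrightarrow> norm (J y - J w - B (y - w)) \<le> e' * norm (y - w)"
        using B e' unfolding has_derivative_at_alt by blast
      define t where "t = d / (2 * norm k)"
      have t: "t > 0" using d False by (simp add: t_def)
      have "norm (t *\<^sub>R k) < d" using d False by (simp add: t_def)
      then have 1: "norm (J (w + t *\<^sub>R k) - z - t *\<^sub>R B k) \<le> e' * (t * norm k)"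
        using d(2)[of "w + t *\<^sub>R k"] t by (simp add: z_def linear_scale[OF linB])
      have "t * norm k \<le> M * norm (J (w + t *\<^sub>R k) - z)"
        using Jlow[OF J[of "w + t *\<^sub>R k"]] t by simp
      also have "\<dots> \<le> M * (t * norm (B k) + e' * (t * norm k))"
        using 1 norm_triangle_ineq2[of "J (w + t *\<^sub>R k) - z" "t *\<^sub>R B k"] M t by (intro mult_left_mono) auto
      also have "\<dots> = t * (M * norm (B k) + e)"
        using M False by (simp add: e'_def field_simps)
      finally show "norm k \<le> M * norm (B k) + e" using t by simp
    qed
  qed (use M in simp)
  then have "inj B" using linear_injective_0[OF linB] by (metis mult_zero_right norm_eq_zero norm_le_zero_iff)
  then obtain B' where B': "linear B'" "\<And>x. B' (B x) = x" "\<And>x. B (B' x) = x"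
    using linear_injective_isomorphism[OF linB] by blast
  have B'M: "norm (B' k) \<le> M * norm k" for k using Blow[of "B' k"] B' by simp
  \<comment> \<open>From \<open>w = z + p\<close>: the increment of the subgradient is that of
    \<open>w\<close> minus that of \<open>z\<close>, and to first order the former is the inverse
    derivative applied to the latter.\<close>
  define A where "A k = B' k - k" for k
  have linA: "linear A" unfolding A_def using B'(1) by (intro linear_compose_sub) (auto simp: linear_ident)
  have subexp: "\<exists>d>0. \<forall>z' p'. norm (z' - z) < d \<and> is_subgradient f z' p' \<longrightarrow>
      norm (p' - p - A (z' - z)) \<le> e * norm (z' - z)" if e: "0 < e" for e
  proof -
    \<comment> \<open>One factor \<open>M\<close> comes from bounding \<open>y - w\<close> by
      \<open>z' - z\<close>, the other from applying \<open>B'\<close> to the error.\<close>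
    define e' where "e' = e / M\<^sup>2"
    have e': "e' > 0" using e M by (simp add: e'_def)
    obtain d where d: "d > 0" "\<And>y. norm (y - w) < d \<Longrightarrow> norm (J y - J w - B (y - w)) \<le> e' * norm (y - w)"
      using B e' unfolding has_derivative_at_alt by blast
    have "norm (p' - p - A (z' - z)) \<le> e * norm (z' - z)"
      if z': "norm (z' - z) < d / M" and zp': "is_subgradient f z' p'" for z' p'
    proof -
      define y where "y = z' + p'"
      have yw: "norm (y - w) \<le> M * norm (z' - z)" using Jlow[OF zp'] by (simp add: y_def)
      also have "\<dots> < d" using z' M by (simp add: field_simps)
      finally have "norm (z' - z - B (y - w)) \<le> e' * norm (y - w)"
        using d(2)[of y] Juniq[OF zp'] by (simp add: y_def z_def)
      also have "\<dots> \<le> e' * (M * norm (z' - z))" using yw e' by simp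
      finally have 1: "norm (z' - z - B (y - w)) \<le> e' * (M * norm (z' - z))" .
      have "p' - p - A (z' - z) = - B' (z' - z - B (y - w))"
        by (simp add: linear_diff[OF B'(1)] B'(2) A_def y_def p_def)
      then have "norm (p' - p - A (z' - z)) \<le> M * norm (z' - z - B (y - w))"
        using B'M by (metis norm_minus_cancel)
      also have "\<dots> \<le> M * (e' * (M * norm (z' - z)))" using 1 M by simp
      also have "\<dots> = e * norm (z' - z)" using M by (simp add: e'_def power2_eq_square)
      finally show ?thesis .
    qed
    then show ?thesis using d(1) M by (intro exI[of _ "d / M"]) auto
  qed
  have exp: "\<exists>d>0. \<forall>h. norm h < d \<longrightarrow> \<bar>f (z + h) - f z - p \<bullet> h - h \<bullet> A h / 2\<bar> \<le> e * (norm h)\<^sup>2"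
    if "0 < e" for e
    using second_order_expansion_from_subgradients[OF _ linA subexp that] sub by blast
  have "- (h \<bullet> A h / 2) \<le> 0" for h
  proof (rule quadratic_nonpos_if_little_o[where X = "\<lambda>h. - (h \<bullet> A h / 2)"])
    show "- (t *\<^sub>R h \<bullet> A (t *\<^sub>R h) / 2) = t\<^sup>2 * - (h \<bullet> A h / 2)" for t h
      by (simp add: linear_scale[OF linA] power2_eq_square)
    fix e :: real assume "0 < e"
    obtain d where d: "d > 0" "\<And>h. norm h < d \<Longrightarrow> \<bar>f (z + h) - f z - p \<bullet> h - h \<bullet> A h / 2\<bar> \<le> e * (norm h)\<^sup>2"
      using exp[OF \<open>0 < e\<close>] by blast
    have "- (h \<bullet> A h / 2) \<le> e * (norm h)\<^sup>2" if "norm h < d" for h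
      using d(2)[OF that] is_subgradientD[OF zp, of "z + h"] by simp
    then show "\<exists>d>0. \<forall>h. norm h < d \<longrightarrow> - (h \<bullet> A h / 2) \<le> e * (norm h)\<^sup>2" using d(1) by blast
  qed
  then have A0: "0 \<le> h \<bullet> A h" for h by (simp add: mult_le_0_iff)
  have "h \<bullet> A h / 2 - h \<bullet> L h / 2 - \<delta> / 2 * (norm h)\<^sup>2 \<le> 0" for h
  proof (rule quadratic_nonpos_if_little_o[where X = "\<lambda>h. h \<bullet> A h / 2 - h \<bullet> L h / 2 - \<delta> / 2 * (norm h)\<^sup>2"])
    show "t *\<^sub>R h \<bullet> A (t *\<^sub>R h) / 2 - t *\<^sub>R h \<bullet> L (t *\<^sub>R h) / 2 - \<delta> / 2 * (norm (t *\<^sub>R h))\<^sup>2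
        = t\<^sup>2 * (h \<bullet> A h / 2 - h \<bullet> L h / 2 - \<delta> / 2 * (norm h)\<^sup>2)" for t h
      by (simp add: linear_scale[OF linA] linear_scale[OF L] power_mult_distrib algebra_simps) (simp add: power2_eq_square)
    fix e :: real assume "0 < e"
    obtain d where d: "d > 0" "\<And>h. norm h < d \<Longrightarrow> \<bar>f (z + h) - f z - p \<bullet> h - h \<bullet> A h / 2\<bar> \<le> e * (norm h)\<^sup>2"
      using exp[OF \<open>0 < e\<close>] by blast
    have "h \<bullet> A h / 2 - h \<bullet> L h / 2 - \<delta> / 2 * (norm h)\<^sup>2 \<le> e * (norm h)\<^sup>2" if "norm h < d" for h
      using d(2)[OF that] up[of h] by simp
    then show "\<exists>d>0. \<forall>h. norm h < d \<longrightarrow> h \<bullet> A h / 2 - h \<bullet> L h / 2 - \<delta> / 2 * (norm h)\<^sup>2 \<le> e * (norm h)\<^sup>2"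
      using d(1) by blast
  qed
  note upper = this
  have "h \<bullet> A h \<le> h \<bullet> L h + \<delta> * (norm h)\<^sup>2" for h using upper[of h] by (simp add: field_simps)
  moreover have "norm (z - z0) < \<delta>" using w(1) by (simp add: touched_def z_def)
  ultimately show thesis using that[of z A p] linA A0 exp by blast
qed

section \<open>The theorem on sums\<close>

lemma usc_on_metric:
  fixes f :: "'a::metric_space \<Rightarrow> real"
  shows "usc_on S f \<longleftrightarrow> (\<forall>x\<in>S. \<forall>e>0. \<exists>d>0. \<forall>y\<in>S. dist y x < d \<longrightarrow> f y < f x + e)"
proof
  assume usc: "usc_on S f"
  show "\<forall>x\<in>S. \<forall>e>0. \<exists>d>0. \<forall>y\<in>S. dist y x < d \<longrightarrow> f y < f x + e"
  proof (intro ballI allI impI)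
    fix x and e :: real assume x: "x \<in> S" "0 < e"
    have "openin (top_of_set S) {y\<in>S. f y < f x + e}" using usc by (simp add: usc_on_def)
    then show "\<exists>d>0. \<forall>y\<in>S. dist y x < d \<longrightarrow> f y < f x + e"
      using x unfolding openin_euclidean_subtopology_iff by auto
  qed
next
  assume *: "\<forall>x\<in>S. \<forall>e>0. \<exists>d>0. \<forall>y\<in>S. dist y x < d \<longrightarrow> f y < f x + e"
  show "usc_on S f"
    unfolding usc_on_def openin_euclidean_subtopology_iff
  proof (intro allI conjI ballI)
    fix c x assume "x \<in> {x \<in> S. f x < c}"
    then obtain d where "d > 0" "\<forall>y\<in>S. dist y x < d \<longrightarrow> f y < f x + (c - f x)"
      using *[rule_format, of x "c - f x"] by auto
    then show "\<exists>e>0. \<forall>x'\<in>S. dist x' x < e \<longrightarrow> x' \<in> {x \<in> S. f x < c}"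
      by (intro exI[of _ d]) auto
  qed auto
qed

lemma usc_on_add:
  fixes f g :: "'a::metric_space \<Rightarrow> real"
  assumes "usc_on S f" "usc_on S g"
  shows "usc_on S (\<lambda>x. f x + g x)"
  unfolding usc_on_metric
proof (intro ballI allI impI)
  fix x and e :: real assume x: "x \<in> S" "0 < e"
  obtain d1 where d1: "d1 > 0" "\<And>y. y \<in> S \<Longrightarrow> dist y x < d1 \<Longrightarrow> f y < f x + e / 2"
    using assms(1) x half_gt_zero[of e] unfolding usc_on_metric by blast
  obtain d2 where d2: "d2 > 0" "\<And>y. y \<in> S \<Longrightarrow> dist y x < d2 \<Longrightarrow> g y < g x + e / 2"
    using assms(2) x half_gt_zero[of e] unfolding usc_on_metric by blast
  have "f y + g y < f x + g x + e" if "y \<in> S" "dist y x < min d1 d2" for y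
    using d1(2)[of y] d2(2)[of y] that by simp
  then show "\<exists>d>0. \<forall>y\<in>S. dist y x < d \<longrightarrow> f y + g y < f x + g x + e"
    using d1 d2 by (intro exI[of _ "min d1 d2"]) auto
qed

lemma continuous_on_imp_usc_on:
  fixes f :: "'a::metric_space \<Rightarrow> real"
  assumes "continuous_on S f"
  shows "usc_on S f"
  unfolding usc_on_metric
proof (intro ballI allI impI)
  fix x and e :: real assume "x \<in> S" "0 < e"
  then obtain d where "d > 0" "\<forall>y\<in>S. dist y x < d \<longrightarrow> dist (f y) (f x) < e"
    using assms unfolding continuous_on_iff by blast
  then show "\<exists>d>0. \<forall>y\<in>S. dist y x < d \<longrightarrow> f y < f x + e"
    by (intro exI[of _ d]) (auto simp: dist_real_def)
qed

lemma usc_on_fst: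
  fixes f :: "'a::metric_space \<Rightarrow> real" and T :: "'b::metric_space set"
  assumes "usc_on S f" shows "usc_on (S \<times> T) (\<lambda>z. f (fst z))"
  unfolding usc_on_metric
proof (intro ballI allI impI)
  fix x and e :: real assume x: "x \<in> S \<times> T" "0 < e"
  then have "fst x \<in> S" by auto
  then obtain d where "d > 0" and d: "\<And>y. y \<in> S \<Longrightarrow> dist y (fst x) < d \<Longrightarrow> f y < f (fst x) + e"
    using assms \<open>0 < e\<close> unfolding usc_on_metric by blast
  have "f (fst y) < f (fst x) + e" if "y \<in> S \<times> T" "dist y x < d" for y
    using d[of "fst y"] that dist_fst_le[of y x] by auto
  then show "\<exists>d>0. \<forall>y\<in>S \<times> T. dist y x < d \<longrightarrow> f (fst y) < f (fst x) + e" using \<open>d > 0\<close> by blast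
qed

lemma usc_on_snd:
  fixes f :: "'a::metric_space \<Rightarrow> real" and T :: "'b::metric_space set"
  assumes "usc_on S f" shows "usc_on (T \<times> S) (\<lambda>z. f (snd z))"
  unfolding usc_on_metric
proof (intro ballI allI impI)
  fix x and e :: real assume x: "x \<in> T \<times> S" "0 < e"
  then have "snd x \<in> S" by auto
  then obtain d where "d > 0" and d: "\<And>y. y \<in> S \<Longrightarrow> dist y (snd x) < d \<Longrightarrow> f y < f (snd x) + e"
    using assms \<open>0 < e\<close> unfolding usc_on_metric by blast
  have "f (snd y) < f (snd x) + e" if "y \<in> T \<times> S" "dist y x < d" for y
    using d[of "snd y"] that dist_snd_le[of y x] by auto
  then show "\<exists>d>0. \<forall>y\<in>T \<times> S. dist y x < d \<longrightarrow> f (snd y) < f (snd x) + e" using \<open>d > 0\<close> by blast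
qed

text \<open>Without a maximum the relatively open sets \<open>{x\<in>S. f x < f y}\<close> would
  cover \<open>S\<close>; in a finite subcover the \<open>y\<close> with the largest value is left
  uncovered.\<close>

lemma usc_on_attains_sup:
  fixes f :: "'a::metric_space \<Rightarrow> real"
  assumes "compact S" "S \<noteq> {}" and usc: "usc_on S f"
  shows "\<exists>x\<in>S. \<forall>y\<in>S. f y \<le> f x"
proof (rule ccontr)
  assume no: "\<not> ?thesis"
  define G where "G y = {x\<in>S. f x < f y}" for y
  have "\<forall>c\<in>G ` S. openin (top_of_set S) c" using usc by (auto simp: usc_on_def G_def)
  moreover have "S \<subseteq> \<Union>(G ` S)" using no by (auto simp: G_def not_le)
  ultimately obtain D where D: "D \<subseteq> G ` S" "finite D" "S \<subseteq> \<Union>D"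
    using \<open>compact S\<close> unfolding compact_eq_openin_cover by meson
  then obtain E where E: "finite E" "E \<subseteq> S" "D = G ` E" using finite_subset_image by metis
  with D \<open>S \<noteq> {}\<close> have "E \<noteq> {}" by auto
  then have "Max (f ` E) \<in> f ` E" using E(1) by (intro Max_in) auto
  then obtain y where y: "y \<in> E" "Max (f ` E) = f y" by blast
  then have "y \<in> \<Union>(G ` E)" using D E by blast
  then obtain x where "x \<in> E" "f y < f x" by (auto simp: G_def)
  then show False using y E(1) Max_ge[of "f ` E" "f x"] by auto
qed

section \<open>Sup-convolutions and their jets\<close>

lemma norm_add_sq_le: "(norm (x + y))\<^sup>2 \<le> 2 * (norm x)\<^sup>2 + 2 * (norm (y::'a::real_inner))\<^sup>2"
proof -
  have "2 * (norm x)\<^sup>2 + 2 * (norm y)\<^sup>2 - (norm (x + y))\<^sup>2 = (norm (x - y))\<^sup>2"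
    unfolding power2_norm_eq_inner by (simp add: inner_add inner_diff inner_commute)
  then show ?thesis using zero_le_power2[of "norm (x - y)"] by linarith
qed

text \<open>Splits the penalty on \<open>x - y\<close> into a penalty on
  \<open>\<xi> - \<eta>\<close> and the two sup-convolution terms. Equality holds when
  \<open>x - \<xi>\<close> and \<open>\<eta> - y\<close> are both half of
  \<open>\<xi> - \<eta>\<close>.\<close>

lemma norm_diff_sq_le:
  "(norm (x - y))\<^sup>2 \<le> 2 * (norm (\<xi> - \<eta>))\<^sup>2 + 4 * (norm (x - \<xi>))\<^sup>2 + 4 * (norm (y - \<eta> :: 'a::real_inner))\<^sup>2"
proof -
  have "x - y = (\<xi> - \<eta>) + ((x - \<xi>) + (\<eta> - y))" by simp
  then have "(norm (x - y))\<^sup>2 \<le> 2 * (norm (\<xi> - \<eta>))\<^sup>2 + 2 * (norm ((x - \<xi>) + (\<eta> - y)))\<^sup>2"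
    using norm_add_sq_le[of "\<xi> - \<eta>" "(x - \<xi>) + (\<eta> - y)"] by metis
  moreover have "(norm ((x - \<xi>) + (\<eta> - y)))\<^sup>2 \<le> 2 * (norm (x - \<xi>))\<^sup>2 + 2 * (norm (y - \<eta>))\<^sup>2"
    using norm_add_sq_le[of "x - \<xi>" "\<eta> - y"] by (simp add: norm_minus_commute)
  ultimately show ?thesis by linarith
qed

text \<open>The test function for \<open>a\<close> at the maximiser \<open>S \<xi>\<close> of the sup-convolution is the one for the
  sup-convolution at \<open>\<xi>\<close>, translated by \<open>S \<xi> - \<xi>\<close>.\<close>

lemma jet_of_sup_convolution:
  fixes a F :: "'a::real_inner \<Rightarrow> real"
  assumes F: "\<And>x \<xi>. x \<in> C \<Longrightarrow> a x - \<beta> / 2 * (norm x)\<^sup>2 + \<beta> * (x \<bullet> \<xi>) \<le> F \<xi>"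
    and x: "F \<xi> = a x - \<beta> / 2 * (norm x)\<^sup>2 + \<beta> * (x \<bullet> \<xi>)"
    and exp: "F (\<xi> + h) - F \<xi> - p \<bullet> h - h \<bullet> A h / 2 \<le> E"
    and xh: "x + h \<in> C"
  shows "a (x + h) \<le> a x + (p - \<beta> *\<^sub>R \<xi>) \<bullet> h + h \<bullet> (A h - \<beta> *\<^sub>R h) / 2 + E"
proof -
  have n: "(norm (x + h))\<^sup>2 = (norm x)\<^sup>2 + 2 * (x \<bullet> h) + (norm h)\<^sup>2" "h \<bullet> h = (norm h)\<^sup>2"
    unfolding power2_norm_eq_inner by (simp_all add: inner_add inner_commute)
  have "a (x + h) \<le> F (\<xi> + h) + \<beta> / 2 * (norm (x + h))\<^sup>2 - \<beta> * ((x + h) \<bullet> (\<xi> + h))"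
    using F[OF xh, of "\<xi> + h"] by simp
  also have "\<dots> \<le> F \<xi> + p \<bullet> h + h \<bullet> A h / 2 + E + \<beta> / 2 * (norm (x + h))\<^sup>2 - \<beta> * ((x + h) \<bullet> (\<xi> + h))"
    using exp by simp
  also have "\<dots> = a x + (p - \<beta> *\<^sub>R \<xi>) \<bullet> h + h \<bullet> (A h - \<beta> *\<^sub>R h) / 2 + E"
  proof -
    have "(x + h) \<bullet> (\<xi> + h) = x \<bullet> \<xi> + x \<bullet> h + \<xi> \<bullet> h + (norm h)\<^sup>2"
      by (simp add: inner_add inner_commute flip: n(2))
    moreover have "(p - \<beta> *\<^sub>R \<xi>) \<bullet> h = p \<bullet> h - \<beta> * (\<xi> \<bullet> h)" "h \<bullet> (A h - \<beta> *\<^sub>R h) = h \<bullet> A h - \<beta> * (norm h)\<^sup>2"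
      by (simp_all add: inner_diff n(2))
    ultimately show ?thesis unfolding x n(1) by (simp add: field_simps)
  qed
  finally show ?thesis .
qed

text \<open>In the theorem of Crandall and Ishii, \<open>(x, y)\<close> is a maximum point and the jets are limits of
  jets at nearby points; here they are jets at an approximate maximum point.\<close>

theorem theorem_on_sums:
  fixes a b :: "'a::euclidean_space \<Rightarrow> real"
  assumes C: "compact C" "C \<noteq> {}" and usc: "usc_on C a" "usc_on C b" and \<alpha>: "0 < \<alpha>" and \<kappa>: "0 < \<kappa>"
  obtains x y p q X Y where "x \<in> C" "y \<in> C"
    "\<And>x' y'. x' \<in> C \<Longrightarrow> y' \<in> C \<Longrightarrow>
      a x' + b y' - \<alpha> / 2 * (norm (x' - y'))\<^sup>2 \<le> a x + b y - \<alpha> / 2 * (norm (x - y))\<^sup>2 + \<kappa>"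
    "linear X" "linear Y"
    "\<And>h. - 4 * \<alpha> * (norm h)\<^sup>2 \<le> h \<bullet> X h" "\<And>h. h \<bullet> X h \<le> (2 * \<alpha> + \<kappa>) * (norm h)\<^sup>2"
    "\<And>h. h \<bullet> X h + h \<bullet> Y h \<le> \<kappa> * (norm h)\<^sup>2"
    "\<And>e. 0 < e \<Longrightarrow> \<exists>d>0. \<forall>h. norm h < d \<and> x + h \<in> C \<longrightarrow> a (x + h) \<le> a x + p \<bullet> h + h \<bullet> X h / 2 + e * (norm h)\<^sup>2"
    "\<And>e. 0 < e \<Longrightarrow> \<exists>d>0. \<forall>h. norm h < d \<and> y + h \<in> C \<longrightarrow> b (y + h) \<le> b y + q \<bullet> h + h \<bullet> Y h / 2 + e * (norm h)\<^sup>2"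
proof -
  \<comment> \<open>Half of \<alpha> times the coefficient 4 in \<open>norm_diff_sq_le\<close> is
    \<open>2 * \<alpha>\<close>, and this has to be the sup-convolution weight
    \<open>\<beta> / 2\<close>.\<close>
  define \<beta> where "\<beta> = 4 * \<alpha>"
  have \<beta>: "\<beta> > 0" using \<alpha> by (simp add: \<beta>_def)
  \<comment> \<open>This is \<open>c x - \<beta> / 2 * (norm (x - \<xi>))\<^sup>2\<close> plus
    \<open>\<beta> / 2 * (norm \<xi>)\<^sup>2\<close>. With the added term it is affine in \<xi>, so
    its maximum over \<open>x\<close> is convex in \<xi>, and \<beta> times a maximiser is a
    subgradient.\<close>
  define \<phi> where "\<phi> c \<xi> x = c x - \<beta> / 2 * (norm x)\<^sup>2 + \<beta> * (x \<bullet> \<xi>)" for c :: "'a \<Rightarrow> real" and \<xi> x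
  have maximiser: "\<exists>x\<in>C. \<forall>x'\<in>C. \<phi> c \<xi> x' \<le> \<phi> c \<xi> x" if "usc_on C c" for c \<xi>
  proof -
    have "usc_on C (\<lambda>x. c x + (- \<beta> / 2 * (norm x)\<^sup>2 + \<beta> * (x \<bullet> \<xi>)))"
      by (intro usc_on_add that continuous_on_imp_usc_on continuous_intros)
    moreover have "c x + (- \<beta> / 2 * (norm x)\<^sup>2 + \<beta> * (x \<bullet> \<xi>)) = \<phi> c \<xi> x" for x by (simp add: \<phi>_def)
    ultimately show ?thesis using usc_on_attains_sup[OF C] by simp
  qed
  obtain S where S: "\<And>\<xi>. S \<xi> \<in> C" "\<And>\<xi> x. x \<in> C \<Longrightarrow> \<phi> a \<xi> x \<le> \<phi> a \<xi> (S \<xi>)"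
    using maximiser[OF usc(1)] by metis
  obtain T where T: "\<And>\<xi>. T \<xi> \<in> C" "\<And>\<xi> x. x \<in> C \<Longrightarrow> \<phi> b \<xi> x \<le> \<phi> b \<xi> (T \<xi>)"
    using maximiser[OF usc(2)] by metis
  define F where "F \<xi> = \<phi> a \<xi> (S \<xi>)" for \<xi>
  define G where "G \<eta> = \<phi> b \<eta> (T \<eta>)" for \<eta>
  define f where "f \<zeta> = F (fst \<zeta>) + G (snd \<zeta>)" for \<zeta>
  have subF: "F \<xi> + \<beta> * (S \<xi> \<bullet> (\<xi>' - \<xi>)) \<le> F \<xi>'" for \<xi> \<xi>'
    using S(2)[OF S(1), of \<xi>' \<xi>] by (simp add: F_def \<phi>_def inner_diff_right algebra_simps)
  have subG: "G \<xi> + \<beta> * (T \<xi> \<bullet> (\<xi>' - \<xi>)) \<le> G \<xi>'" for \<xi> \<xi>'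
    using T(2)[OF T(1), of \<xi>' \<xi>] by (simp add: G_def \<phi>_def inner_diff_right algebra_simps)
  define s where "s \<zeta> = (\<beta> *\<^sub>R S (fst \<zeta>), \<beta> *\<^sub>R T (snd \<zeta>))" for \<zeta>
  have s: "is_subgradient f \<zeta> (s \<zeta>)" for \<zeta>
    unfolding is_subgradient_def
  proof
    show "f \<zeta> + s \<zeta> \<bullet> (\<zeta>' - \<zeta>) \<le> f \<zeta>'" for \<zeta>'
      using subF[of "fst \<zeta>" "fst \<zeta>'"] subG[of "snd \<zeta>" "snd \<zeta>'"] by (simp add: f_def s_def inner_prod_def)
  qed
  obtain R where R: "\<And>x. x \<in> C \<Longrightarrow> norm x \<le> R" using compact_imp_bounded[OF C(1)] bounded_iff by blast
  have sub: "\<exists>p. norm p \<le> 2 * \<beta> * R \<and> is_subgradient f \<zeta> p" for \<zeta>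
  proof -
    have "norm (s \<zeta>) \<le> norm (\<beta> *\<^sub>R S (fst \<zeta>)) + norm (\<beta> *\<^sub>R T (snd \<zeta>))"
      unfolding s_def by (rule norm_Pair_le)
    also have "\<dots> \<le> \<beta> * R + \<beta> * R" using R S(1) T(1) \<beta> by (intro add_mono) auto
    finally show ?thesis using s[of \<zeta>] by (intro exI[of _ "s \<zeta>"]) (simp add: mult_ac)
  qed
  \<comment> \<open>Subtracting \<open>\<zeta> \<bullet> L \<zeta> / 2\<close> from \<open>f\<close>
    removes the convexifying squares and leaves the two sup-convolutions minus \<alpha> times the
    squared distance of \<xi> and \<eta>.\<close>
  define L where "L \<zeta> = (2 * \<alpha>) *\<^sub>R (fst \<zeta> - snd \<zeta>, snd \<zeta> - fst \<zeta>) + \<beta> *\<^sub>R \<zeta>" for \<zeta> :: "'a \<times> 'a"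
  have L: "linear L"
    by (rule linearI) (auto simp: L_def algebra_simps scaleR_add_right)
  have Lsym: "x \<bullet> L y = y \<bullet> L x" for x y
    by (simp add: L_def inner_prod_def inner_add inner_diff inner_commute algebra_simps)
  have LL: "\<zeta> \<bullet> L \<zeta> = 2 * \<alpha> * (norm (fst \<zeta> - snd \<zeta>))\<^sup>2 + \<beta> * ((norm (fst \<zeta>))\<^sup>2 + (norm (snd \<zeta>))\<^sup>2)" for \<zeta>
    unfolding power2_norm_eq_inner
    by (simp add: L_def inner_prod_def inner_add inner_diff inner_commute algebra_simps)
  define w where "w x y = a x + b y - \<alpha> / 2 * (norm (x - y))\<^sup>2" for x y
  have "usc_on (C \<times> C) (\<lambda>z. a (fst z) + b (snd z) + (- \<alpha> / 2 * (norm (fst z - snd z))\<^sup>2))"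
    by (intro usc_on_add usc_on_fst usc_on_snd usc continuous_on_imp_usc_on continuous_intros)
  from usc_on_attains_sup[OF compact_Times[OF C(1) C(1)] _ this] C(2)
  obtain z where z: "z \<in> C \<times> C" "\<forall>z'\<in>C \<times> C. a (fst z') + b (snd z') + (- \<alpha> / 2 * (norm (fst z' - snd z'))\<^sup>2)
      \<le> a (fst z) + b (snd z) + (- \<alpha> / 2 * (norm (fst z - snd z))\<^sup>2)"
    by (metis Times_empty)
  define x0 where "x0 = fst z"
  define y0 where "y0 = snd z"
  have xy0: "x0 \<in> C" "y0 \<in> C" using z(1) by (auto simp: x0_def y0_def)
  have max0: "w x y \<le> w x0 y0" if "x \<in> C" "y \<in> C" for x y
    using z(2)[rule_format, of "(x, y)"] that by (simp add: w_def x0_def y0_def)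
  have expand: "\<phi> a (fst \<zeta>) x + \<phi> b (snd \<zeta>) y - \<zeta> \<bullet> L \<zeta> / 2
      = a x + b y - 2 * \<alpha> * ((norm (x - fst \<zeta>))\<^sup>2 + (norm (y - snd \<zeta>))\<^sup>2) - \<alpha> * (norm (fst \<zeta> - snd \<zeta>))\<^sup>2" for \<zeta> x y
  proof -
    have n: "(norm (u - v))\<^sup>2 = (norm u)\<^sup>2 - 2 * (u \<bullet> v) + (norm v)\<^sup>2" for u v :: 'a
      unfolding power2_norm_eq_inner by (simp add: inner_diff inner_commute)
    show ?thesis unfolding LL \<phi>_def \<beta>_def n[of x] n[of y] by (simp add: field_simps)
  qed
  have below: "\<phi> a (fst \<zeta>) x + \<phi> b (snd \<zeta>) y - \<zeta> \<bullet> L \<zeta> / 2 \<le> w x y" for \<zeta> x y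
  proof -
    have "\<alpha> / 2 * (norm (x - y))\<^sup>2 \<le> \<alpha> / 2 * (2 * (norm (fst \<zeta> - snd \<zeta>))\<^sup>2 + 4 * (norm (x - fst \<zeta>))\<^sup>2 + 4 * (norm (y - snd \<zeta>))\<^sup>2)"
      using \<alpha> norm_diff_sq_le by (intro mult_left_mono) auto
    also have "\<dots> = \<alpha> * (norm (fst \<zeta> - snd \<zeta>))\<^sup>2 + 2 * \<alpha> * ((norm (x - fst \<zeta>))\<^sup>2 + (norm (y - snd \<zeta>))\<^sup>2)"
      by (simp add: algebra_simps)
    finally show ?thesis unfolding expand w_def by linarith
  qed
  \<comment> \<open>The point \<open>\<zeta>0\<close> realises equality in
    \<open>norm_diff_sq_le\<close> for \<open>x0\<close>, \<open>y0\<close>. Hence \<open>f\<close>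
    minus the quadratic form attains its maximum \<open>w x0 y0\<close> there, which is the touching
    condition.\<close>
  define k where "k = (1 / 4) *\<^sub>R (x0 - y0)"
  define \<zeta>0 where "\<zeta>0 = (x0 - k, y0 + k)"
  have f\<zeta>0: "f \<zeta>0 - \<zeta>0 \<bullet> L \<zeta>0 / 2 \<ge> w x0 y0"
  proof -
    have xy: "x0 - y0 = 4 *\<^sub>R k" by (simp add: k_def)
    have "fst \<zeta>0 - snd \<zeta>0 = (x0 - y0) - 2 *\<^sub>R k" by (simp add: \<zeta>0_def scaleR_2 algebra_simps)
    also have "\<dots> = 2 *\<^sub>R k" unfolding xy by (simp flip: scaleR_diff_left)
    finally have d: "fst \<zeta>0 - snd \<zeta>0 = 2 *\<^sub>R k" .
    have "\<phi> a (fst \<zeta>0) x0 + \<phi> b (snd \<zeta>0) y0 - \<zeta>0 \<bullet> L \<zeta>0 / 2 = w x0 y0"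
      unfolding expand w_def d xy by (simp add: \<zeta>0_def power_mult_distrib)
    moreover have "\<phi> a (fst \<zeta>0) x0 + \<phi> b (snd \<zeta>0) y0 \<le> f \<zeta>0"
      unfolding f_def F_def G_def using S(2) T(2) xy0 by (intro add_mono) auto
    ultimately show ?thesis by linarith
  qed
  have f_le: "f \<zeta> - \<zeta> \<bullet> L \<zeta> / 2 \<le> w (S (fst \<zeta>)) (T (snd \<zeta>))" for \<zeta>
    unfolding f_def F_def G_def by (rule below)
  have touch: "f \<zeta> \<le> f \<zeta>0 + L \<zeta>0 \<bullet> (\<zeta> - \<zeta>0) + (\<zeta> - \<zeta>0) \<bullet> L (\<zeta> - \<zeta>0) / 2" for \<zeta>
  proof -
    have "f \<zeta> - \<zeta> \<bullet> L \<zeta> / 2 \<le> f \<zeta>0 - \<zeta>0 \<bullet> L \<zeta>0 / 2"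
      using f_le[of \<zeta>] max0[OF S(1) T(1)] f\<zeta>0 by (meson order_trans)
    moreover have "(\<zeta> - \<zeta>0) \<bullet> L (\<zeta> - \<zeta>0) = \<zeta> \<bullet> L \<zeta> - 2 * (L \<zeta>0 \<bullet> \<zeta>) + \<zeta>0 \<bullet> L \<zeta>0"
      using Lsym[of \<zeta> \<zeta>0] by (simp add: linear_diff[OF L] inner_diff inner_commute)
    moreover have "L \<zeta>0 \<bullet> (\<zeta> - \<zeta>0) = L \<zeta>0 \<bullet> \<zeta> - \<zeta>0 \<bullet> L \<zeta>0"
      by (simp add: inner_diff inner_commute)
    ultimately show ?thesis by (simp add: field_simps)
  qed
  \<comment> \<open>A subgradient at \<open>\<zeta>0\<close> bounds \<open>f\<close> below by an
    affine function with the right value there, so little is lost nearby. Combined with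
    \<open>f_le\<close>, this makes the maximisers \<open>S (fst \<zeta>)\<close>,
    \<open>T (snd \<zeta>)\<close> approximate maximum points.\<close>
  obtain \<delta>1 where \<delta>1: "\<delta>1 > 0" "\<And>\<zeta>. norm (\<zeta> - \<zeta>0) < \<delta>1 \<Longrightarrow> w x0 y0 - \<kappa> \<le> f \<zeta> - \<zeta> \<bullet> L \<zeta> / 2"
  proof -
    define r where "r \<zeta> = s \<zeta>0 \<bullet> (\<zeta> - \<zeta>0) - \<zeta> \<bullet> L \<zeta> / 2" for \<zeta>
    have "continuous_on UNIV L" using L by (simp add: linear_continuous_on linear_linear)
    then have "continuous_on UNIV r" unfolding r_def by (intro continuous_intros) auto
    then obtain d where d: "d > 0" "\<And>\<zeta>. dist \<zeta> \<zeta>0 < d \<Longrightarrow> dist (r \<zeta>) (r \<zeta>0) < \<kappa>"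
      unfolding continuous_on_iff using \<kappa> by (metis UNIV_I)
    have "w x0 y0 - \<kappa> \<le> f \<zeta> - \<zeta> \<bullet> L \<zeta> / 2" if "norm (\<zeta> - \<zeta>0) < d" for \<zeta>
    proof -
      have "r \<zeta> > r \<zeta>0 - \<kappa>" using d(2)[of \<zeta>] that by (simp add: dist_norm)
      then show ?thesis using is_subgradientD[OF s, of \<zeta>0 \<zeta>] f\<zeta>0 by (simp add: r_def)
    qed
    then show thesis using that d(1) by blast
  qed
  define \<delta> where "\<delta> = min \<delta>1 (\<kappa> / 2)"
  have \<delta>: "\<delta> > 0" "\<delta> \<le> \<delta>1" "2 * \<delta> \<le> \<kappa>" using \<delta>1 \<kappa> by (auto simp: \<delta>_def)
  obtain \<zeta> P A where \<zeta>: "norm (\<zeta> - \<zeta>0) < \<delta>" and linA: "linear A"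
    and A0: "\<forall>h. 0 \<le> h \<bullet> A h" and AL: "\<forall>h. h \<bullet> A h \<le> h \<bullet> L h + \<delta> * (norm h)\<^sup>2"
    and exp: "\<forall>e>0. \<exists>d>0. \<forall>h. norm h < d \<longrightarrow> \<bar>f (\<zeta> + h) - f \<zeta> - P \<bullet> h - h \<bullet> A h / 2\<bar> \<le> e * (norm h)\<^sup>2"
    by (rule jensen_alexandrov[OF sub L Lsym touch \<delta>(1)])
  note A0 = A0[rule_format] and AL = AL[rule_format] and exp = exp[rule_format]
  define \<xi> where "\<xi> = fst \<zeta>"
  define \<eta> where "\<eta> = snd \<zeta>"
  define A1 where "A1 h = fst (A (h, 0))" for h
  define A2 where "A2 h = snd (A (0, h))" for h
  have A12: "(h, 0) \<bullet> A (h, 0) = h \<bullet> A1 h" "(0, h) \<bullet> A (0, h) = h \<bullet> A2 h" for h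
    by (simp_all add: A1_def A2_def inner_prod_def)
  have lin1: "linear A1"
  proof (rule linearI)
    fix u v :: 'a and c :: real
    show "A1 (u + v) = A1 u + A1 v" using linear_add[OF linA, of "(u, 0)" "(v, 0)"] by (simp add: A1_def)
    show "A1 (c *\<^sub>R u) = c *\<^sub>R A1 u" using linear_scale[OF linA, of c "(u, 0)"] by (simp add: A1_def)
  qed
  have lin2: "linear A2"
  proof (rule linearI)
    fix u v :: 'a and c :: real
    show "A2 (u + v) = A2 u + A2 v" using linear_add[OF linA, of "(0, u)" "(0, v)"] by (simp add: A2_def)
    show "A2 (c *\<^sub>R u) = c *\<^sub>R A2 u" using linear_scale[OF linA, of c "(0, u)"] by (simp add: A2_def)
  qed
  have expF: "\<exists>d>0. \<forall>h. norm h < d \<longrightarrow> \<bar>F (\<xi> + h) - F \<xi> - fst P \<bullet> h - h \<bullet> A1 h / 2\<bar> \<le> e * (norm h)\<^sup>2" if e: "0 < e" for e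
  proof -
    obtain d where "d > 0" and d: "\<And>h. norm h < d \<Longrightarrow> \<bar>f (\<zeta> + h) - f \<zeta> - P \<bullet> h - h \<bullet> A h / 2\<bar> \<le> e * (norm h)\<^sup>2"
      using exp[OF e] by blast
    have "\<bar>F (\<xi> + h) - F \<xi> - fst P \<bullet> h - h \<bullet> A1 h / 2\<bar> \<le> e * (norm h)\<^sup>2" if "norm h < d" for h
      using d[of "(h, 0)"] that unfolding A12 by (simp add: f_def \<xi>_def norm_Pair inner_prod_def)
    then show ?thesis using \<open>d > 0\<close> by blast
  qed
  have expG: "\<exists>d>0. \<forall>h. norm h < d \<longrightarrow> \<bar>G (\<eta> + h) - G \<eta> - snd P \<bullet> h - h \<bullet> A2 h / 2\<bar> \<le> e * (norm h)\<^sup>2" if e: "0 < e" for e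
  proof -
    obtain d where "d > 0" and d: "\<And>h. norm h < d \<Longrightarrow> \<bar>f (\<zeta> + h) - f \<zeta> - P \<bullet> h - h \<bullet> A h / 2\<bar> \<le> e * (norm h)\<^sup>2"
      using exp[OF e] by blast
    have "\<bar>G (\<eta> + h) - G \<eta> - snd P \<bullet> h - h \<bullet> A2 h / 2\<bar> \<le> e * (norm h)\<^sup>2" if "norm h < d" for h
      using d[of "(0, h)"] that unfolding A12 by (simp add: f_def \<eta>_def norm_Pair inner_prod_def)
    then show ?thesis using \<open>d > 0\<close> by blast
  qed
  have nhh: "(norm (h, h))\<^sup>2 = 2 * (norm h)\<^sup>2" for h :: 'a by (simp add: norm_Pair)
  \<comment> \<open>\<open>f\<close> is a function of \<xi> plus a function of \<eta>, so its
    expansion at \<open>(h, h)\<close> agrees to second order with the sum of those at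
    \<open>(h, 0)\<close> and \<open>(0, h)\<close>: the off-diagonal blocks of \<open>A\<close> do
    not contribute.\<close>
  have "h \<bullet> A1 h / 2 + h \<bullet> A2 h / 2 - (h, h) \<bullet> A (h, h) / 2 \<le> 0" for h
  proof (rule quadratic_nonpos_if_little_o[where X = "\<lambda>h. h \<bullet> A1 h / 2 + h \<bullet> A2 h / 2 - (h, h) \<bullet> A (h, h) / 2"])
    fix t :: real and h :: 'a
    have "(t *\<^sub>R h, t *\<^sub>R h) = t *\<^sub>R (h, h)" by simp
    then show "t *\<^sub>R h \<bullet> A1 (t *\<^sub>R h) / 2 + t *\<^sub>R h \<bullet> A2 (t *\<^sub>R h) / 2 - (t *\<^sub>R h, t *\<^sub>R h) \<bullet> A (t *\<^sub>R h, t *\<^sub>R h) / 2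
        = t\<^sup>2 * (h \<bullet> A1 h / 2 + h \<bullet> A2 h / 2 - (h, h) \<bullet> A (h, h) / 2)"
      by (simp only: linear_scale[OF linA] linear_scale[OF lin1] linear_scale[OF lin2] inner_scaleR_left inner_scaleR_right)
        (simp add: power2_eq_square algebra_simps)
  next
    fix e :: real assume "0 < e"
    then have e: "e / 4 > 0" by simp
    obtain d where "d > 0" and d: "\<And>h. norm h < d \<Longrightarrow> \<bar>f (\<zeta> + h) - f \<zeta> - P \<bullet> h - h \<bullet> A h / 2\<bar> \<le> e / 4 * (norm h)\<^sup>2"
      using exp[OF e] by blast
    obtain d1 where "d1 > 0" and d1: "\<And>h. norm h < d1 \<Longrightarrow> \<bar>F (\<xi> + h) - F \<xi> - fst P \<bullet> h - h \<bullet> A1 h / 2\<bar> \<le> e / 4 * (norm h)\<^sup>2"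
      using expF[OF e] by blast
    obtain d2 where "d2 > 0" and d2: "\<And>h. norm h < d2 \<Longrightarrow> \<bar>G (\<eta> + h) - G \<eta> - snd P \<bullet> h - h \<bullet> A2 h / 2\<bar> \<le> e / 4 * (norm h)\<^sup>2"
      using expG[OF e] by blast
    define r where "r = min (d / 2) (min d1 d2)"
    have "h \<bullet> A1 h / 2 + h \<bullet> A2 h / 2 - (h, h) \<bullet> A (h, h) / 2 \<le> e * (norm h)\<^sup>2" if h: "norm h < r" for h
    proof -
      have hd: "norm (h, h) < d" using h norm_Pair_le[of h h] by (simp add: r_def)
      have "\<bar>(F (\<xi> + h) - F \<xi>) + (G (\<eta> + h) - G \<eta>) - (fst P \<bullet> h + snd P \<bullet> h) - (h, h) \<bullet> A (h, h) / 2\<bar>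
          \<le> 2 * (e / 4 * (norm h)\<^sup>2)"
      proof -
        have "f (\<zeta> + (h, h)) - f \<zeta> = (F (\<xi> + h) - F \<xi>) + (G (\<eta> + h) - G \<eta>)"
          by (simp add: f_def \<xi>_def \<eta>_def)
        moreover have "P \<bullet> (h, h) = fst P \<bullet> h + snd P \<bullet> h" by (simp add: inner_prod_def)
        moreover have "e / 4 * (norm (h, h))\<^sup>2 = 2 * (e / 4 * (norm h)\<^sup>2)" by (simp add: nhh)
        ultimately show ?thesis using d[OF hd] by (simp only:)
      qed
      moreover have "norm h < d1" "norm h < d2" using h by (auto simp: r_def)
      moreover have "x + y - q \<le> 4 * E" if "\<bar>u + v - (p + p') - q\<bar> \<le> 2 * E" "\<bar>u - p - x\<bar> \<le> E"
        "\<bar>v - p' - y\<bar> \<le> E" for x y q u v p p' E :: real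
        using that by linarith
      ultimately have "h \<bullet> A1 h / 2 + h \<bullet> A2 h / 2 - (h, h) \<bullet> A (h, h) / 2 \<le> 4 * (e / 4 * (norm h)\<^sup>2)"
        using d1[of h] d2[of h] by blast
      then show ?thesis by simp
    qed
    then show "\<exists>d>0. \<forall>h. norm h < d \<longrightarrow> h \<bullet> A1 h / 2 + h \<bullet> A2 h / 2 - (h, h) \<bullet> A (h, h) / 2 \<le> e * (norm h)\<^sup>2"
      using \<open>d > 0\<close> \<open>d1 > 0\<close> \<open>d2 > 0\<close> by (intro exI[of _ r]) (auto simp: r_def)
  qed
  note cross = this
  \<comment> \<open>Takes away the Hessian of the square that was added to make \<open>F\<close>
    convex.\<close>
  define X where "X h = A1 h - \<beta> *\<^sub>R h" for h
  define Y where "Y h = A2 h - \<beta> *\<^sub>R h" for h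
  have hX: "h \<bullet> X h = h \<bullet> A1 h - \<beta> * (norm h)\<^sup>2" and hY: "h \<bullet> Y h = h \<bullet> A2 h - \<beta> * (norm h)\<^sup>2" for h
    by (simp_all add: X_def Y_def inner_diff power2_norm_eq_inner)
  have F1: "x \<in> C \<Longrightarrow> a x - \<beta> / 2 * (norm x)\<^sup>2 + \<beta> * (x \<bullet> \<xi>) \<le> F \<xi>" for x \<xi>
    using S(2)[of x \<xi>] by (simp add: F_def \<phi>_def)
  have F2: "F \<xi> = a (S \<xi>) - \<beta> / 2 * (norm (S \<xi>))\<^sup>2 + \<beta> * (S \<xi> \<bullet> \<xi>)" by (simp add: F_def \<phi>_def)
  have G1: "x \<in> C \<Longrightarrow> b x - \<beta> / 2 * (norm x)\<^sup>2 + \<beta> * (x \<bullet> \<xi>) \<le> G \<xi>" for x \<xi>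
    using T(2)[of x \<xi>] by (simp add: G_def \<phi>_def)
  have G2: "G \<eta> = b (T \<eta>) - \<beta> / 2 * (norm (T \<eta>))\<^sup>2 + \<beta> * (T \<eta> \<bullet> \<eta>)" by (simp add: G_def \<phi>_def)
  show thesis
  proof (rule that[of "S \<xi>" "T \<eta>" X Y "fst P - \<beta> *\<^sub>R \<xi>" "snd P - \<beta> *\<^sub>R \<eta>"])
    show "S \<xi> \<in> C" "T \<eta> \<in> C" by (rule S T)+
    show "a x' + b y' - \<alpha> / 2 * (norm (x' - y'))\<^sup>2 \<le> a (S \<xi>) + b (T \<eta>) - \<alpha> / 2 * (norm (S \<xi> - T \<eta>))\<^sup>2 + \<kappa>"
      if "x' \<in> C" "y' \<in> C" for x' y'
      using max0[OF that] f_le[of \<zeta>] \<delta>1(2)[of \<zeta>] \<zeta> \<delta>(2) by (simp add: w_def \<xi>_def \<eta>_def)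
    show "linear X" "linear Y"
      unfolding X_def Y_def by (intro linear_compose_sub lin1 lin2 linear_compose_scale_right linear_ident)+
    fix h :: 'a
    \<comment> \<open>Convexity of \<open>f\<close>, shifted by \<beta>. The upper bound comes from
      \<open>L\<close> in the direction \<open>(h, 0)\<close>.\<close>
    show "- 4 * \<alpha> * (norm h)\<^sup>2 \<le> h \<bullet> X h"
      using A0[of "(h, 0)"] unfolding A12 hX by (simp add: \<beta>_def)
    have "h \<bullet> A1 h \<le> 2 * \<alpha> * (norm h)\<^sup>2 + \<beta> * (norm h)\<^sup>2 + \<delta> * (norm h)\<^sup>2"
      using AL[of "(h, 0)"] unfolding A12 LL by (simp add: norm_Pair)
    moreover have "\<delta> * (norm h)\<^sup>2 \<le> \<kappa> * (norm h)\<^sup>2" using \<delta> by (intro mult_right_mono) auto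
    ultimately show "h \<bullet> X h \<le> (2 * \<alpha> + \<kappa>) * (norm h)\<^sup>2" unfolding hX by (simp add: algebra_simps)
    \<comment> \<open>On the diagonal the coupling term of \<open>L\<close> vanishes, and what
      remains is cancelled by the shifts in \<open>X\<close> and \<open>Y\<close>. Because
      \<open>(h, h)\<close> has squared norm \<open>2 * (norm h)\<^sup>2\<close>, \<delta> was taken
      at most \<open>\<kappa> / 2\<close>.\<close>
    have "(h, h) \<bullet> A (h, h) \<le> \<beta> * (2 * (norm h)\<^sup>2) + \<delta> * (2 * (norm h)\<^sup>2)"
      using AL[of "(h, h)"] unfolding LL nhh by simp
    moreover have "2 * \<delta> * (norm h)\<^sup>2 \<le> \<kappa> * (norm h)\<^sup>2" using \<delta> by (intro mult_right_mono) auto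
    ultimately show "h \<bullet> X h + h \<bullet> Y h \<le> \<kappa> * (norm h)\<^sup>2"
      using cross[of h] unfolding hX hY by simp
  next
    fix e :: real assume e: "0 < e"
    obtain d where "d > 0" and d: "\<And>h. norm h < d \<Longrightarrow> \<bar>F (\<xi> + h) - F \<xi> - fst P \<bullet> h - h \<bullet> A1 h / 2\<bar> \<le> e * (norm h)\<^sup>2"
      using expF[OF e] by blast
    show "\<exists>d>0. \<forall>h. norm h < d \<and> S \<xi> + h \<in> C \<longrightarrow>
        a (S \<xi> + h) \<le> a (S \<xi>) + (fst P - \<beta> *\<^sub>R \<xi>) \<bullet> h + h \<bullet> X h / 2 + e * (norm h)\<^sup>2"
    proof (intro exI[of _ d] conjI allI impI)
      fix h assume h: "norm h < d \<and> S \<xi> + h \<in> C"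
      show "a (S \<xi> + h) \<le> a (S \<xi>) + (fst P - \<beta> *\<^sub>R \<xi>) \<bullet> h + h \<bullet> X h / 2 + e * (norm h)\<^sup>2"
        unfolding X_def
      proof (rule jet_of_sup_convolution[where F = F and C = C])
        show "F (\<xi> + h) - F \<xi> - fst P \<bullet> h - h \<bullet> A1 h / 2 \<le> e * (norm h)\<^sup>2"
          using d[of h] h by simp
      qed (use F1 F2 h in auto)
    qed (fact \<open>d > 0\<close>)
  next
    fix e :: real assume e: "0 < e"
    obtain d where "d > 0" and d: "\<And>h. norm h < d \<Longrightarrow> \<bar>G (\<eta> + h) - G \<eta> - snd P \<bullet> h - h \<bullet> A2 h / 2\<bar> \<le> e * (norm h)\<^sup>2"
      using expG[OF e] by blast
    show "\<exists>d>0. \<forall>h. norm h < d \<and> T \<eta> + h \<in> C \<longrightarrow>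
        b (T \<eta> + h) \<le> b (T \<eta>) + (snd P - \<beta> *\<^sub>R \<eta>) \<bullet> h + h \<bullet> Y h / 2 + e * (norm h)\<^sup>2"
    proof (intro exI[of _ d] conjI allI impI)
      fix h assume h: "norm h < d \<and> T \<eta> + h \<in> C"
      show "b (T \<eta> + h) \<le> b (T \<eta>) + (snd P - \<beta> *\<^sub>R \<eta>) \<bullet> h + h \<bullet> Y h / 2 + e * (norm h)\<^sup>2"
        unfolding Y_def
      proof (rule jet_of_sup_convolution[where F = G and C = C])
        show "G (\<eta> + h) - G \<eta> - snd P \<bullet> h - h \<bullet> A2 h / 2 \<le> e * (norm h)\<^sup>2"
          using d[of h] h by simp
      qed (use G1 G2 h in auto)
    qed (fact \<open>d > 0\<close>)
  qed
qed

section \<open>Quadratic forms of symmetric matrices\<close>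

definition qform :: "real^'n^'n \<Rightarrow> real^'n \<Rightarrow> real" where
  "qform M h = h \<bullet> (M *v h)"

lemma qform_simps:
  "qform (M + N) h = qform M h + qform N h"
  "qform (M - N) h = qform M h - qform N h"
  "qform (- M) h = - qform M h"
  "qform (c *\<^sub>R M) h = c * qform M h"
  "qform (mat 1) h = (norm h)\<^sup>2"
proof -
  show 1: "qform (M + N) h = qform M h + qform N h" for M N
    by (simp add: qform_def matrix_vector_mult_add_rdistrib inner_add)
  show 2: "qform (c *\<^sub>R M) h = c * qform M h" for c M
    by (simp add: qform_def flip: scaleR_matrix_vector_assoc)
  show 3: "qform (- M) h = - qform M h" for M
    using 2[of "-1" M] by simp
  show "qform (M - N) h = qform M h - qform N h"
    using 1[of M "- N"] 3[of N] by simp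
  show "qform (mat 1) h = (norm h)\<^sup>2"
    by (simp add: qform_def power2_norm_eq_inner)
qed

lemma transpose_simps:
  fixes M N :: "real^'n^'m"
  shows "transpose (M + N) = transpose M + transpose N"
    "transpose (M - N) = transpose M - transpose N"
    "transpose (- M) = - transpose M"
    "transpose (c *\<^sub>R M) = c *\<^sub>R transpose M"
  by (simp_all add: transpose_def vec_eq_iff)

lemma sym_mats_intros:
  "M \<in> sym_mats \<Longrightarrow> N \<in> sym_mats \<Longrightarrow> M + N \<in> sym_mats"
  "M \<in> sym_mats \<Longrightarrow> N \<in> sym_mats \<Longrightarrow> M - N \<in> sym_mats"
  "M \<in> sym_mats \<Longrightarrow> - M \<in> sym_mats"
  "M \<in> sym_mats \<Longrightarrow> c *\<^sub>R M \<in> sym_mats"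
  "mat 1 \<in> sym_mats"
  by (simp_all add: sym_mats_def transpose_simps transpose_mat)

lemma sym_mats_inner: "M \<in> sym_mats \<Longrightarrow> x \<bullet> (M *v y) = y \<bullet> (M *v x)"
  by (metis (mono_tags, lifting) dot_lmul_matrix inner_commute mem_Collect_eq sym_mats_def vector_transpose_matrix)

text \<open>The linear maps in the second-order expansions are not known to be symmetric, whereas
  the equation concerns symmetric matrices. The expansions involve only the quadratic form, which
  the symmetric part preserves.\<close>

lemma symmetric_part:
  fixes X :: "real^'n \<Rightarrow> real^'n"
  assumes "linear X"
  obtains S where "S \<in> sym_mats" "\<And>h. qform S h = h \<bullet> X h"
proof -
  define A where "A = matrix X"
  have A: "A *v h = X h" for h using assms by (simp add: A_def matrix_works linear_matrix_vector_mul_eq)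
  define S where "S = (1 / 2) *\<^sub>R (A + transpose A)"
  have "transpose (transpose A) = A" by (simp add: transpose_transpose)
  then have "S \<in> sym_mats" by (simp add: S_def sym_mats_def transpose_simps add.commute)
  moreover have "qform (transpose A) h = qform A h" for h
    unfolding qform_def by (metis dot_lmul_matrix inner_commute vector_transpose_matrix)
  then have "qform S h = h \<bullet> X h" for h
    unfolding S_def qform_simps by (simp add: qform_def A)
  ultimately show thesis using that by blast
qed

lemma loewner_le_iff:
  "X \<in> sym_mats \<Longrightarrow> Y \<in> sym_mats \<Longrightarrow> loewner_le X Y \<longleftrightarrow> (\<forall>h. qform X h \<le> qform Y h)"
  unfolding loewner_le_def pos_semidef_def
  by (simp add: sym_mats_def transpose_simps flip: qform_def) (simp add: qform_simps)

lemma abs_qform_le_op_norm: "\<bar>qform M h\<bar> \<le> op_norm M * (norm h)\<^sup>2"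
proof -
  have "\<bar>qform M h\<bar> \<le> norm h * norm (M *v h)" unfolding qform_def by (rule Cauchy_Schwarz_ineq2)
  also have "\<dots> \<le> norm h * (op_norm M * norm h)"
    unfolding op_norm_def using matrix_vector_mul_bounded_linear[of M]
    by (intro mult_left_mono onorm) auto
  finally show ?thesis by (simp add: power2_eq_square mult_ac)
qed

text \<open>The topology of the matrix space is that of the Frobenius norm \<open>norm M\<close>,
  while distances are measured in the operator norm; Cauchy-Schwarz in each row links the former to
  quadratic forms.\<close>

lemma norm_matrix_vector_mult_le: "norm (M *v h) \<le> norm M * norm (h :: real^'n)" for M :: "real^'n^'m"
proof -
  have "norm (M *v h) = L2_set (\<lambda>i. \<bar>(M *v h) $ i\<bar>) UNIV" by (simp add: norm_vec_def)
  also have "\<dots> \<le> L2_set (\<lambda>i. norm h * norm (M $ i)) UNIV"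
  proof (rule L2_set_mono)
    fix i
    have "(M *v h) $ i = M $ i \<bullet> h" by (simp add: matrix_vector_mult_def inner_vec_def)
    then show "\<bar>(M *v h) $ i\<bar> \<le> norm h * norm (M $ i)"
      using Cauchy_Schwarz_ineq2[of "M $ i" h] by (simp add: mult.commute)
  qed simp
  also have "\<dots> = norm h * norm M" by (simp add: L2_set_right_distrib norm_vec_def[of M])
  finally show ?thesis by (simp add: mult.commute)
qed

lemma abs_qform_le_norm: "\<bar>qform M h\<bar> \<le> norm M * (norm h)\<^sup>2"
proof -
  have "\<bar>qform M h\<bar> \<le> norm h * norm (M *v h)" unfolding qform_def by (rule Cauchy_Schwarz_ineq2)
  also have "\<dots> \<le> norm h * (norm M * norm h)"
    by (intro mult_left_mono norm_matrix_vector_mult_le) auto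
  finally show ?thesis by (simp add: power2_eq_square mult_ac)
qed

text \<open>Polarisation: for symmetric \<open>M\<close>, four times
  \<open>y \<bullet> (M *v x)\<close> is the difference of the form at \<open>x + y\<close> and
  \<open>x - y\<close>. With \<open>y\<close> the vector \<open>M *v x\<close> rescaled to the
  length of \<open>x\<close>, the parallelogram law gives the sharp constant.\<close>

lemma op_norm_le_of_qform:
  fixes M :: "real^'n^'n"
  assumes M: "M \<in> sym_mats" and c: "0 \<le> c" and bound: "\<And>h. \<bar>qform M h\<bar> \<le> c * (norm h)\<^sup>2"
  shows "op_norm M \<le> c"
  unfolding op_norm_def
proof (rule onorm_bound)
  fix x :: "real^'n"
  show "norm (M *v x) \<le> c * norm x"
  proof (cases "norm x = 0 \<or> norm (M *v x) = 0")
    case False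
    define r where "r = norm x"
    define s where "s = norm (M *v x)"
    have rs: "r > 0" "s > 0" using False by (auto simp: r_def s_def)
    define y where "y = (r / s) *\<^sub>R (M *v x)"
    have ny: "norm y = r" using rs by (simp add: y_def s_def)
    have "4 * (y \<bullet> (M *v x)) = qform M (x + y) - qform M (x - y)"
      using sym_mats_inner[OF M, of x y] by (simp add: qform_def inner_add inner_diff vec.add vec.diff)
    also have "\<dots> \<le> c * ((norm (x + y))\<^sup>2 + (norm (x - y))\<^sup>2)"
      using bound[of "x + y"] bound[of "x - y"] by (simp add: distrib_left abs_le_iff)
    also have "(norm (x + y))\<^sup>2 + (norm (x - y))\<^sup>2 = 2 * (norm x)\<^sup>2 + 2 * (norm y)\<^sup>2"
      unfolding power2_norm_eq_inner by (simp add: inner_add inner_diff inner_commute)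
    finally have "y \<bullet> (M *v x) \<le> c * r\<^sup>2" by (simp add: ny r_def)
    moreover have "y \<bullet> (M *v x) = r * s"
      using rs by (simp add: y_def s_def power2_norm_eq_inner[symmetric] power2_eq_square)
    ultimately have "r * s \<le> r * (c * r)" by (simp add: power2_eq_square mult_ac)
    then show ?thesis using rs by (simp add: r_def s_def)
  qed (use c in auto)
qed (fact c)

section \<open>The sets \<open>\<Theta>\<^sub>+\<close> and \<open>\<Theta>\<^sub>-\<close>\<close>

lemma Theta_plus_up:
  assumes "elliptic_at_0 \<Omega> F" "x \<in> \<Omega>" "X \<in> Theta_plus F x" "Z \<in> sym_mats" "\<And>h. qform X h \<le> qform Z h"
  shows "Z \<in> Theta_plus F x"
proof -
  have "X \<in> sym_mats" "0 \<le> F X x" using assms(3) by (auto simp: Theta_plus_def)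
  moreover from this have "loewner_le X Z" using loewner_le_iff[OF _ assms(4)] assms(5) by blast
  ultimately have "0 \<le> F Z x" using assms(1,2,4) unfolding elliptic_at_0_def by blast
  then show ?thesis using assms(4) by (simp add: Theta_plus_def)
qed

lemma Theta_minus_down:
  assumes "elliptic_at_0 \<Omega> F" "x \<in> \<Omega>" "Y \<in> Theta_minus F x" "Z \<in> sym_mats" "\<And>h. qform Z h \<le> qform Y h"
  shows "Z \<in> Theta_minus F x"
proof -
  have Y: "Y \<in> sym_mats" "F Y x \<le> 0" using assms(3) by (auto simp: Theta_minus_def)
  have "loewner_le Z Y" using loewner_le_iff[OF assms(4) Y(1)] assms(5) by blast
  then have "0 < F Z x \<longrightarrow> 0 < F Y x" using assms(1,2,4) Y(1) unfolding elliptic_at_0_def by blast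
  then have "F Z x \<le> 0" using Y(2) by (meson leD leI)
  then show ?thesis using assms(4) by (simp add: Theta_minus_def)
qed

lemma sym_interiorI:
  assumes "Z \<in> sym_mats" "0 < e" "\<And>W. W \<in> sym_mats \<Longrightarrow> norm (W - Z) < e \<Longrightarrow> W \<in> T"
  shows "Z \<in> (top_of_set sym_mats) interior_of T"
proof -
  have "openin (top_of_set sym_mats) (sym_mats \<inter> ball Z e)" by (simp add: openin_open_Int)
  moreover have "sym_mats \<inter> ball Z e \<subseteq> T" using assms(3) by (auto simp: dist_norm norm_minus_commute)
  ultimately have "sym_mats \<inter> ball Z e \<subseteq> (top_of_set sym_mats) interior_of T"
    by (simp add: interior_of_maximal)
  then show ?thesis using assms(1,2) by auto
qed

text \<open>The margin \<open>\<gamma>\<close> absorbs every symmetric perturbation of Frobenius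
  norm below \<open>\<gamma>\<close>, and ellipticity then keeps the perturbed matrix in the
  set.\<close>

lemma Theta_plus_interior:
  assumes "elliptic_at_0 \<Omega> F" "x \<in> \<Omega>" "X \<in> Theta_plus F x" "Z \<in> sym_mats" "0 < \<gamma>"
    and le: "\<And>h. qform X h + \<gamma> * (norm h)\<^sup>2 \<le> qform Z h"
  shows "Z \<in> (top_of_set sym_mats) interior_of (Theta_plus F x)"
proof (rule sym_interiorI)
  fix W assume W: "W \<in> sym_mats" "norm (W - Z) < \<gamma>"
  have "qform X h \<le> qform W h" for h
  proof -
    have "\<bar>qform (W - Z) h\<bar> \<le> \<gamma> * (norm h)\<^sup>2"
      using W(2) by (intro order_trans[OF abs_qform_le_norm] mult_right_mono) auto
    then show ?thesis using le[of h] by (simp add: qform_simps abs_le_iff)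
  qed
  then show "W \<in> Theta_plus F x" using Theta_plus_up assms W(1) by blast
qed (use assms in auto)

lemma Theta_minus_interior:
  assumes "elliptic_at_0 \<Omega> F" "x \<in> \<Omega>" "Y \<in> Theta_minus F x" "Z \<in> sym_mats" "0 < \<gamma>"
    and le: "\<And>h. qform Z h + \<gamma> * (norm h)\<^sup>2 \<le> qform Y h"
  shows "Z \<in> (top_of_set sym_mats) interior_of (Theta_minus F x)"
proof (rule sym_interiorI)
  fix W assume W: "W \<in> sym_mats" "norm (W - Z) < \<gamma>"
  have "qform W h \<le> qform Y h" for h
  proof -
    have "\<bar>qform (W - Z) h\<bar> \<le> \<gamma> * (norm h)\<^sup>2"
      using W(2) by (intro order_trans[OF abs_qform_le_norm] mult_right_mono) auto
    then show ?thesis using le[of h] by (simp add: qform_simps abs_le_iff)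
  qed
  then show "W \<in> Theta_minus F x" using Theta_minus_down assms W(1) by blast
qed (use assms in auto)

text \<open>Moving from \<open>Y\<close> in the direction \<open>- I\<close>, one leaves \<open>\<Theta>\<^sub>+\<close> after a positive time, at a boundary
  point of \<open>\<Theta>\<^sub>+\<close> that is interior to \<open>\<Theta>\<^sub>-\<close>.\<close>

lemma Theta_strictly_ordered_False:
  fixes F :: "real^'n^'n \<Rightarrow> real^'n \<Rightarrow> ereal"
  assumes ell: "elliptic_at_0 \<Omega> F" and x: "x \<in> \<Omega>"
    and ne: "sym_boundary (Theta_plus F x) \<noteq> {}"
    and eq: "sym_boundary (Theta_plus F x) = sym_boundary (Theta_minus F x)"
    and X: "X \<in> Theta_plus F x" and Y: "Y \<in> Theta_minus F x" and \<gamma>: "0 < \<gamma>"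
    and le: "\<And>h. qform X h + \<gamma> * (norm h)\<^sup>2 \<le> qform Y h"
  shows False
proof -
  let ?T = "top_of_set sym_mats"
  have Ys: "Y \<in> sym_mats" using Y by (simp add: Theta_minus_def)
  define Z where "Z s = Y - s *\<^sub>R mat 1" for s :: real
  have Zs: "Z s \<in> sym_mats" for s unfolding Z_def by (intro sym_mats_intros Ys)
  have qZ: "qform (Z s) h = qform Y h - s * (norm h)\<^sup>2" for s h by (simp add: Z_def qform_simps)
  have mono: "Z s' \<in> Theta_plus F x" if "Z s \<in> Theta_plus F x" "s' \<le> s" for s s'
    using that by (intro Theta_plus_up[OF ell x that(1) Zs]) (simp add: qZ mult_right_mono)
  obtain B where B: "B \<in> sym_boundary (Theta_plus F x)" using ne by blast
  then have B': "B \<in> sym_mats" "B \<notin> ?T interior_of (Theta_plus F x)"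
    by (auto simp: sym_boundary_def frontier_of_def in_closure_of)
  \<comment> \<open>For this \<open>r\<close>, \<open>Z r\<close> lies below the boundary point
    \<open>B\<close> by at least the identity. Were it in \<open>\<Theta>\<^sub>+\<close>, then
    \<open>B\<close> would be interior. So the line through \<open>Y\<close> does leave
    \<open>\<Theta>\<^sub>+\<close>.\<close>
  define r where "r = norm Y + norm B + 1"
  have "Z r \<notin> Theta_plus F x"
  proof
    assume "Z r \<in> Theta_plus F x"
    then have "B \<in> ?T interior_of (Theta_plus F x)"
    proof (rule Theta_plus_interior[OF ell x _ B'(1)])
      show "qform (Z r) h + 1 * (norm h)\<^sup>2 \<le> qform B h" for h
        using abs_qform_le_norm[of Y h] abs_qform_le_norm[of B h]
        by (simp add: qZ r_def abs_le_iff algebra_simps)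
    qed simp
    then show False using B' by blast
  qed
  then have r: "s < r" if "Z s \<in> Theta_plus F x" for s using mono that by (meson not_le)
  define A where "A = {s. Z s \<in> Theta_plus F x}"
  have \<gamma>A: "\<gamma> \<in> A" unfolding A_def
    using le by (auto intro!: Theta_plus_up[OF ell x X Zs] simp: qZ algebra_simps)
  have bdd: "bdd_above A" using r by (auto simp: A_def intro!: bdd_aboveI[of _ r] less_imp_le)
  define s0 where "s0 = Sup A"
  have s0: "\<gamma> \<le> s0" unfolding s0_def by (rule cSup_upper[OF \<gamma>A bdd])
  have inA: "Z s \<in> Theta_plus F x" if "s < s0" for s
  proof -
    obtain s' where "s' \<in> A" "s < s'" using less_cSup_iff[of A s] \<gamma>A bdd \<open>s < s0\<close> by (auto simp: s0_def)
    then show ?thesis using mono by (auto simp: A_def)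
  qed
  have notA: "Z s \<notin> Theta_plus F x" if "s0 < s" for s
    using cSup_upper[of s A] bdd that by (auto simp: A_def s0_def)
  have near: "\<exists>\<eta>>0. Z (s0 - \<eta>) \<in> U \<and> Z (s0 + \<eta>) \<in> U" if U: "openin ?T U" "Z s0 \<in> U" for U
  proof -
    obtain e where e: "e > 0" "\<And>W. W \<in> sym_mats \<Longrightarrow> dist W (Z s0) < e \<Longrightarrow> W \<in> U"
      using U unfolding openin_euclidean_subtopology_iff by blast
    define c where "c = norm (mat 1 :: real^'n^'n) + 1"
    have c: "c > 0" by (simp add: c_def add_nonneg_pos)
    define \<eta> where "\<eta> = e / c"
    have \<eta>: "\<eta> > 0" using e c by (simp add: \<eta>_def)
    have d: "dist (Z (s0 - \<eta>)) (Z s0) = \<eta> * norm (mat 1 :: real^'n^'n)" "dist (Z (s0 + \<eta>)) (Z s0) = \<eta> * norm (mat 1 :: real^'n^'n)"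
      using \<eta> by (simp_all add: Z_def dist_norm algebra_simps)
    have "\<eta> * norm (mat 1 :: real^'n^'n) < \<eta> * c" using \<eta> by (simp add: c_def)
    also have "\<dots> = e" using c by (simp add: \<eta>_def)
    finally have "Z (s0 - \<eta>) \<in> U" "Z (s0 + \<eta>) \<in> U" using e(2) Zs d by simp_all
    then show ?thesis using \<eta> by blast
  qed
  have "Z s0 \<in> ?T closure_of (Theta_plus F x)"
    unfolding in_closure_of
  proof (intro conjI allI impI)
    fix U assume "Z s0 \<in> U \<and> openin ?T U"
    then obtain \<eta> where "\<eta> > 0" "Z (s0 - \<eta>) \<in> U" using near by blast
    then show "\<exists>y. y \<in> Theta_plus F x \<and> y \<in> U" using inA[of "s0 - \<eta>"] by auto
  qed (simp add: Zs)
  moreover have "Z s0 \<notin> ?T interior_of (Theta_plus F x)"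
  proof
    assume "Z s0 \<in> ?T interior_of (Theta_plus F x)"
    from near[OF openin_interior_of this]
    obtain \<eta> where "\<eta> > 0" "Z (s0 + \<eta>) \<in> ?T interior_of (Theta_plus F x)" by blast
    from subsetD[OF interior_of_subset this(2)] have "Z (s0 + \<eta>) \<in> Theta_plus F x" .
    then show False using notA[of "s0 + \<eta>"] \<open>\<eta> > 0\<close> by simp
  qed
  ultimately have "Z s0 \<in> sym_boundary (Theta_minus F x)"
    unfolding eq[symmetric] by (simp add: sym_boundary_def frontier_of_def)
  moreover have "Z s0 \<in> ?T interior_of (Theta_minus F x)"
    using s0 \<gamma> by (intro Theta_minus_interior[OF ell x Y Zs, of s0]) (auto simp: qZ)
  ultimately show False by (simp add: sym_boundary_def frontier_of_def)
qed

section \<open>The comparison principle\<close>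

lemma quadratic_test_function:
  fixes M :: "real^'n^'n" and p x0 :: "real^'n" and c :: real
  assumes M: "M \<in> sym_mats"
  defines "\<phi> \<equiv> \<lambda>x. c + p \<bullet> (x - x0) + qform M (x - x0) / 2"
  shows "C2_near \<phi> x0" "hessian \<phi> x0 = M" "\<phi> x0 = c"
proof -
  have D: "(\<phi> has_derivative (\<lambda>h. (p + M *v (x - x0)) \<bullet> h)) (at x)" for x
  proof -
    have "((\<lambda>x. c + p \<bullet> (x - x0) + ((x - x0) \<bullet> (M *v (x - x0))) / 2) has_derivative
        (\<lambda>h. p \<bullet> h + ((x - x0) \<bullet> (M *v h) + h \<bullet> (M *v (x - x0))) / 2)) (at x)"
      by (auto intro!: derivative_eq_intros bounded_linear.has_derivative[OF matrix_vector_mul_bounded_linear])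
    moreover have "p \<bullet> h + ((x - x0) \<bullet> (M *v h) + h \<bullet> (M *v (x - x0))) / 2 = (p + M *v (x - x0)) \<bullet> h" for h
      using sym_mats_inner[OF M, of "x - x0" h] by (simp add: inner_add inner_commute)
    ultimately show ?thesis unfolding \<phi>_def qform_def by simp
  qed
  have g: "gradient \<phi> = (\<lambda>x. p + M *v (x - x0))"
  proof
    show "gradient \<phi> x = p + M *v (x - x0)" for x
      unfolding gradient_def frechet_derivative_at[OF D, symmetric] by (simp add: vec_eq_iff inner_axis)
  qed
  have DG: "(gradient \<phi> has_derivative (*v) M) (at x)" for x
    unfolding g
    by (auto intro!: derivative_eq_intros bounded_linear.has_derivative[OF matrix_vector_mul_bounded_linear])
  have h: "hessian \<phi> x = M" for x
    unfolding hessian_def jacobian_def frechet_derivative_at[OF DG, symmetric] by simp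
  then show "hessian \<phi> x0 = M" .
  have "continuous_on UNIV (hessian \<phi>)" using h by (metis continuous_on_const continuous_on_cong)
  then show "C2_near \<phi> x0" unfolding C2_near_def
    using D DG by (intro exI[of _ UNIV]) (auto simp: differentiable_def)
  show "\<phi> x0 = c" by (simp add: \<phi>_def qform_def)
qed

text \<open>The quadratic polynomial itself is the test function, so the jet must hold without
  remainder; a remainder of order \<open>\<eta> * (norm h)\<^sup>2\<close> has to be put into
  \<open>M\<close> beforehand.\<close>

lemma Theta_plus_of_jet:
  assumes sub: "viscosity_subsolution \<Omega> F v" and "open \<Omega>" "x \<in> \<Omega>" and M: "M \<in> sym_mats" and "0 < d"
    and jet: "\<And>h. norm h < d \<Longrightarrow> x + h \<in> closure \<Omega> \<Longrightarrow> v (x + h) \<le> v x + p \<bullet> h + qform M h / 2"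
  shows "M \<in> Theta_plus F x"
proof -
  let ?\<phi> = "\<lambda>y. v x + p \<bullet> (y - x) + qform M (y - x) / 2"
  have "\<forall>\<^sub>F y in nhds x. y \<in> \<Omega> \<and> dist y x < d"
    using \<open>open \<Omega>\<close> \<open>x \<in> \<Omega>\<close> \<open>0 < d\<close> by (intro eventually_conj eventually_nhds_in_open eventually_nhds_ball[simplified dist_commute]) (auto simp: eventually_nhds_metric)
  then have "\<forall>\<^sub>F y in nhds x. v y \<le> ?\<phi> y"
  proof eventually_elim
    case (elim y)
    then show ?case using jet[of "y - x"] closure_subset by (auto simp: dist_norm)
  qed
  then have "0 \<le> F (hessian ?\<phi> x) x"
    using sub \<open>x \<in> \<Omega>\<close> quadratic_test_function[OF M, of "v x" p x] unfolding viscosity_subsolution_def by blast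
  then show ?thesis using M by (simp add: Theta_plus_def quadratic_test_function(2))
qed

lemma Theta_minus_of_jet:
  assumes super: "viscosity_supersolution \<Omega> F u" and "open \<Omega>" "x \<in> \<Omega>" and M: "M \<in> sym_mats" and "0 < d"
    and jet: "\<And>h. norm h < d \<Longrightarrow> x + h \<in> closure \<Omega> \<Longrightarrow> u x + p \<bullet> h + qform M h / 2 \<le> u (x + h)"
  shows "M \<in> Theta_minus F x"
proof -
  let ?\<phi> = "\<lambda>y. u x + p \<bullet> (y - x) + qform M (y - x) / 2"
  have "\<forall>\<^sub>F y in nhds x. y \<in> \<Omega> \<and> dist y x < d"
    using \<open>open \<Omega>\<close> \<open>x \<in> \<Omega>\<close> \<open>0 < d\<close> by (intro eventually_conj eventually_nhds_in_open eventually_nhds_ball[simplified dist_commute]) (auto simp: eventually_nhds_metric)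
  then have "\<forall>\<^sub>F y in nhds x. ?\<phi> y \<le> u y"
  proof eventually_elim
    case (elim y)
    then show ?case using jet[of "y - x"] closure_subset by (auto simp: dist_norm)
  qed
  then have "F (hessian ?\<phi> x) x \<le> 0"
    using super \<open>x \<in> \<Omega>\<close> quadratic_test_function[OF M, of "u x" p x] unfolding viscosity_supersolution_def by blast
  then show ?thesis using M by (simp add: Theta_minus_def quadratic_test_function(2))
qed

section \<open>Limits of penalised maximum points\<close>

text \<open>Comparing with a fixed diagonal point bounds the penalties, so \<open>x j - y j\<close>
  tends to 0 and a subsequence of both has a common limit. Comparing with that limit point,
  semicontinuity from above forces the penalties themselves to 0.\<close>

lemma doubling_limit:
  fixes a b :: "'a::euclidean_space \<Rightarrow> real"
  assumes C: "compact C" and usc: "usc_on C a" "usc_on C b"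
    and xy: "\<And>j::nat. x j \<in> C" "\<And>j. y j \<in> C"
    and near: "\<And>j z. z \<in> C \<Longrightarrow> a z + b z \<le> a (x j) + b (y j) - real (Suc j) / 2 * (norm (x j - y j))\<^sup>2 + 1 / real (Suc j)"
  obtains r x0 where "x0 \<in> C" "(x \<circ> r) \<longlonglongrightarrow> x0" "(y \<circ> r) \<longlonglongrightarrow> x0"
    "(\<lambda>j. real (Suc (r j)) * (norm (x (r j) - y (r j)))\<^sup>2) \<longlonglongrightarrow> 0"
    "\<And>z. z \<in> C \<Longrightarrow> a z + b z \<le> a x0 + b x0"
proof -
  have "C \<noteq> {}" using xy by auto
  obtain xa where xa: "xa \<in> C" "\<And>z. z \<in> C \<Longrightarrow> a z \<le> a xa" using usc_on_attains_sup[OF C \<open>C \<noteq> {}\<close> usc(1)] by blast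
  obtain xb where xb: "xb \<in> C" "\<And>z. z \<in> C \<Longrightarrow> b z \<le> b xb" using usc_on_attains_sup[OF C \<open>C \<noteq> {}\<close> usc(2)] by blast
  define P where "P j = real (Suc j) * (norm (x j - y j))\<^sup>2" for j
  define q where "q j = 1 / real (Suc j)" for j
  have near': "a z + b z \<le> a (x j) + b (y j) - P j / 2 + q j" if "z \<in> C" for z j
    using near[OF that, of j] by (simp add: P_def q_def)
  have P0: "0 \<le> P j" for j by (simp add: P_def)
  \<comment> \<open>From \<open>near'\<close> at \<open>xa\<close>, with \<open>a (x j)\<close> and
    \<open>b (y j)\<close> replaced by the maxima of \<open>a\<close> and \<open>b\<close>, and
    \<open>q j\<close> by 1.\<close>
  define D where "D = 2 * (a xa + b xb + 1 - (a xa + b xa))"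
  have D: "P j \<le> D" for j
  proof -
    have "q j \<le> 1" by (simp add: q_def)
    then show ?thesis
      using near'[OF xa(1), of j] xa(2)[OF xy(1), of j] xb(2)[OF xy(2), of j] unfolding D_def by simp
  qed
  have inv0: "q \<longlonglongrightarrow> 0"
    unfolding q_def using LIMSEQ_inverse_real_of_nat by (simp add: inverse_eq_divide)
  have "(\<lambda>j. (norm (x j - y j))\<^sup>2) \<longlonglongrightarrow> 0"
  proof (rule tendsto_sandwich[of "\<lambda>_. 0"])
    have "(norm (x j - y j))\<^sup>2 \<le> D * q j" for j
      using D[of j] unfolding P_def q_def by (simp add: pos_le_divide_eq mult.commute)
    then show "\<forall>\<^sub>F j in sequentially. (norm (x j - y j))\<^sup>2 \<le> D * q j" by simp
    show "(\<lambda>j. D * q j) \<longlonglongrightarrow> 0" using tendsto_mult_right_zero[OF inv0, of D] by simp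
  qed auto
  then have "(\<lambda>j. sqrt ((norm (x j - y j))\<^sup>2)) \<longlonglongrightarrow> sqrt 0" by (rule tendsto_real_sqrt)
  then have diff0: "(\<lambda>j. x j - y j) \<longlonglongrightarrow> 0" by (simp add: tendsto_norm_zero_iff)
  obtain x0 r where r: "strict_mono r" and x0: "x0 \<in> C" "(x \<circ> r) \<longlonglongrightarrow> x0"
    using C xy(1) unfolding compact_def by blast
  have "((\<lambda>j. x j - y j) \<circ> r) \<longlonglongrightarrow> 0" by (rule LIMSEQ_subseq_LIMSEQ[OF diff0 r])
  from tendsto_diff[OF x0(2) this] have y0: "(y \<circ> r) \<longlonglongrightarrow> x0" by (simp add: o_def)
  have inv0r: "(\<lambda>j. q (r j)) \<longlonglongrightarrow> 0"
    using LIMSEQ_subseq_LIMSEQ[OF inv0 r] by (simp add: o_def)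
  have ev: "\<forall>\<^sub>F j in sequentially. a (x (r j)) < a x0 + e \<and> b (y (r j)) < b x0 + e \<and> q (r j) < e"
    if e: "0 < e" for e
  proof -
    obtain d1 where d1: "d1 > 0" "\<And>z. z \<in> C \<Longrightarrow> dist z x0 < d1 \<Longrightarrow> a z < a x0 + e"
      using usc(1) x0(1) e unfolding usc_on_metric by blast
    obtain d2 where d2: "d2 > 0" "\<And>z. z \<in> C \<Longrightarrow> dist z x0 < d2 \<Longrightarrow> b z < b x0 + e"
      using usc(2) x0(1) e unfolding usc_on_metric by blast
    have "\<forall>\<^sub>F j in sequentially. dist (x (r j)) x0 < d1" using tendstoD[OF x0(2) d1(1)] by simp
    moreover have "\<forall>\<^sub>F j in sequentially. dist (y (r j)) x0 < d2" using tendstoD[OF y0 d2(1)] by simp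
    moreover have "\<forall>\<^sub>F j in sequentially. q (r j) < e" using order_tendstoD(2)[OF inv0r e] .
    ultimately show ?thesis by eventually_elim (use d1(2) d2(2) xy in auto)
  qed
  have "(\<lambda>j. P (r j)) \<longlonglongrightarrow> 0"
  proof (rule order_tendstoI)
    fix e :: real assume "0 < e"
    show "\<forall>\<^sub>F j in sequentially. P (r j) < e"
    \<comment> \<open>Three errors of size \<open>e / 6\<close> add up to a bound on
      \<open>P (r j) / 2\<close>.\<close>
    proof (rule eventually_mono[OF ev[of "e / 6"]])
      fix j assume "a (x (r j)) < a x0 + e / 6 \<and> b (y (r j)) < b x0 + e / 6 \<and> q (r j) < e / 6"
      then show "P (r j) < e" using near'[OF x0(1), of "r j"] by linarith
    qed (use \<open>0 < e\<close> in simp)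
  next
    fix e :: real assume "e < 0"
    then have "e < P (r j)" for j using P0[of "r j"] by linarith
    then show "\<forall>\<^sub>F j in sequentially. e < P (r j)" by simp
  qed
  moreover have "a z + b z \<le> a x0 + b x0" if z: "z \<in> C" for z
  proof (rule field_le_epsilon)
    fix e :: real assume "0 < e"
    then obtain j where "a (x (r j)) < a x0 + e / 3 \<and> b (y (r j)) < b x0 + e / 3 \<and> q (r j) < e / 3"
      using eventually_happens[OF ev[of "e / 3"]] by auto
    then show "a z + b z \<le> a x0 + b x0 + e" using near'[OF z, of "r j"] P0[of "r j"] by linarith
  qed
  ultimately show thesis using that[of x0 r] x0 y0 unfolding P_def by simp
qed

section \<open>Distances between matrices and sets\<close>

lemma mat_dist_self:
  assumes "X \<in> T" shows "mat_dist X T = 0"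
proof (rule antisym)
  have "(*v) (X - X) = (\<lambda>_. 0)" by (simp add: fun_eq_iff)
  then have "op_norm (X - X) = 0" unfolding op_norm_def by (simp only: onorm_zero)
  then show "mat_dist X T \<le> 0"
    unfolding mat_dist_def using INF_lower[OF assms, of "\<lambda>Y. ereal (op_norm (X - Y))"] by (simp add: zero_ereal_def)
  show "0 \<le> mat_dist X T"
    unfolding mat_dist_def op_norm_def
    by (intro INF_greatest) (simp add: onorm_pos_le matrix_vector_mul_bounded_linear)
qed

text \<open>Since \<open>X\<close> has distance 0 to \<open>T1\<close>, the supremum at
  \<open>X\<close> bounds its distance to \<open>T2\<close>. The finite bound also rules out an
  empty \<open>T2\<close>, to which the distance would be infinite.\<close>

lemma near_point_of_bdd_hausdorff:
  assumes "X \<in> T1" "X \<in> sym_mats" "ereal (op_norm X) < R" "bdd_hausdorff R T1 T2 < ereal e"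
  obtains Y where "Y \<in> T2" "op_norm (X - Y) < e"
proof -
  have "\<bar>mat_dist X T1 - mat_dist X T2\<bar> \<le> bdd_hausdorff R T1 T2"
    unfolding bdd_hausdorff_def using assms(2,3) by (intro SUP_upper) auto
  then have "\<bar>mat_dist X T2\<bar> < ereal e"
    using assms(4) unfolding mat_dist_self[OF assms(1)] by (auto intro: le_less_trans)
  then have "mat_dist X T2 < ereal e" by (cases "mat_dist X T2") auto
  then show thesis using that unfolding mat_dist_def by (auto simp: INF_less_iff)
qed

theorem proposition2p3:
  fixes \<Omega> :: "(real^'n) set"
    and F :: "real^'n^'n \<Rightarrow> real^'n \<Rightarrow> ereal"
  assumes "open \<Omega>" and "bounded \<Omega>"
    and "elliptic_at_0 \<Omega> F"
    and "\<And>x0. x0 \<in> \<Omega> \<Longrightarrow> sym_boundary (Theta_plus F x0) \<noteq> {}"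
    and "\<And>x0. x0 \<in> \<Omega> \<Longrightarrow> sym_boundary (Theta_plus F x0) = sym_boundary (Theta_minus F x0)"
    and "\<And>x0. x0 \<in> \<Omega> \<Longrightarrow>
           ((\<lambda>t. SUP (x, y)\<in>ball x0 t \<times> ball x0 t.
                   bdd_hausdorff (scaled_radius t x y) (Theta_plus F x) (Theta_plus F y))
             \<longlongrightarrow> 0) (at_right 0)"
  shows "comparison_principle \<Omega> F"
  unfolding comparison_principle_def
proof (intro allI impI ballI)
  fix v u x assume vu: "viscosity_subsolution \<Omega> F v \<and> viscosity_supersolution \<Omega> F u \<and> (\<forall>x\<in>frontier \<Omega>. v x \<le> u x)"
    and "x \<in> \<Omega>"
  then have sub: "viscosity_subsolution \<Omega> F v" and super: "viscosity_supersolution \<Omega> F u"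
    and bd: "\<And>x. x \<in> frontier \<Omega> \<Longrightarrow> v x \<le> u x" by auto
  show "v x \<le> u x"
  proof (rule ccontr)
    assume "\<not> v x \<le> u x"
    define m where "m = v x - u x"
    have m: "m > 0" using \<open>\<not> v x \<le> u x\<close> by (simp add: m_def)
    define C where "C = closure \<Omega>"
    have C: "compact C" "C \<noteq> {}" and xC: "x \<in> C"
      using \<open>bounded \<Omega>\<close> \<open>x \<in> \<Omega>\<close> closure_subset by (auto simp: C_def compact_closure)
    obtain R where R: "R > 0" "\<And>z. z \<in> C \<Longrightarrow> norm z \<le> R"
      using compact_imp_bounded[OF C(1)] bounded_pos by blast
    \<comment> \<open>The perturbation is then at most \<open>m / 2\<close> on \<open>C\<close>. On
      the boundary, where \<open>v \<le> u\<close>, the perturbed difference stays below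
      \<open>m\<close>, its lower bound at \<open>x\<close>.\<close>
    define \<epsilon> where "\<epsilon> = m / R\<^sup>2"
    have \<epsilon>: "\<epsilon> > 0" using m R by (simp add: \<epsilon>_def)
    define a where "a z = v z + \<epsilon> / 2 * (norm z)\<^sup>2" for z
    define b where "b z = - u z" for z
    have uscv: "usc_on C v" using sub by (simp add: viscosity_subsolution_def C_def)
    have "usc_on C a"
      unfolding a_def by (intro usc_on_add uscv continuous_on_imp_usc_on continuous_intros)
    have "usc_on C b"
      unfolding usc_on_def
    proof
      fix c
      have "{z \<in> C. b z < c} = {z \<in> C. u z > - c}" by (auto simp: b_def)
      then show "openin (top_of_set C) {z \<in> C. b z < c}"
        using super by (simp add: viscosity_supersolution_def lsc_on_def C_def)
    qed
    \<comment> \<open>Packs the statements on jets, so that only the sequences of points have to be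
      chosen; the jets are unpacked later, at a single index.\<close>
    define Q where "Q \<alpha> \<kappa> y z \<longleftrightarrow> (\<exists>p q X Y. linear X \<and> linear Y \<and>
        (\<forall>h. - 4 * \<alpha> * (norm h)\<^sup>2 \<le> h \<bullet> X h) \<and> (\<forall>h. h \<bullet> X h \<le> (2 * \<alpha> + \<kappa>) * (norm h)\<^sup>2) \<and>
        (\<forall>h. h \<bullet> X h + h \<bullet> Y h \<le> \<kappa> * (norm h)\<^sup>2) \<and>
        (\<forall>e>0. \<exists>d>0. \<forall>h. norm h < d \<and> y + h \<in> C \<longrightarrow> a (y + h) \<le> a y + p \<bullet> h + h \<bullet> X h / 2 + e * (norm h)\<^sup>2) \<and>
        (\<forall>e>0. \<exists>d>0. \<forall>h. norm h < d \<and> z + h \<in> C \<longrightarrow> b (z + h) \<le> b z + q \<bullet> h + h \<bullet> Y h / 2 + e * (norm h)\<^sup>2))"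
      for \<alpha> \<kappa> y z
    \<comment> \<open>The first bound makes the points asymptotically maximal, the second is the
      share of the margin allowed to the theorem on sums.\<close>
    define \<kappa> where "\<kappa> j = min (1 / real (Suc j)) (\<epsilon> / 4)" for j
    have "\<exists>y z. y \<in> C \<and> z \<in> C \<and> Q (real (Suc j)) (\<kappa> j) y z \<and>
        (\<forall>x'\<in>C. a x' + b x' \<le> a y + b z - real (Suc j) / 2 * (norm (y - z))\<^sup>2 + 1 / real (Suc j))" for j
    proof -
      have \<kappa>: "0 < \<kappa> j" "\<kappa> j \<le> 1 / real (Suc j)" using \<epsilon> by (auto simp: \<kappa>_def)
      show ?thesis
      proof (rule theorem_on_sums[OF C \<open>usc_on C a\<close> \<open>usc_on C b\<close> _ \<kappa>(1), of "real (Suc j)"])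
        fix y z p q X Y
        assume yz: "y \<in> C" "z \<in> C"
          and near: "\<And>x' y'. x' \<in> C \<Longrightarrow> y' \<in> C \<Longrightarrow> a x' + b y' - real (Suc j) / 2 * (norm (x' - y'))\<^sup>2
            \<le> a y + b z - real (Suc j) / 2 * (norm (y - z))\<^sup>2 + \<kappa> j"
          and rest: "linear X" "linear Y"
            "\<And>h. - 4 * real (Suc j) * (norm h)\<^sup>2 \<le> h \<bullet> X h"
            "\<And>h. h \<bullet> X h \<le> (2 * real (Suc j) + \<kappa> j) * (norm h)\<^sup>2"
            "\<And>h. h \<bullet> X h + h \<bullet> Y h \<le> \<kappa> j * (norm h)\<^sup>2"
            "\<And>e. 0 < e \<Longrightarrow> \<exists>d>0. \<forall>h. norm h < d \<and> y + h \<in> C \<longrightarrow> a (y + h) \<le> a y + p \<bullet> h + h \<bullet> X h / 2 + e * (norm h)\<^sup>2"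
            "\<And>e. 0 < e \<Longrightarrow> \<exists>d>0. \<forall>h. norm h < d \<and> z + h \<in> C \<longrightarrow> b (z + h) \<le> b z + q \<bullet> h + h \<bullet> Y h / 2 + e * (norm h)\<^sup>2"
        have "Q (real (Suc j)) (\<kappa> j) y z"
          unfolding Q_def by (rule exI[of _ p], rule exI[of _ q], rule exI[of _ X], rule exI[of _ Y]) (intro conjI allI impI rest)
        moreover have "a x' + b x' \<le> a y + b z - real (Suc j) / 2 * (norm (y - z))\<^sup>2 + 1 / real (Suc j)"
          if "x' \<in> C" for x'
          using near[OF that that] \<kappa>(2) by simp
        ultimately show ?thesis using yz by blast
      qed simp
    qed
    then obtain y z where yz: "\<And>j. y j \<in> C" "\<And>j. z j \<in> C" and Q: "\<And>j. Q (real (Suc j)) (\<kappa> j) (y j) (z j)"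
      and near: "\<And>j x'. x' \<in> C \<Longrightarrow>
        a x' + b x' \<le> a (y j) + b (z j) - real (Suc j) / 2 * (norm (y j - z j))\<^sup>2 + 1 / real (Suc j)"
      by metis
    have "\<exists>r x0. x0 \<in> C \<and> (y \<circ> r) \<longlonglongrightarrow> x0 \<and> (z \<circ> r) \<longlonglongrightarrow> x0 \<and>
        (\<lambda>j. real (Suc (r j)) * (norm (y (r j) - z (r j)))\<^sup>2) \<longlonglongrightarrow> 0 \<and> (\<forall>x'\<in>C. a x' + b x' \<le> a x0 + b x0)"
      by (rule doubling_limit[OF C(1) \<open>usc_on C a\<close> \<open>usc_on C b\<close> yz near]) blast+
    then obtain r x0 where x0: "x0 \<in> C" "(y \<circ> r) \<longlonglongrightarrow> x0" "(z \<circ> r) \<longlonglongrightarrow> x0"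
      and pen: "(\<lambda>j. real (Suc (r j)) * (norm (y (r j) - z (r j)))\<^sup>2) \<longlonglongrightarrow> 0"
      and max: "\<forall>x'\<in>C. a x' + b x' \<le> a x0 + b x0"
      by blast
    note max = max[rule_format]
    have "x0 \<in> \<Omega>"
    proof (rule ccontr)
      assume "x0 \<notin> \<Omega>"
      then have "x0 \<in> frontier \<Omega>" using x0(1) \<open>open \<Omega>\<close> by (simp add: C_def frontier_def interior_open)
      then have "a x0 + b x0 \<le> \<epsilon> / 2 * (norm x0)\<^sup>2" using bd by (simp add: a_def b_def)
      also have "\<dots> \<le> \<epsilon> / 2 * R\<^sup>2" using R(2)[OF x0(1)] \<epsilon> by (intro mult_left_mono power_mono) auto
      also have "\<dots> = m / 2" using R by (simp add: \<epsilon>_def)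
      also have "\<dots> < m" using m by simp
      also have "\<dots> \<le> a x + b x" using \<epsilon> by (simp add: m_def a_def b_def)
      finally show False using max[OF xC] by simp
    qed
    then obtain \<rho> where \<rho>: "\<rho> > 0" "ball x0 \<rho> \<subseteq> \<Omega>" using \<open>open \<Omega>\<close> openE by blast
    have "\<forall>\<^sub>F t in at_right 0. (SUP (x, y)\<in>ball x0 t \<times> ball x0 t.
        bdd_hausdorff (scaled_radius t x y) (Theta_plus F x) (Theta_plus F y)) < ereal (\<epsilon> / 4)"
      using order_tendstoD(2)[OF assms(6)[OF \<open>x0 \<in> \<Omega>\<close>]] \<epsilon> by simp
    moreover have "\<forall>\<^sub>F t in at_right 0. 0 < t \<and> t < \<rho>"
      using \<rho>(1) unfolding eventually_at_right_field by blast
    ultimately obtain t where t: "0 < t" "t < \<rho>" and sup: "(SUP (x, y)\<in>ball x0 t \<times> ball x0 t.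
        bdd_hausdorff (scaled_radius t x y) (Theta_plus F x) (Theta_plus F y)) < ereal (\<epsilon> / 4)"
      using eventually_happens'[OF trivial_limit_at_right_real eventually_conj] by blast
    \<comment> \<open>For \<open>\<alpha> \<ge> 1\<close>, \<open>K * \<alpha>\<close> dominates
      \<open>4 * \<alpha> + 1 + \<epsilon>\<close>, which will bound the operator norm of
      \<open>M\<close>. Requiring the penalty to be below \<open>t / K\<close> puts \<open>M\<close>
      within the radius of the Hausdorff distance.\<close>
    define K where "K = 6 + 2 * \<epsilon>"
    have K: "K > 0" using \<epsilon> by (simp add: K_def)
    have "\<forall>\<^sub>F j in sequentially. dist (y (r j)) x0 < t" using tendstoD[OF x0(2) t(1)] by simp
    moreover have "\<forall>\<^sub>F j in sequentially. dist (z (r j)) x0 < t" using tendstoD[OF x0(3) t(1)] by simp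
    moreover have "\<forall>\<^sub>F j in sequentially. real (Suc (r j)) * (norm (y (r j) - z (r j)))\<^sup>2 < t / K"
      using order_tendstoD(2)[OF pen] t K by simp
    ultimately have "\<forall>\<^sub>F j in sequentially. dist (y (r j)) x0 < t \<and> dist (z (r j)) x0 < t \<and>
        real (Suc (r j)) * (norm (y (r j) - z (r j)))\<^sup>2 < t / K" by eventually_elim simp
    then obtain i where i: "dist (y (r i)) x0 < t" "dist (z (r i)) x0 < t"
        "real (Suc (r i)) * (norm (y (r i) - z (r i)))\<^sup>2 < t / K"
      using eventually_happens'[OF sequentially_bot] by blast
    define \<alpha> where "\<alpha> = real (Suc (r i))"
    define Y where "Y = y (r i)"
    define Z where "Z = z (r i)"
    have \<alpha>: "\<alpha> \<ge> 1" by (simp add: \<alpha>_def)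
    have YZ: "Y \<in> ball x0 t" "Z \<in> ball x0 t" using i by (auto simp: Y_def Z_def dist_commute)
    then have YZ\<Omega>: "Y \<in> \<Omega>" "Z \<in> \<Omega>" using t \<rho>(2) by (auto simp: subset_iff)
    have small: "\<kappa> (r i) \<le> 1" "\<kappa> (r i) \<le> \<epsilon> / 4"
      by (auto simp: \<kappa>_def intro: min.coboundedI1)
    \<comment> \<open>Absorbing the remainders costs \<open>2 * \<eta>\<close> in each of the two
      matrices, in total \<open>\<epsilon> / 4\<close>.\<close>
    define \<eta> where "\<eta> = \<epsilon> / 16"
    have \<eta>: "\<eta> > 0" using \<epsilon> by (simp add: \<eta>_def)
    obtain p q A B where AB: "linear A" "linear B"
      and Alow: "\<And>h. - 4 * \<alpha> * (norm h)\<^sup>2 \<le> h \<bullet> A h" and Aup: "\<And>h. h \<bullet> A h \<le> (2 * \<alpha> + \<kappa> (r i)) * (norm h)\<^sup>2"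
      and sum: "\<And>h. h \<bullet> A h + h \<bullet> B h \<le> \<kappa> (r i) * (norm h)\<^sup>2"
      and jets: "\<exists>d>0. \<forall>h. norm h < d \<and> Y + h \<in> C \<longrightarrow> a (Y + h) \<le> a Y + p \<bullet> h + h \<bullet> A h / 2 + \<eta> * (norm h)\<^sup>2"
        "\<exists>d>0. \<forall>h. norm h < d \<and> Z + h \<in> C \<longrightarrow> b (Z + h) \<le> b Z + q \<bullet> h + h \<bullet> B h / 2 + \<eta> * (norm h)\<^sup>2"
      using Q[of "r i"] \<eta> unfolding Q_def \<alpha>_def Y_def Z_def by metis
    obtain A' where A': "A' \<in> sym_mats" "\<And>h. qform A' h = h \<bullet> A h" using symmetric_part[OF AB(1)] by blast
    obtain B' where B': "B' \<in> sym_mats" "\<And>h. qform B' h = h \<bullet> B h" using symmetric_part[OF AB(2)] by blast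
    \<comment> \<open>Passing from \<open>a\<close> back to \<open>v\<close> subtracts \<epsilon>.
      The term \<open>2 * \<eta>\<close> absorbs the remainder
      \<open>\<eta> * (norm h)\<^sup>2\<close>, as half of the form enters the jet. In
      \<open>N\<close> the signs are reversed because \<open>b\<close> is
      \<open>- u\<close>.\<close>
    define M where "M = A' + (2 * \<eta> - \<epsilon>) *\<^sub>R mat 1"
    define N where "N = - B' - (2 * \<eta>) *\<^sub>R mat 1"
    have MN: "M \<in> sym_mats" "N \<in> sym_mats" unfolding M_def N_def by (intro sym_mats_intros A' B')+
    have qM: "qform M h = h \<bullet> A h + (2 * \<eta> - \<epsilon>) * (norm h)\<^sup>2" for h by (simp add: M_def qform_simps A')
    have qN: "qform N h = - (h \<bullet> B h) - 2 * \<eta> * (norm h)\<^sup>2" for h by (simp add: N_def qform_simps B')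
    have M: "M \<in> Theta_plus F Y"
    proof -
      obtain d where "d > 0" and d: "\<And>h. norm h < d \<Longrightarrow> Y + h \<in> C \<Longrightarrow>
          a (Y + h) \<le> a Y + p \<bullet> h + h \<bullet> A h / 2 + \<eta> * (norm h)\<^sup>2" using jets(1) by blast
      show ?thesis
      proof (rule Theta_plus_of_jet[OF sub \<open>open \<Omega>\<close> YZ\<Omega>(1) MN(1) \<open>d > 0\<close>])
        fix h :: "real^'n" assume h: "norm h < d" "Y + h \<in> closure \<Omega>"
        have "(norm (Y + h))\<^sup>2 = (norm Y)\<^sup>2 + 2 * (Y \<bullet> h) + (norm h)\<^sup>2"
          unfolding power2_norm_eq_inner by (simp add: inner_add inner_commute)
        then have "v (Y + h) + \<epsilon> / 2 * ((norm Y)\<^sup>2 + 2 * (Y \<bullet> h) + (norm h)\<^sup>2)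
            \<le> v Y + \<epsilon> / 2 * (norm Y)\<^sup>2 + p \<bullet> h + h \<bullet> A h / 2 + \<eta> * (norm h)\<^sup>2"
          using d[OF h(1)] h(2) by (simp add: a_def C_def)
        then show "v (Y + h) \<le> v Y + (p - \<epsilon> *\<^sub>R Y) \<bullet> h + qform M h / 2"
          unfolding qM by (simp add: inner_diff_left field_simps)
      qed
    qed
    have N: "N \<in> Theta_minus F Z"
    proof -
      obtain d where "d > 0" and d: "\<And>h. norm h < d \<Longrightarrow> Z + h \<in> C \<Longrightarrow>
          b (Z + h) \<le> b Z + q \<bullet> h + h \<bullet> B h / 2 + \<eta> * (norm h)\<^sup>2" using jets(2) by blast
      show ?thesis
      proof (rule Theta_minus_of_jet[OF super \<open>open \<Omega>\<close> YZ\<Omega>(2) MN(2) \<open>d > 0\<close>])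
        fix h :: "real^'n" assume h: "norm h < d" "Z + h \<in> closure \<Omega>"
        show "u Z + (- q) \<bullet> h + qform N h / 2 \<le> u (Z + h)"
          unfolding qN using d[OF h(1)] h(2) by (simp add: b_def C_def field_simps)
      qed
    qed
    have "op_norm M \<le> K * \<alpha>"
    proof (rule op_norm_le_of_qform[OF MN(1)])
      show "\<bar>qform M h\<bar> \<le> K * \<alpha> * (norm h)\<^sup>2" for h
      proof -
        have "\<bar>h \<bullet> A h\<bar> \<le> (4 * \<alpha> + 1) * (norm h)\<^sup>2"
        proof -
          have "(2 * \<alpha> + \<kappa> (r i)) * (norm h)\<^sup>2 \<le> (4 * \<alpha> + 1) * (norm h)\<^sup>2"
            using small \<alpha> by (intro mult_right_mono) auto
          moreover have "(4 * \<alpha>) * (norm h)\<^sup>2 \<le> (4 * \<alpha> + 1) * (norm h)\<^sup>2"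
            by (intro mult_right_mono) auto
          ultimately show ?thesis using Alow[of h] Aup[of h] by (simp add: abs_le_iff)
        qed
        moreover have "\<bar>(2 * \<eta> - \<epsilon>) * (norm h)\<^sup>2\<bar> \<le> \<epsilon> * (norm h)\<^sup>2"
          unfolding abs_mult using \<epsilon> by (intro mult_mono) (auto simp: \<eta>_def)
        ultimately have "\<bar>qform M h\<bar> \<le> (4 * \<alpha> + 1) * (norm h)\<^sup>2 + \<epsilon> * (norm h)\<^sup>2"
          unfolding qM by linarith
        also have "\<dots> = (4 * \<alpha> + 1 + \<epsilon>) * (norm h)\<^sup>2" by (simp add: algebra_simps)
        also have "\<dots> \<le> K * \<alpha> * (norm h)\<^sup>2"
        proof (rule mult_right_mono)
          have "\<epsilon> * 1 \<le> \<epsilon> * \<alpha>" using \<epsilon> \<alpha> by (intro mult_left_mono) auto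
          moreover have "K * \<alpha> = 6 * \<alpha> + 2 * (\<epsilon> * \<alpha>)" by (simp add: K_def algebra_simps)
          ultimately show "4 * \<alpha> + 1 + \<epsilon> \<le> K * \<alpha>" using \<alpha> \<epsilon> by linarith
        qed simp
        finally show ?thesis .
      qed
    qed (use K \<alpha> in simp)
    then have radius: "ereal (op_norm M) < scaled_radius t Y Z"
    proof (cases "Y = Z")
      case False
      then have n: "(norm (Y - Z))\<^sup>2 > 0" by simp
      have "K * (\<alpha> * (norm (Y - Z))\<^sup>2) < t"
        using i(3) K unfolding \<alpha>_def Y_def Z_def by (simp add: pos_less_divide_eq mult.commute)
      then have "K * \<alpha> < t / (norm (Y - Z))\<^sup>2" using n by (simp add: pos_less_divide_eq mult.assoc)
      then show ?thesis using False \<open>op_norm M \<le> K * \<alpha>\<close> by (simp add: scaled_radius_def)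
    qed (simp add: scaled_radius_def)
    have "bdd_hausdorff (scaled_radius t Y Z) (Theta_plus F Y) (Theta_plus F Z)
        \<le> (SUP (x, y)\<in>ball x0 t \<times> ball x0 t. bdd_hausdorff (scaled_radius t x y) (Theta_plus F x) (Theta_plus F y))"
      using YZ by (intro SUP_upper2[of "(Y, Z)"]) auto
    then have "bdd_hausdorff (scaled_radius t Y Z) (Theta_plus F Y) (Theta_plus F Z) < ereal (\<epsilon> / 4)"
      using sup by (rule le_less_trans)
    then obtain X where X: "X \<in> Theta_plus F Z" "op_norm (M - X) < \<epsilon> / 4"
      using near_point_of_bdd_hausdorff[OF M MN(1) radius] by blast
    show False
    proof (rule Theta_strictly_ordered_False[OF assms(3) YZ\<Omega>(2) assms(4,5)[OF YZ\<Omega>(2)] X(1) N])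
      show "0 < \<epsilon> / 4" using \<epsilon> by simp
      \<comment> \<open>Of the margin \<epsilon>, one quarter goes to \<kappa>, one to the
        remainders and one to the Hausdorff distance; the last quarter is the strict gap.\<close>
      show "qform X h + \<epsilon> / 4 * (norm h)\<^sup>2 \<le> qform N h" for h
      proof -
        have "op_norm (M - X) * (norm h)\<^sup>2 \<le> \<epsilon> / 4 * (norm h)\<^sup>2" using X(2) by (intro mult_right_mono) auto
        then have "qform X h \<le> qform M h + \<epsilon> / 4 * (norm h)\<^sup>2"
          using abs_qform_le_op_norm[of "M - X" h] by (simp add: qform_simps)
        moreover have "\<kappa> (r i) * (norm h)\<^sup>2 \<le> \<epsilon> / 4 * (norm h)\<^sup>2" using small by (intro mult_right_mono) auto
        ultimately show ?thesis using sum[of h] unfolding qM qN \<eta>_def by (simp add: algebra_simps)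
      qed
    qed
  qed
qed

end
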